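(* For every integer $n\ge1$, the independence complex of the hexagonal grid graph $H^2_n=H_{1\times2\times n}$ satisfies $$\operatorname{Ind}(H^2_n)\simeq\begin{cases}\mathbb{S}^2\vee\mathbb{S}^2, & n=1;\\ \mathbb{S}^4\vee\mathbb{S}^4\vee\mathbb{S}^4, & n=2;\\ \mathbb{S}^5\vee\mathbb{S}^6, & n=3;\\ \Sigma^6\left(\operatorname{Ind}(Y_{n-3})\right)\vee\Sigma^4\left(\operatorname{Ind}(Y_{n-2})\right)\vee\Sigma^5\left(\operatorname{Ind}\left(H^2_{n-3}\right)\right), & n\ge4.\end{cases}$$
   Context: For a finite simple graph $G$, $\operatorname{Ind}(G)$ is the simplicial complex on $V(G)$ whose faces are the independent sets of $G$. For $n\ge1$, $H^2_n=H_{1\times 2\times n}$ is the graph with vertex set $\{v^1_1,\dots,v^1_{2n+1}\}\sqcup\{v^2_1,\dots,v^2_{2n+2}\}\sqcup\{v^3_1,\dots,v^3_{2n+1}\}$ and edges: $\{v^1_r,v^1_{r+1}\}$ and $\{v^3_r,v^3_{r+1}\}$ for $1\le r\le 2n$; $\{v^2_s,v^2_{s+1}\}$ for $1\le s\le 2n+1$; and $\{v^1_{2t-1},v^2_{2t}\}$ and $\{v^2_{2t-1},v^3_{2t-1}\}$ for $1\le t\le n+1$. $Y_n$ is the induced subgraph $H^2_n\setminus\{v^1_{2n},v^1_{2n+1},v^2_{2n+2}\}$, where $G\setminus S$ is the subgraph induced on $V(G)\setminus S$. $\Sigma^k$ is the $k$-fold (unreduced) suspension, $\vee$ the wedge sum,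 $\simeq$ homotopy equivalence. *)

theory Defs
  imports "HOL-Analysis.Analysis"
begin

section \<open>Graphs and independence complexes\<close>

text \<open>A finite simple graph is a pair of its vertex set and its set of edges, the edges being
  two-element sets of vertices.\<close>

type_synonym 'v graph = "'v set \<times> 'v set set"

definition delete_vertices :: "'v graph \<Rightarrow> 'v set \<Rightarrow> 'v graph" where
  "delete_vertices G S = (fst G - S, {e \<in> snd G. e \<subseteq> fst G - S})"

definition independent_complex :: "'v graph \<Rightarrow> 'v set set" where
  "independent_complex G = {A. A \<subseteq> fst G \<and> (\<forall>u\<in>A. \<forall>v\<in>A. {u, v} \<notin> snd G)}"

text \<open>Geometric realization of a finite abstract simplicial complex in barycentric coordinates.
  The topology is that of pointwise convergence; it is the usual (weak) topology because the
  complex has only finitely many vertices.\<close>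

definition geometric_realization :: "'v set set \<Rightarrow> ('v \<Rightarrow> real) topology" where
  "geometric_realization K = subtopology (powertop_real UNIV)
     {x. {v. x v \<noteq> 0} \<in> K \<and> (\<forall>v. 0 \<le> x v) \<and> (\<Sum>v | x v \<noteq> 0. x v) = 1}"

definition Ind :: "'v graph \<Rightarrow> ('v \<Rightarrow> real) topology" where
  "Ind G = geometric_realization (independent_complex G)"

section \<open>The hexagonal grid graphs\<close>

text \<open>The pair \<open>(i, r)\<close> is the vertex \<open>v\<^sup>i\<^sub>r\<close>.\<close>

definition hex_grid :: "nat \<Rightarrow> (nat \<times> nat) graph" where
  "hex_grid n =
    ({(1, r) |r. 1 \<le> r \<and> r \<le> 2 * n + 1} \<union>
     {(2, s) |s. 1 \<le> s \<and> s \<le> 2 * n + 2} \<union>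
     {(3, r) |r. 1 \<le> r \<and> r \<le> 2 * n + 1},
     {{(1, r), (1, r + 1)} |r. 1 \<le> r \<and> r \<le> 2 * n} \<union>
     {{(3, r), (3, r + 1)} |r. 1 \<le> r \<and> r \<le> 2 * n} \<union>
     {{(2, s), (2, s + 1)} |s. 1 \<le> s \<and> s \<le> 2 * n + 1} \<union>
     {{(1, 2 * t - 1), (2, 2 * t)} |t. 1 \<le> t \<and> t \<le> n + 1} \<union>
     {{(2, 2 * t - 1), (3, 2 * t - 1)} |t. 1 \<le> t \<and> t \<le> n + 1})"

definition Y_graph :: "nat \<Rightarrow> (nat \<times> nat) graph" where
  "Y_graph n = delete_vertices (hex_grid n) {(1, 2 * n), (1, 2 * n + 1), (2, 2 * n + 2)}"

section \<open>Quotients, suspensions and wedge sums\<close>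

definition quotient_topology :: "'a topology \<Rightarrow> ('a \<Rightarrow> 'b) \<Rightarrow> 'b topology" where
  "quotient_topology X q =
    topology (\<lambda>U. U \<subseteq> q ` topspace X \<and> openin X {x \<in> topspace X. q x \<in> U})"

lemma openin_quotient_topology:
  "openin (quotient_topology X q) U \<longleftrightarrow>
     U \<subseteq> q ` topspace X \<and> openin X {x \<in> topspace X. q x \<in> U}"
proof -
  have "openin X {x \<in> topspace X. q x \<in> S \<inter> T}"
    if "openin X {x \<in> topspace X. q x \<in> S}" "openin X {x \<in> topspace X. q x \<in> T}" for S T
  proof -
    have "{x \<in> topspace X. q x \<in> S \<inter> T} = {x \<in> topspace X. q x \<in> S} \<inter> {x \<in> topspace X. q x \<in> T}"
      by blast
    then show ?thesis
      using that by (simp only: openin_Int)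
  qed
  moreover have "openin X {x \<in> topspace X. q x \<in> \<Union>\<K>}"
    if "\<forall>K\<in>\<K>. openin X {x \<in> topspace X. q x \<in> K}" for \<K>
  proof -
    have "{x \<in> topspace X. q x \<in> \<Union>\<K>} = (\<Union>K\<in>\<K>. {x \<in> topspace X. q x \<in> K})"
      by blast
    then show ?thesis
      using that by (simp only:) (rule openin_Union, blast)
  qed
  ultimately have "istopology (\<lambda>U. U \<subseteq> q ` topspace X \<and> openin X {x \<in> topspace X. q x \<in> U})"
    unfolding istopology_def by (intro conjI allI impI) (blast, blast, blast, blast)
  then show ?thesis
    unfolding quotient_topology_def by (simp only: topology_inverse')
qed

lemma topspace_quotient_topology: "topspace (quotient_topology X q) = q ` topspace X"
proof
  show "topspace (quotient_topology X q) \<subseteq> q ` topspace X"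
    using openin_topspace [of "quotient_topology X q"] by (simp only: openin_quotient_topology)
  have "{x \<in> topspace X. q x \<in> q ` topspace X} = topspace X"
    by blast
  then have "openin (quotient_topology X q) (q ` topspace X)"
    by (simp add: openin_quotient_topology)
  then show "q ` topspace X \<subseteq> topspace (quotient_topology X q)"
    by (rule openin_subset)
qed

lemma quotient_map_quotient_topology: "quotient_map X (quotient_topology X q) q"
  by (auto simp: quotient_map_def topspace_quotient_topology openin_quotient_topology)

text \<open>Points of iterated suspensions of a space with points in \<open>'a\<close>. The type is recursive so that
  all iterated suspensions of a space have the same type of points; \<open>Base\<close> embeds the original
  space, and \<open>Level x t\<close> is the class of \<open>(x, t)\<close> for \<open>0 < t < 1\<close>.\<close>

datatype 'a susp_point = Base 'a | South | North | Level "'a susp_point" real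

text \<open>The unreduced suspension: \<open>X \<times> [0, 1]\<close> with each of the ends \<open>X \<times> {0}\<close> and \<open>X \<times> {1}\<close>
  collapsed to a point. (The suspension of the empty space is empty here.)\<close>

definition suspension :: "'a susp_point topology \<Rightarrow> 'a susp_point topology" where
  "suspension X = quotient_topology (prod_topology X (top_of_set {0..1::real}))
     (\<lambda>(x, t). if t = 0 then South else if t = 1 then North else Level x t)"

definition iterated_suspension :: "nat \<Rightarrow> 'a topology \<Rightarrow> 'a susp_point topology" where
  "iterated_suspension k X = (suspension ^^ k) (quotient_topology X Base)"

text \<open>The wedge sum of the spaces \<open>Xs ! i\<close> with base points \<open>ps ! i\<close>: the disjoint sum in which all
  base points are identified to the single point \<open>None\<close>.\<close>

definition wedge_sum :: "'a topology list \<Rightarrow> 'a list \<Rightarrow> (nat \<times> 'a) option topology" where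
  "wedge_sum Xs ps = quotient_topology (sum_topology (\<lambda>i. Xs ! i) {..<length Xs})
     (\<lambda>(i, x). if x = ps ! i then None else Some (i, x))"

text \<open>A wedge sum written without base points, as in \<open>X \<simeq> Y\<^sub>1 \<or> \<dots> \<or> Y\<^sub>m\<close>, is read as: the
  \<open>Y\<^sub>i\<close> are nonempty, and the equivalence holds for every choice of base points.\<close>

definition homotopy_equivalent_wedge :: "'a topology \<Rightarrow> 'b topology list \<Rightarrow> bool" where
  "homotopy_equivalent_wedge X Ys \<longleftrightarrow>
     (\<forall>Y\<in>set Ys. topspace Y \<noteq> {}) \<and>
     (\<forall>ps. list_all2 (\<lambda>p Y. p \<in> topspace Y) ps Ys \<longrightarrow>
        X homotopy_equivalent_space wedge_sum Ys ps)"

end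

theory Submission
  imports Defs
begin

text \<open>
  \<open>Ind G\<close> is the realization of the clique complex of the complement of \<open>G\<close>. If a face \<open>\<sigma>\<close> and
  a vertex \<open>w\<close> are such that \<open>w\<close> can be added to every face containing \<open>\<sigma>\<close>, then all faces
  containing \<open>\<sigma>\<close> can be removed by a straight-line deformation; all the homotopy equivalences between
  complexes are chains of such moves. In particular, if the neighbours of \<open>v\<close> in the clique
  graph lie in a set that collapses to a point without using \<open>v\<close>, then the star of \<open>v\<close> can be
  detached, and the complex becomes the wedge of the complex without \<open>v\<close> and the suspension of the
  link of \<open>v\<close>. For \<open>n \<ge> 4\<close> (and \<open>n = 2\<close>) this is applied to \<open>v\<^sup>2\<^sub>2\<^sub>n\<close> and then to
  \<open>v\<^sup>1\<^sub>2\<^sub>n\<close>. The two links and the remaining graph fold to disjoint unions of edges with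
  \<open>H\<^sub>n\<^sub>-\<^sub>3\<close>, \<open>Y\<^sub>n\<^sub>-\<^sub>2\<close> and \<open>Y\<^sub>n\<^sub>-\<^sub>3\<close>, and each such edge is a suspension.
  For \<open>n = 1\<close> and \<open>n = 3\<close> a single splitting suffices.
\<close>

section \<open>Elementary moves on geometric realizations\<close>

text \<open>The equivalence has to hold for every choice of base points. Therefore nothing is glued
  at a point before the very end: the pieces hang by edges on an extra vertex \<open>None\<close>,
  and moving a base point means changing the edges at \<open>None\<close>, which is again a removal
  of faces. It can be done because any two vertices of a summand are at distance at most two
  (\<open>diameter_two\<close>), every summand being a suspension or a sphere of positive dimension.
  That a link contracts in the rest of the complex is certified by a set \<open>U\<close> between
  the link and \<open>V - {v}\<close> that folds to one vertex \<open>a\<close>. Both splittings use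
  the same \<open>a\<close>, so the remaining graph stays attached there throughout. The exponents
  6, 4, 5 count isolated edges. What remains after the two splittings folds to
  \<open>Y\<^sub>n\<^sub>-\<^sub>3\<close> and six edges; the links fold to
  \<open>Y\<^sub>n\<^sub>-\<^sub>2\<close> and three edges, and to
  \<open>H\<^sub>n\<^sub>-\<^sub>3\<close> and four edges, and for a link the splitting itself
  contributes one more suspension.\<close>

definition supp :: "('v \<Rightarrow> real) \<Rightarrow> 'v set" where
  "supp x = {v. x v \<noteq> 0}"

definition finite_complex :: "'v set set \<Rightarrow> bool" where
  "finite_complex K \<longleftrightarrow> finite (\<Union>K) \<and> (\<forall>\<sigma>\<in>K. \<forall>\<tau>. \<tau> \<subseteq> \<sigma> \<longrightarrow> \<tau> \<in> K)"

lemma finite_complex_down: "finite_complex K \<Longrightarrow> \<sigma> \<in> K \<Longrightarrow> \<tau> \<subseteq> \<sigma> \<Longrightarrow> \<tau> \<in> K"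
  unfolding finite_complex_def by blast

lemma topspace_realization:
  assumes "finite V" "\<Union>K \<subseteq> V"
  shows "x \<in> topspace (geometric_realization K) \<longleftrightarrow> supp x \<in> K \<and> (\<forall>v. 0 \<le> x v) \<and> sum x V = 1"
proof -
  have "(\<Sum>v | x v \<noteq> 0. x v) = sum x V" if "supp x \<in> K"
    using assms that by (intro sum.mono_neutral_left) (auto simp: supp_def)
  then show ?thesis
    by (auto simp: geometric_realization_def supp_def)
qed

lemma continuous_map_into_realization:
  "continuous_map X (geometric_realization K) f \<longleftrightarrow>
     (\<forall>v. continuous_map X euclideanreal (\<lambda>x. f x v)) \<and> f \<in> topspace X \<rightarrow> topspace (geometric_realization K)"
  unfolding geometric_realization_def continuous_map_in_subtopology
  by (auto simp: continuous_map_componentwise_UNIV)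

lemma continuous_map_realization_coordinate [continuous_intros]:
  "continuous_map (geometric_realization K) euclideanreal (\<lambda>x. x v)"
  unfolding geometric_realization_def
  by (intro continuous_map_from_subtopology continuous_map_product_projection) auto

lemma Hausdorff_realization: "Hausdorff_space (geometric_realization K)"
  unfolding geometric_realization_def
  by (intro Hausdorff_space_subtopology) (simp add: Hausdorff_space_product_topology)

lemma continuous_map_Min:
  assumes "finite S" "S \<noteq> {}" "\<And>v. v \<in> S \<Longrightarrow> continuous_map X euclideanreal (f v)"
  shows "continuous_map X euclideanreal (\<lambda>x. Min ((\<lambda>v. f v x) ` S))"
  using assms
proof (induction S rule: finite_ne_induct)
  case (insert u S)
  then have "continuous_map X euclideanreal (\<lambda>x. min (f u x) (Min ((\<lambda>v. f v x) ` S)))"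
    by (intro continuous_map_real_min) auto
  then show ?case
    using insert.hyps by simp
qed auto

text \<open>A closed face is a closed subset of the cube of all functions into
  \<open>{0..1}\<close>, which is compact by Tychonoff's theorem even for infinitely many
  coordinates, and there are finitely many faces. Compactness later turns continuous surjections
  onto Hausdorff spaces into quotient maps.\<close>

lemma compact_realization:
  assumes "finite_complex K"
  shows "compact_space (geometric_realization K)"
proof -
  let ?V = "\<Union>K" and ?P = "powertop_real (UNIV :: 'a set)"
  define F where "F \<sigma> = {x \<in> topspace ?P. (\<forall>v. x v \<in> {0..1}) \<and> (\<forall>v\<in>-\<sigma>. x v = 0) \<and> sum x \<sigma> = 1}" for \<sigma> :: "'a set"
  have fin: "finite K" and finV: "finite ?V"
    using assms finite_UnionD by (auto simp: finite_complex_def)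
  have cc: "continuous_map ?P euclideanreal (\<lambda>x. x v)" for v
    by (intro continuous_map_product_projection) auto
  have comp: "compactin ?P (F \<sigma>)" if "\<sigma> \<in> K" for \<sigma>
  proof (rule closed_compactin)
    show "compactin ?P (Pi\<^sub>E UNIV (\<lambda>_. {0..1}))"
      by (simp add: compactin_PiE)
    show "F \<sigma> \<subseteq> Pi\<^sub>E UNIV (\<lambda>_. {0..1})"
      by (auto simp: F_def)
    have "finite \<sigma>" using that finV by (meson Union_upper finite_subset)
    then have "continuous_map ?P euclideanreal (\<lambda>x. sum x \<sigma>)"
      by (intro continuous_map_sum cc)
    then have 1: "closedin ?P {x \<in> topspace ?P. sum x \<sigma> \<in> {1}}"
      by (rule closedin_continuous_map_preimage) auto
    have 2: "closedin ?P {x \<in> topspace ?P. x v \<in> {0..1}}" for v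
      by (rule closedin_continuous_map_preimage [OF cc]) auto
    have 3: "closedin ?P {x \<in> topspace ?P. x v \<in> {0}}" for v
      by (rule closedin_continuous_map_preimage [OF cc]) auto
    have "F \<sigma> = {x \<in> topspace ?P. sum x \<sigma> \<in> {1}} \<inter> (\<Inter>v. {x \<in> topspace ?P. x v \<in> {0..1}}) \<inter>
       (topspace ?P \<inter> (\<Inter>v\<in>-\<sigma>. {x \<in> topspace ?P. x v \<in> {0}}))"
      by (auto simp: F_def)
    \<comment> \<open>\<open>closedin_Inter\<close> wants a nonempty family, and this one would be
      empty if \<open>\<sigma>\<close> were the whole type; hence the inserted
      \<open>topspace ?P\<close>.\<close>
    moreover have "closedin ?P (\<Inter> (insert (topspace ?P) ((\<lambda>v. {x \<in> topspace ?P. x v \<in> {0}}) ` (-\<sigma>))))"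
      using 3 closedin_topspace [of ?P] by (intro closedin_Inter) (blast | clarsimp)+
    then have "closedin ?P (topspace ?P \<inter> (\<Inter>v\<in>-\<sigma>. {x \<in> topspace ?P. x v \<in> {0}}))"
      by simp
    ultimately show "closedin ?P (F \<sigma>)"
      using 1 2 by (auto intro!: closedin_Int closedin_INT)
  qed
  have eq: "topspace (geometric_realization K) = (\<Union>\<sigma>\<in>K. F \<sigma>)"
  proof (intro equalityI subsetI)
    fix x assume "x \<in> topspace (geometric_realization K)"
    then have x: "supp x \<in> K" "\<And>v. 0 \<le> x v" "sum x ?V = 1"
      using topspace_realization [OF finV, of K x] by auto
    have "x v \<le> sum x ?V" if "v \<in> ?V" for v
      using x finV that by (intro member_le_sum) auto
    moreover have "x v = 0" if "v \<notin> ?V" for v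
      using that x by (auto simp: supp_def)
    ultimately have "x v \<le> 1" for v
      using x by (metis zero_le_one)
    moreover have "sum x (supp x) = sum x ?V"
      using x finV by (intro sum.mono_neutral_left) (auto simp: supp_def)
    ultimately have "x \<in> F (supp x)"
      using x by (auto simp: F_def supp_def)
    then show "x \<in> (\<Union>\<sigma>\<in>K. F \<sigma>)"
      using x by blast
  next
    fix x assume "x \<in> (\<Union>\<sigma>\<in>K. F \<sigma>)"
    then obtain \<sigma> where \<sigma>: "\<sigma> \<in> K" "x \<in> F \<sigma>" by blast
    then have "supp x \<subseteq> \<sigma>" by (auto simp: F_def supp_def)
    then have "supp x \<in> K" using finite_complex_down [OF assms \<sigma>(1)] by blast
    moreover have "sum x \<sigma> = sum x ?V"
      using \<sigma> finV by (intro sum.mono_neutral_left) (auto simp: F_def)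
    ultimately show "x \<in> topspace (geometric_realization K)"
      using \<sigma> topspace_realization [OF finV, of K x] by (auto simp: F_def)
  qed
  have "compactin ?P (\<Union>\<sigma>\<in>K. F \<sigma>)"
    using fin comp by (intro compactin_Union) auto
  then have "compactin ?P (topspace (geometric_realization K))"
    using eq by simp
  moreover have "topspace (geometric_realization K) \<subseteq> {x. {v. x v \<noteq> 0} \<in> K \<and> (\<forall>v. 0 \<le> x v) \<and> (\<Sum>v | x v \<noteq> 0. x v) = 1}"
    by (auto simp: geometric_realization_def)
  ultimately have "compactin (geometric_realization K) (topspace (geometric_realization K))"
    unfolding geometric_realization_def by (simp add: compactin_subtopology)
  then show ?thesis by (simp add: compact_space_def)
qed

text \<open>Since \<open>supp x\<close> and \<open>supp (r x)\<close> lie in a common face, the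
  segment from \<open>x\<close> to \<open>r x\<close> stays in the realization and the affine
  homotopy is available.\<close>

lemma realization_deformation_retract:
  assumes K: "finite_complex K" and "L \<subseteq> K"
    and r: "continuous_map (geometric_realization K) (geometric_realization K) r"
    and L: "\<And>x. x \<in> topspace (geometric_realization K) \<Longrightarrow> supp (r x) \<in> L"
    and seg: "\<And>x. x \<in> topspace (geometric_realization K) \<Longrightarrow> supp x \<union> supp (r x) \<in> K"
    and fix_r: "\<And>x. x \<in> topspace (geometric_realization K) \<Longrightarrow> supp x \<in> L \<Longrightarrow> r x = x"
  shows "geometric_realization K homotopy_equivalent_space geometric_realization L"
proof -
  let ?X = "geometric_realization K" and ?Y = "geometric_realization L" and ?V = "\<Union>K"
  have finV: "finite ?V" using K by (auto simp: finite_complex_def)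
  have LV: "\<Union>L \<subseteq> ?V" using \<open>L \<subseteq> K\<close> by blast
  note X = topspace_realization [OF finV, of K, simplified]
  note Y = topspace_realization [OF finV LV]
  have rX: "r x \<in> topspace ?X" if "x \<in> topspace ?X" for x
    using r that by (auto simp: continuous_map_def)
  have rc: "continuous_map ?X euclideanreal (\<lambda>x. r x v)" for v
    using r by (simp add: continuous_map_into_realization)
  let ?h = "\<lambda>(s::real, x) v. (1 - s) * x v + s * r x v"
  have "continuous_map (prod_topology (top_of_set {0..1}) ?X) ?X ?h"
    unfolding continuous_map_into_realization
  proof (intro conjI allI Pi_I)
    fix v
    have c1: "continuous_map (prod_topology (top_of_set {0..1}) ?X) euclideanreal fst"
      by (metis continuous_map_fst_of continuous_map_from_subtopology continuous_map_id id_comp continuous_map_in_subtopology continuous_map_fst)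
    have c2: "continuous_map (prod_topology (top_of_set {0..1::real}) ?X) euclideanreal (\<lambda>z. snd z v)"
      using continuous_map_compose [OF continuous_map_snd continuous_map_realization_coordinate]
      by (simp add: o_def)
    have c3: "continuous_map (prod_topology (top_of_set {0..1::real}) ?X) euclideanreal (\<lambda>z. r (snd z) v)"
      using continuous_map_compose [OF continuous_map_snd rc] by (simp add: o_def)
    show "continuous_map (prod_topology (top_of_set {0..1}) ?X) euclideanreal (\<lambda>z. ?h z v)"
      unfolding case_prod_unfold by (intro continuous_intros c1 c2 c3)
  next
    fix z assume z: "z \<in> topspace (prod_topology (top_of_set {0..1::real}) ?X)"
    obtain s x where sx: "z = (s, x)" by (cases z)
    have s: "0 \<le> s" "s \<le> 1" and x: "x \<in> topspace ?X"
      using z sx by auto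
    have "supp (?h z) \<subseteq> supp x \<union> supp (r x)"
      by (auto simp: sx supp_def)
    then have "supp (?h z) \<in> K"
      using seg [OF x] finite_complex_down [OF K] by blast
    moreover have "0 \<le> ?h z v" for v
      using s x rX [OF x] X by (auto simp: sx)
    moreover have "sum (?h z) ?V = (1 - s) * sum x ?V + s * sum (r x) ?V"
      by (simp add: sx sum.distrib sum_distrib_left)
    then have "sum (?h z) ?V = 1"
      using x rX [OF x] X by simp
    ultimately show "?h z \<in> topspace ?X"
      using X by blast
  qed
  then have "homotopic_with (\<lambda>x. True) ?X ?X id r"
    unfolding homotopic_with_def by (intro exI [of _ ?h]) auto
  then have hom: "homotopic_with (\<lambda>x. True) ?X ?X r id"
    by (rule homotopic_with_symD)
  have "retraction_maps ?X ?Y r id"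
    unfolding retraction_maps_def
  proof (intro conjI ballI)
    show "continuous_map ?X ?Y r"
      unfolding continuous_map_into_realization using rc L rX X Y by auto
    show "continuous_map ?Y ?X id"
      unfolding continuous_map_into_realization id_def
      using \<open>L \<subseteq> K\<close> X Y continuous_map_realization_coordinate by auto
    show "r (id y) = y" if "y \<in> topspace ?Y" for y
      using that X Y fix_r \<open>L \<subseteq> K\<close> by auto
  qed
  then show ?thesis
    using hom deformation_retract_imp_homotopy_equivalent_space by blast
qed

text \<open>Pushing mass from the vertices of \<open>\<sigma>\<close> to \<open>w\<close>, until one of them vanishes, retracts onto the
  subcomplex of the faces that do not contain \<open>\<sigma>\<close>.\<close>

lemma realization_remove_face:
  assumes K: "finite_complex K" and \<sigma>: "finite \<sigma>" "\<sigma> \<noteq> {}" "w \<notin> \<sigma>"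
    and w: "\<And>\<tau>. \<tau> \<in> K \<Longrightarrow> \<sigma> \<subseteq> \<tau> \<Longrightarrow> insert w \<tau> \<in> K"
  shows "geometric_realization K homotopy_equivalent_space geometric_realization {\<tau> \<in> K. \<not> \<sigma> \<subseteq> \<tau>}"
proof -
  let ?X = "geometric_realization K" and ?V = "\<Union>K"
  have finV: "finite ?V" using K by (auto simp: finite_complex_def)
  note X = topspace_realization [OF finV, of K, simplified]
  \<comment> \<open>On the realization, \<open>t x\<close> is positive exactly when
    \<open>\<sigma> \<subseteq> supp x\<close>, so \<open>r\<close> is the identity on the part to
    be kept. The factor \<open>card \<sigma>\<close> gives \<open>w\<close> what the vertices of
    \<open>\<sigma>\<close> lose, which keeps the total mass 1.\<close>
  define t where "t x = Min (x ` \<sigma>)" for x :: "'a \<Rightarrow> real"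
  define r where "r x v = (if v \<in> \<sigma> then x v - t x else if v = w then x w + real (card \<sigma>) * t x else x v)"
    for x v
  have tle: "t x \<le> x v" if "v \<in> \<sigma>" for x v
    using that \<sigma> by (simp add: t_def)
  have tattain: "\<exists>v\<in>\<sigma>. t x = x v" for x
    using \<sigma> Min_in [of "x ` \<sigma>"] unfolding t_def by (meson finite_imageI image_iff image_is_empty)
  have t0: "t x = 0" if h: "\<not> \<sigma> \<subseteq> supp x" "\<forall>v. 0 \<le> x v" for x
  proof -
    obtain v where "v \<in> \<sigma>" "x v = 0" using h by (auto simp: supp_def)
    then show ?thesis using tle [of v x] tattain [of x] h by (metis order.antisym)
  qed
  have rid: "r x = x" if "t x = 0" for x
    using that by (auto simp: r_def)
  have tnn: "0 \<le> t x" if "\<forall>v. 0 \<le> x v" for x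
    using tattain [of x] that by auto
  have sub: "supp x \<union> supp (r x) \<in> K \<and> supp (r x) \<in> {\<tau> \<in> K. \<not> \<sigma> \<subseteq> \<tau>} \<and> (\<forall>v. 0 \<le> r x v) \<and> sum (r x) ?V = 1"
    if "x \<in> topspace ?X" for x
  proof (cases "\<sigma> \<subseteq> supp x")
    case False
    then have "r x = x" using that X t0 rid by blast
    then show ?thesis using that False X by auto
  next
    case True
    have x: "supp x \<in> K" "\<And>v. 0 \<le> x v" "sum x ?V = 1"
      using that X by auto
    have iw: "insert w (supp x) \<in> K" using w x True by blast
    have "supp x \<union> supp (r x) \<subseteq> insert w (supp x)"
      using True by (auto simp: r_def supp_def split: if_splits)
    then have 1: "supp x \<union> supp (r x) \<in> K" "supp (r x) \<in> K"
      using finite_complex_down [OF K iw] by auto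
    obtain v where v: "v \<in> \<sigma>" "t x = x v" using tattain by blast
    then have "r x v = 0" by (simp add: r_def)
    then have 2: "\<not> \<sigma> \<subseteq> supp (r x)" using v by (auto simp: supp_def)
    have 3: "0 \<le> r x v" for v
      using x tle [of v x] tnn [of x] by (auto simp: r_def)
    have sV: "\<sigma> \<subseteq> ?V" "w \<in> ?V" using True x iw by auto
    have "sum (r x) ?V = sum (r x) \<sigma> + sum (r x) {w} + sum (r x) (?V - \<sigma> - {w})"
      using finV sV \<sigma> sum.subset_diff [of \<sigma> ?V "r x"] sum.subset_diff [of "{w}" "?V - \<sigma>" "r x"] by simp
    also have "\<dots> = (sum x \<sigma> - real (card \<sigma>) * t x) + (x w + real (card \<sigma>) * t x) + sum x (?V - \<sigma> - {w})"
    proof -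
      have "sum (r x) \<sigma> = sum x \<sigma> - real (card \<sigma>) * t x"
        by (simp add: r_def sum_subtractf)
      moreover have "sum (r x) {w} = x w + real (card \<sigma>) * t x" using \<sigma> by (simp add: r_def)
      moreover have "sum (r x) (?V - \<sigma> - {w}) = sum x (?V - \<sigma> - {w})"
        by (intro sum.cong) (auto simp: r_def)
      ultimately show ?thesis by simp
    qed
    also have "\<dots> = sum x \<sigma> + sum x {w} + sum x (?V - \<sigma> - {w})" by simp
    also have "\<dots> = sum x ?V"
      using finV sV \<sigma> sum.subset_diff [of \<sigma> ?V x] sum.subset_diff [of "{w}" "?V - \<sigma>" x] by simp
    finally show ?thesis using 1 2 3 x by auto
  qed
  have tc: "continuous_map ?X euclideanreal t"
    unfolding t_def using \<sigma> by (intro continuous_map_Min continuous_map_realization_coordinate)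
  have "continuous_map ?X euclideanreal (\<lambda>x. r x v)" for v
    unfolding r_def by (cases "v \<in> \<sigma>"; cases "v = w"; simp) (intro continuous_intros tc)+
  then have "continuous_map ?X ?X r"
    unfolding continuous_map_into_realization using sub X by auto
  moreover have "r x = x" if "supp x \<in> {\<tau> \<in> K. \<not> \<sigma> \<subseteq> \<tau>}" "x \<in> topspace ?X" for x
    using that t0 rid X by auto
  ultimately show ?thesis
    using realization_deformation_retract [OF K, of "{\<tau> \<in> K. \<not> \<sigma> \<subseteq> \<tau>}" r] sub by auto
qed

section \<open>Clique complexes\<close>

definition cliques :: "'v set \<Rightarrow> ('v \<Rightarrow> 'v \<Rightarrow> bool) \<Rightarrow> 'v set set" where
  "cliques V R = {A. A \<subseteq> V \<and> (\<forall>u\<in>A. \<forall>v\<in>A. u \<noteq> v \<longrightarrow> R u v)}"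

abbreviation clique_space :: "'v set \<Rightarrow> ('v \<Rightarrow> 'v \<Rightarrow> bool) \<Rightarrow> ('v \<Rightarrow> real) topology" where
  "clique_space V R \<equiv> geometric_realization (cliques V R)"

lemma Union_cliques: "\<Union>(cliques V R) = V"
proof -
  have "{v} \<in> cliques V R" if "v \<in> V" for v
    using that by (simp add: cliques_def)
  then show ?thesis unfolding cliques_def by blast
qed

lemma clique_subset: "\<tau> \<in> cliques V R \<Longrightarrow> x \<in> \<tau> \<Longrightarrow> x \<in> V"
  by (auto simp: cliques_def)

lemma clique_rel: "\<tau> \<in> cliques V R \<Longrightarrow> x \<in> \<tau> \<Longrightarrow> y \<in> \<tau> \<Longrightarrow> x \<noteq> y \<Longrightarrow> R x y"
  by (simp add: cliques_def)

lemma finite_complex_cliques: "finite V \<Longrightarrow> finite_complex (cliques V R)"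
  unfolding finite_complex_def Union_cliques by (auto simp: cliques_def)

lemma topspace_clique_space:
  "finite V \<Longrightarrow> x \<in> topspace (clique_space V R) \<longleftrightarrow>
     supp x \<in> cliques V R \<and> (\<forall>v. 0 \<le> x v) \<and> sum x V = 1"
  by (rule topspace_realization) (simp_all add: Union_cliques)

lemma clique_space_zero:
  assumes "finite V" "x \<in> topspace (clique_space V R)" "v \<notin> V"
  shows "x v = 0"
proof -
  have "supp x \<in> cliques V R"
    using assms(2) topspace_clique_space [OF assms(1)] by blast
  then have "v \<notin> supp x"
    using clique_subset assms(3) by metis
  then show ?thesis by (simp add: supp_def)
qed

lemma cliques_cong:
  assumes "\<And>x y. x \<in> V \<Longrightarrow> y \<in> V \<Longrightarrow> x \<noteq> y \<Longrightarrow> R x y \<longleftrightarrow> R' x y"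
  shows "cliques V R = cliques V R'"
  unfolding cliques_def using assms by (intro Collect_cong) (metis subsetD)

text \<open>\<open>R\<close> is compatibility, that is, non-adjacency in the graph. In terms of the
  graph this is the condition of the fold lemma: \<open>u\<close> and \<open>w\<close> are not
  adjacent, and each neighbour of \<open>w\<close> is a neighbour of \<open>u\<close>.\<close>

definition dominated :: "('v \<Rightarrow> 'v \<Rightarrow> bool) \<Rightarrow> 'v set \<Rightarrow> 'v \<Rightarrow> 'v \<Rightarrow> bool" where
  "dominated R V u w \<longleftrightarrow> u \<in> V \<and> w \<in> V \<and> u \<noteq> w \<and> R u w \<and>
     (\<forall>x\<in>V. x \<noteq> u \<longrightarrow> x \<noteq> w \<longrightarrow> R u x \<longrightarrow> R w x)"

lemma insert_clique:
  assumes "\<tau> \<in> cliques V R" "w \<in> V" "symp R" "\<And>x. x \<in> \<tau> \<Longrightarrow> x \<noteq> w \<Longrightarrow> R w x"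
  shows "insert w \<tau> \<in> cliques V R"
proof -
  have "R u v" if "u \<in> insert w \<tau>" "v \<in> insert w \<tau>" "u \<noteq> v" for u v
    using that clique_rel [OF assms(1)] assms(4) sympD [OF assms(3)] by (metis insertE)
  then show ?thesis
    using clique_subset [OF assms(1)] assms(2) by (auto simp: cliques_def)
qed

lemma remove_dominated_vertex:
  assumes "finite V" "symp R" "dominated R V u w"
  shows "clique_space V R homotopy_equivalent_space clique_space (V - {u}) R"
proof -
  have w: "w \<in> V" "u \<noteq> w" "R w u" and dom: "\<And>x. x \<in> V \<Longrightarrow> x \<noteq> u \<Longrightarrow> x \<noteq> w \<Longrightarrow> R u x \<Longrightarrow> R w x"
    using assms(3) sympD [OF assms(2)] unfolding dominated_def by blast+
  have "insert w \<tau> \<in> cliques V R" if \<tau>: "\<tau> \<in> cliques V R" "{u} \<subseteq> \<tau>" for \<tau>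
  proof (rule insert_clique)
    show "R w x" if "x \<in> \<tau>" "x \<noteq> w" for x
      using \<tau>(2) clique_subset [OF \<tau>(1) that(1)] clique_rel [OF \<tau>(1), of u x] that w dom [of x]
      by (cases "x = u") simp_all
  qed (use assms(2) w \<tau> in auto)
  moreover have "{\<tau> \<in> cliques V R. \<not> {u} \<subseteq> \<tau>} = cliques (V - {u}) R"
    unfolding cliques_def by blast
  ultimately show ?thesis
    using realization_remove_face [of "cliques V R" "{u}" w] w finite_complex_cliques [OF assms(1)]
    by simp
qed

text \<open>The dominating vertices lie outside \<open>C\<close> and domination passes to smaller
  vertex sets, so every witness survives and the order of removal is irrelevant.\<close>

lemma remove_dominated_vertices:
  assumes "finite V" "symp R" "C \<subseteq> V" "\<And>c. c \<in> C \<Longrightarrow> \<exists>w\<in>V - C. dominated R V c w"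
  shows "clique_space V R homotopy_equivalent_space clique_space (V - C) R"
proof -
  have "finite C" using assms finite_subset by blast
  have "clique_space V R homotopy_equivalent_space clique_space (V - D) R" if "D \<subseteq> C" for D
    using finite_subset [OF that \<open>finite C\<close>] that
  proof (induction D rule: finite_induct)
    case empty
    then show ?case by (simp add: homotopy_equivalent_space_refl)
  next
    case (insert c D)
    obtain w where w: "w \<in> V - C" "dominated R V c w"
      using assms(4) insert.prems by blast
    then have "dominated R (V - D) c w"
      using insert by (auto simp: dominated_def)
    then have "clique_space (V - D) R homotopy_equivalent_space clique_space (V - D - {c}) R"
      using assms by (intro remove_dominated_vertex) auto
    moreover have "V - D - {c} = V - insert c D" by blast
    ultimately show ?case
      using insert homotopy_eqv_trans by (metis insert_subset)
  qed
  then show ?thesis by blast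
qed

text \<open>The link of the edge is a cone with apex \<open>w\<close>, so
  \<open>realization_remove_face\<close> applies to the face \<open>{u, v}\<close>. Forbidding this
  face gives a clique complex again, because that amounts to deleting one pair from the
  relation.\<close>

lemma remove_edge:
  assumes "finite V" "symp R" "u \<in> V" "v \<in> V" "u \<noteq> v"
    and w: "w \<in> V" "w \<noteq> u" "w \<noteq> v" "R w u" "R w v"
    and dom: "\<And>x. x \<in> V \<Longrightarrow> x \<noteq> u \<Longrightarrow> x \<noteq> v \<Longrightarrow> x \<noteq> w \<Longrightarrow> R x u \<Longrightarrow> R x v \<Longrightarrow> R w x"
  shows "clique_space V R homotopy_equivalent_space clique_space V (\<lambda>x y. R x y \<and> {x, y} \<noteq> {u, v})"
proof -
  have "insert w \<tau> \<in> cliques V R" if \<tau>: "\<tau> \<in> cliques V R" "{u, v} \<subseteq> \<tau>" for \<tau>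
  proof (rule insert_clique)
    show "R w x" if x: "x \<in> \<tau>" "x \<noteq> w" for x
    proof (cases "x = u \<or> x = v")
      case False
      then have "R x u" "R x v" "x \<in> V"
        using \<tau>(2) clique_subset [OF \<tau>(1) x(1)] clique_rel [OF \<tau>(1) x(1)] by simp_all
      then show ?thesis using dom False x by blast
    qed (use w in blast)
  qed (use assms(2) w \<tau> in auto)
  moreover have "{\<tau> \<in> cliques V R. \<not> {u, v} \<subseteq> \<tau>} = cliques V (\<lambda>x y. R x y \<and> {x, y} \<noteq> {u, v})"
  proof (intro set_eqI iffI)
    fix \<tau> assume \<tau>: "\<tau> \<in> {\<tau> \<in> cliques V R. \<not> {u, v} \<subseteq> \<tau>}"
    then have "{x, y} \<noteq> {u, v}" if "x \<in> \<tau>" "y \<in> \<tau>" for x y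
      using that by (metis (no_types, lifting) empty_subsetI insert_subset mem_Collect_eq)
    then show "\<tau> \<in> cliques V (\<lambda>x y. R x y \<and> {x, y} \<noteq> {u, v})"
      using \<tau> by (simp add: cliques_def)
  next
    fix \<tau> assume \<tau>: "\<tau> \<in> cliques V (\<lambda>x y. R x y \<and> {x, y} \<noteq> {u, v})"
    then have "\<not> {u, v} \<subseteq> \<tau>"
      using clique_rel [OF \<tau>, of u v] \<open>u \<noteq> v\<close> by blast
    then show "\<tau> \<in> {\<tau> \<in> cliques V R. \<not> {u, v} \<subseteq> \<tau>}"
      using \<tau> by (simp add: cliques_def)
  qed
  ultimately show ?thesis
    using realization_remove_face [of "cliques V R" "{u, v}" w] w finite_complex_cliques [OF assms(1)]
    by simp
qed

text \<open>The conditions on \<open>G\<close> protect all edges that make \<open>w\<close> a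
  witness: none of them is ever removed, while the common neighbours of \<open>u\<close> and
  \<open>v\<close> can only become fewer. Each witness thus stays valid whatever has been removed
  before.\<close>

lemma remove_edges:
  assumes "finite V" "symp R"
    and dom: "\<And>u v. u \<in> V \<Longrightarrow> v \<in> V \<Longrightarrow> u \<noteq> v \<Longrightarrow> R u v \<Longrightarrow> G u v \<Longrightarrow>
      \<exists>w\<in>V. w \<noteq> u \<and> w \<noteq> v \<and> R u w \<and> R v w \<and> \<not> G w u \<and> \<not> G u w \<and> \<not> G w v \<and> \<not> G v w \<and>
        (\<forall>x\<in>V. x \<noteq> u \<longrightarrow> x \<noteq> v \<longrightarrow> x \<noteq> w \<longrightarrow> R u x \<longrightarrow> R v x \<longrightarrow> R w x \<and> \<not> G w x \<and> \<not> G x w)"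
  shows "clique_space V R homotopy_equivalent_space clique_space V (\<lambda>x y. R x y \<and> \<not> G x y \<and> \<not> G y x)"
proof -
  define E where "E = {{u, v} |u v. u \<in> V \<and> v \<in> V \<and> u \<noteq> v \<and> R u v \<and> G u v}"
  have "finite E"
    by (rule finite_subset [of _ "Pow V"]) (use \<open>finite V\<close> in \<open>auto simp: E_def\<close>)
  have Rs: "R x y \<longleftrightarrow> R y x" for x y using \<open>symp R\<close> by (auto dest: sympD)
  have EG: "G x y \<or> G y x" if "{x, y} \<in> E" for x y
    using that by (auto simp: E_def doubleton_eq_iff)
  have "clique_space V R homotopy_equivalent_space clique_space V (\<lambda>x y. R x y \<and> {x, y} \<notin> D)"
    if "D \<subseteq> E" for D
    using finite_subset [OF that \<open>finite E\<close>] that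
  proof (induction D rule: finite_induct)
    case empty
    then show ?case by (simp add: homotopy_equivalent_space_refl)
  next
    case (insert e D)
    let ?S = "\<lambda>x y. R x y \<and> {x, y} \<notin> D"
    obtain u v where uv: "e = {u, v}" "u \<in> V" "v \<in> V" "u \<noteq> v" "R u v" "G u v"
      using insert.prems by (auto simp: E_def)
    from dom [OF uv(2-6)] obtain w where w: "w \<in> V" "w \<noteq> u" "w \<noteq> v" "R u w" "R v w"
      "\<not> G w u" "\<not> G u w" "\<not> G w v" "\<not> G v w"
      and wx: "\<And>x. x \<in> V \<Longrightarrow> x \<noteq> u \<Longrightarrow> x \<noteq> v \<Longrightarrow> x \<noteq> w \<Longrightarrow> R u x \<Longrightarrow> R v x \<Longrightarrow>
        R w x \<and> \<not> G w x \<and> \<not> G x w"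
      by blast
    have DE: "{x, y} \<notin> D" if "\<not> G x y" "\<not> G y x" for x y
      using EG insert.prems that by blast
    have "clique_space V ?S homotopy_equivalent_space
        clique_space V (\<lambda>x y. ?S x y \<and> {x, y} \<noteq> {u, v})"
    proof (rule remove_edge [of V ?S u v w])
      show "symp ?S" using \<open>symp R\<close> by (auto simp: symp_def insert_commute)
      show "?S w u" "?S w v" using w DE Rs by blast+
      show "?S w x" if "x \<in> V" "x \<noteq> u" "x \<noteq> v" "x \<noteq> w" "?S x u" "?S x v" for x
        using wx [of x] that DE Rs by blast
    qed (use uv w \<open>finite V\<close> in auto)
    moreover have "(\<lambda>x y. ?S x y \<and> {x, y} \<noteq> {u, v}) = (\<lambda>x y. R x y \<and> {x, y} \<notin> insert e D)"
      using uv by auto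
    ultimately show ?case
      using insert homotopy_eqv_trans by (metis (no_types, lifting) insert_subset)
  qed
  from this [of E] have "clique_space V R homotopy_equivalent_space clique_space V (\<lambda>x y. R x y \<and> {x, y} \<notin> E)"
    by blast
  moreover have "cliques V (\<lambda>x y. R x y \<and> {x, y} \<notin> E) = cliques V (\<lambda>x y. R x y \<and> \<not> G x y \<and> \<not> G y x)"
  proof (rule cliques_cong)
    fix x y assume "x \<in> V" "y \<in> V" "x \<noteq> y"
    then have "{x, y} \<in> E" if "R x y" "G x y \<or> G y x"
      using that Rs unfolding E_def by blast
    then show "R x y \<and> {x, y} \<notin> E \<longleftrightarrow> R x y \<and> \<not> G x y \<and> \<not> G y x"
      using EG by blast
  qed
  ultimately show ?thesis by simp
qed

section \<open>Relabelling of vertices and fold sequences\<close>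

definition relabel :: "'v set \<Rightarrow> ('v \<Rightarrow> 'w) \<Rightarrow> ('v \<Rightarrow> real) \<Rightarrow> 'w \<Rightarrow> real" where
  "relabel V f x = (\<lambda>u. if u \<in> f ` V then x (inv_into V f u) else 0)"

lemma continuous_map_relabel:
  assumes "finite V" "inj_on f V"
    and R: "\<And>x y. x \<in> V \<Longrightarrow> y \<in> V \<Longrightarrow> x \<noteq> y \<Longrightarrow> R x y \<Longrightarrow> R' (f x) (f y)"
  shows "continuous_map (clique_space V R) (clique_space (f ` V) R') (relabel V f)"
  unfolding continuous_map_into_realization
proof (intro conjI allI Pi_I)
  fix u
  show "continuous_map (clique_space V R) euclideanreal (\<lambda>x. relabel V f x u)"
    unfolding relabel_def by (cases "u \<in> f ` V") (auto intro: continuous_intros)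
next
  fix x assume "x \<in> topspace (clique_space V R)"
  then have x: "supp x \<in> cliques V R" "\<forall>v. 0 \<le> x v" "sum x V = 1"
    using topspace_clique_space [OF \<open>finite V\<close>] by auto
  have "relabel V f x (f v) = x v" if "v \<in> V" for v
    using that assms by (simp add: relabel_def)
  then have "sum (relabel V f x) (f ` V) = 1"
    using x assms by (simp add: sum.reindex)
  moreover have "supp (relabel V f x) \<subseteq> f ` supp x"
    using assms by (auto simp: relabel_def supp_def)
  then have "supp (relabel V f x) \<in> cliques (f ` V) R'"
    using x(1) R unfolding cliques_def by (smt (verit) image_iff image_mono mem_Collect_eq subset_iff)
  ultimately show "relabel V f x \<in> topspace (clique_space (f ` V) R')"
    using x assms by (auto simp: topspace_clique_space relabel_def)
qed

lemma clique_space_relabel: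
  assumes "finite V" "inj_on f V"
    and R: "\<And>x y. x \<in> V \<Longrightarrow> y \<in> V \<Longrightarrow> x \<noteq> y \<Longrightarrow> R x y \<longleftrightarrow> R' (f x) (f y)"
  shows "clique_space V R homeomorphic_space clique_space (f ` V) R'"
proof -
  let ?g = "inv_into V f"
  have gV: "?g ` f ` V = V" and ginj: "inj_on ?g (f ` V)"
    using assms by (auto intro: inj_on_inv_into)
  have "continuous_map (clique_space V R) (clique_space (f ` V) R') (relabel V f)"
    using assms by (intro continuous_map_relabel) auto
  moreover have "continuous_map (clique_space (f ` V) R') (clique_space (?g ` f ` V) R) (relabel (f ` V) ?g)"
  proof (rule continuous_map_relabel)
    show "R (?g u) (?g u')" if "u \<in> f ` V" "u' \<in> f ` V" "u \<noteq> u'" "R' u u'" for u u'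
      using that R [of "?g u" "?g u'"] by (metis f_inv_into_f inv_into_into)
  qed (use assms ginj in auto)
  moreover have "relabel (f ` V) ?g (relabel V f x) = x" if "x \<in> topspace (clique_space V R)" for x
  proof
    fix v
    have "v \<notin> V \<Longrightarrow> x v = 0"
      using that clique_space_zero assms(1) by metis
    moreover have "inv_into (f ` V) ?g v = f v" if "v \<in> V"
      using that assms ginj by (intro inv_into_f_eq) auto
    ultimately show "relabel (f ` V) ?g (relabel V f x) v = x v"
      unfolding relabel_def [of "f ` V"] gV using assms by (simp add: relabel_def)
  qed
  moreover have "relabel V f (relabel (f ` V) ?g y) = y" if "y \<in> topspace (clique_space (f ` V) R')" for y
  proof
    fix u
    have "u \<notin> f ` V \<Longrightarrow> y u = 0"
      using that clique_space_zero [OF finite_imageI [OF assms(1)]] by metis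
    moreover have "inv_into (f ` V) ?g (?g u) = u" if "u \<in> f ` V"
      using that ginj by simp
    ultimately show "relabel V f (relabel (f ` V) ?g y) u = y u"
      unfolding relabel_def [of "f ` V"] gV by (auto simp: relabel_def inv_into_into)
  qed
  ultimately show ?thesis
    unfolding homeomorphic_space_def homeomorphic_maps_def gV by blast
qed

text \<open>A sequence of dominated vertices, kept as combinatorial data instead of a homotopy
  equivalence because it is replayed in other complexes: on the set of vertices joined to
  \<open>None\<close>, on one piece of a bouquet, and inside a suspension.\<close>

inductive folds :: "('v \<Rightarrow> 'v \<Rightarrow> bool) \<Rightarrow> 'v set \<Rightarrow> 'v set \<Rightarrow> bool" for R where
  folds_refl: "folds R U U"
| folds_step: "dominated R U x w \<Longrightarrow> folds R (U - {x}) U' \<Longrightarrow> folds R U U'"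

lemma folds_subset: "folds R U U' \<Longrightarrow> U' \<subseteq> U"
  by (induction rule: folds.induct) auto

lemma folds_cone:
  assumes "finite U" "a \<in> U" "\<And>x. x \<in> U \<Longrightarrow> x \<noteq> a \<Longrightarrow> R x a \<and> R a x"
  shows "folds R U {a}"
proof -
  have "folds R (insert a U) {a}" if "finite U" "\<And>x. x \<in> U \<Longrightarrow> x \<noteq> a \<and> R x a \<and> R a x" for U
    using that
  proof (induction U rule: finite_induct)
    case empty
    then show ?case by (simp add: folds_refl)
  next
    case (insert x U)
    then have "dominated R (insert a (insert x U)) x a"
      by (auto simp: dominated_def)
    moreover have "insert a (insert x U) - {x} = insert a U"
      using insert by auto
    ultimately show ?case using insert folds_step by (metis insertCI)
  qed
  from this [of "U - {a}"] show ?thesis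
    using assms by (auto simp: insert_absorb)
qed

section \<open>Splitting off the suspension of a link\<close>

text \<open>If the link \<open>N\<close> of \<open>v\<close> lies in the link of a further vertex \<open>p\<close>, then the star of \<open>v\<close> can be
  detached and becomes a suspension of \<open>N\<close> (on the vertices \<open>Copy l\<close>, with poles \<open>Near\<close> and \<open>Far\<close>)
  that hangs on \<open>p\<close>. The flags of \<open>cell_rel\<close> switch on the edges from \<open>N\<close> to \<open>Far\<close>, those from \<open>N\<close> to
  the copies (a prism), and those from \<open>p\<close> to the copies; \<open>Far\<close> plays the role of \<open>v\<close>.\<close>

datatype 'v cell = Old 'v | Copy 'v | Near | Far

fun cell_rel :: "bool \<Rightarrow> bool \<Rightarrow> bool \<Rightarrow> ('v \<Rightarrow> 'v \<Rightarrow> bool) \<Rightarrow> 'v \<Rightarrow> 'v set \<Rightarrow> 'v cell \<Rightarrow> 'v cell \<Rightarrow> bool" where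
  "cell_rel a b c R p N (Old x) (Old y) = R x y"
| "cell_rel a b c R p N (Old x) (Copy l) = (b \<and> x \<in> N \<and> (x = l \<or> R x l) \<or> c \<and> x = p)"
| "cell_rel a b c R p N (Copy l) (Old x) = (b \<and> x \<in> N \<and> (x = l \<or> R l x) \<or> c \<and> x = p)"
| "cell_rel a b c R p N (Old x) Far = (a \<and> x \<in> N)"
| "cell_rel a b c R p N Far (Old x) = (a \<and> x \<in> N)"
| "cell_rel a b c R p N (Old x) Near = (x = p)"
| "cell_rel a b c R p N Near (Old x) = (x = p)"
| "cell_rel a b c R p N (Copy k) (Copy l) = R k l"
| "cell_rel a b c R p N (Copy k) Near = True"
| "cell_rel a b c R p N (Copy k) Far = True"
| "cell_rel a b c R p N Near (Copy k) = True"
| "cell_rel a b c R p N Far (Copy k) = True"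
| "cell_rel a b c R p N Near Near = False"
| "cell_rel a b c R p N Near Far = False"
| "cell_rel a b c R p N Far Near = False"
| "cell_rel a b c R p N Far Far = False"

lemma symp_cell_rel: "symp R \<Longrightarrow> symp (cell_rel a b c R p N)"
proof (rule sympI)
  fix x y assume "symp R" "cell_rel a b c R p N x y"
  then show "cell_rel a b c R p N y x"
    by (cases x; cases y) (auto dest: sympD)
qed

text \<open>The star of \<open>v\<close> is a cone glued along \<open>N\<close>, and
  \<open>N\<close> contracts to \<open>p\<close> within the star of \<open>p\<close>. The prism
  between \<open>N\<close> and its copies carries this homotopy: the cone is moved from
  \<open>N\<close> to the copies, the copies are pulled to \<open>p\<close>, and an edge is inserted
  between \<open>p\<close> and the resulting suspension.\<close>

lemma split_link:
  assumes V: "finite V" "symp R" "v \<in> V" "p \<in> V" "p \<noteq> v" "\<not> R v p"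
    and N: "N = {x \<in> V. x \<noteq> v \<and> R v x}" and pN: "\<And>x. x \<in> N \<Longrightarrow> R p x"
  shows "clique_space V R homotopy_equivalent_space
    clique_space (Old ` (V - {v}) \<union> Copy ` N \<union> {Near, Far}) (cell_rel False False False R p N)"
proof -
  let ?W = "Old ` (V - {v})" and ?C = "Copy ` N" and ?r = "\<lambda>a b c. cell_rel a b c R p N"
  have fin: "finite N" using V N by auto
  have Nx: "x \<in> V \<and> x \<noteq> v \<and> R v x" "R x v" "R x p" if "x \<in> N" for x
    using that N pN \<open>symp R\<close> by (auto dest: sympD)
  have xN: "x \<in> N" if "x \<in> V" "x \<noteq> v" "R v x \<or> R x v" for x
    using that N \<open>symp R\<close> by (auto dest: sympD)
  have p: "p \<notin> N" using V N by auto
  have NV: "N \<subseteq> V - {v}" using N by auto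
  have sy: "symp (?r a b c)" for a b c using \<open>symp R\<close> by (rule symp_cell_rel)
  \<comment> \<open>No copies are present yet, so only the first flag matters here.\<close>
  have "clique_space V R homeomorphic_space
      clique_space ((\<lambda>x. if x = v then Far else Old x) ` V) (?r True True True)"
  proof (rule clique_space_relabel)
    show "R x y \<longleftrightarrow> ?r True True True (if x = v then Far else Old x) (if y = v then Far else Old y)"
      if "x \<in> V" "y \<in> V" "x \<noteq> y" for x y
    proof -
      have "R v y \<longleftrightarrow> y \<in> N" if "y \<noteq> v" using \<open>y \<in> V\<close> that Nx(1) xN by blast
      moreover have "R x v \<longleftrightarrow> x \<in> N" if "x \<noteq> v" using \<open>x \<in> V\<close> that Nx(2) xN by blast
      ultimately show ?thesis using \<open>x \<noteq> y\<close> by auto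
    qed
  qed (use V in \<open>auto simp: inj_on_def\<close>)
  moreover have "(\<lambda>x. if x = v then Far else Old x) ` V = insert Far ?W"
    using V by auto
  ultimately have 1: "clique_space V R homotopy_equivalent_space
      clique_space (insert Far ?W) (?r True True True)"
    using homeomorphic_imp_homotopy_equivalent_space by fastforce
  let ?V1 = "insert Far (?W \<union> ?C)" and ?V2 = "?W \<union> ?C \<union> {Near, Far}"
  \<comment> \<open>The copies are added by reading a vertex removal backwards:
    \<open>Copy l\<close> is dominated by \<open>Old l\<close>.\<close>
  have "clique_space ?V1 (?r True True True) homotopy_equivalent_space
      clique_space (?V1 - ?C) (?r True True True)"
  proof (rule remove_dominated_vertices)
    show "\<exists>w\<in>?V1 - ?C. dominated (?r True True True) ?V1 c w" if c: "c \<in> ?C" for c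
    proof -
      obtain l where l: "l \<in> N" "c = Copy l" using c by auto
      then have "dominated (?r True True True) ?V1 c (Old l)"
        using NV Nx(3) [OF l(1)] unfolding dominated_def by auto
      then show ?thesis using l NV by blast
    qed
  qed (use fin V sy in auto)
  moreover have "?V1 - ?C = insert Far ?W" by auto
  ultimately have 2: "clique_space ?V1 (?r True True True) homotopy_equivalent_space
      clique_space (insert Far ?W) (?r True True True)" by simp
  \<comment> \<open>\<open>Far\<close> is cut off from \<open>N\<close>. The witness for the edge
    from \<open>Old l\<close> to \<open>Far\<close> is \<open>Copy l\<close>.\<close>
  let ?G = "\<lambda>x y. (\<exists>l. x = Old l) \<and> y = Far"
  have "clique_space ?V1 (?r True True True) homotopy_equivalent_space
      clique_space ?V1 (\<lambda>x y. ?r True True True x y \<and> \<not> ?G x y \<and> \<not> ?G y x)"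
  proof (rule remove_edges)
    fix x y assume h: "?r True True True x y" "?G x y"
    then obtain l where l: "l \<in> N" "x = Old l" "y = Far" by auto
    show "\<exists>w\<in>?V1. w \<noteq> x \<and> w \<noteq> y \<and> ?r True True True x w \<and> ?r True True True y w \<and>
        \<not> ?G w x \<and> \<not> ?G x w \<and> \<not> ?G w y \<and> \<not> ?G y w \<and>
        (\<forall>z\<in>?V1. z \<noteq> x \<longrightarrow> z \<noteq> y \<longrightarrow> z \<noteq> w \<longrightarrow> ?r True True True x z \<longrightarrow> ?r True True True y z \<longrightarrow>
          ?r True True True w z \<and> \<not> ?G w z \<and> \<not> ?G z w)"
      by (rule bexI [of _ "Copy l"]) (use l p in auto)
  qed (use fin V sy in auto)
  moreover have "cliques ?V1 (\<lambda>x y. ?r True True True x y \<and> \<not> ?G x y \<and> \<not> ?G y x) =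
      cliques ?V1 (?r False True True)"
    by (rule cliques_cong) auto
  ultimately have 3: "clique_space ?V1 (?r True True True) homotopy_equivalent_space
      clique_space ?V1 (?r False True True)" by simp
  \<comment> \<open>The prism is cut. Now that \<open>Far\<close> is not joined to \<open>N\<close>,
    all common neighbours of \<open>Old k\<close> and \<open>Copy l\<close> are compatible with
    \<open>Old p\<close>.\<close>
  let ?G = "\<lambda>x y. (\<exists>k. k \<noteq> p \<and> x = Old k) \<and> (\<exists>l. y = Copy l)"
  have "clique_space ?V1 (?r False True True) homotopy_equivalent_space
      clique_space ?V1 (\<lambda>x y. ?r False True True x y \<and> \<not> ?G x y \<and> \<not> ?G y x)"
  proof (rule remove_edges)
    fix x y assume h: "x \<in> ?V1" "y \<in> ?V1" "?r False True True x y" "?G x y"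
    then obtain k l where l: "x = Old k" "y = Copy l" "k \<noteq> p" by blast
    then have kl: "k \<in> N" "l \<in> N" using h by auto
    show "\<exists>w\<in>?V1. w \<noteq> x \<and> w \<noteq> y \<and> ?r False True True x w \<and> ?r False True True y w \<and>
        \<not> ?G w x \<and> \<not> ?G x w \<and> \<not> ?G w y \<and> \<not> ?G y w \<and>
        (\<forall>z\<in>?V1. z \<noteq> x \<longrightarrow> z \<noteq> y \<longrightarrow> z \<noteq> w \<longrightarrow> ?r False True True x z \<longrightarrow> ?r False True True y z \<longrightarrow>
          ?r False True True w z \<and> \<not> ?G w z \<and> \<not> ?G z w)"
      by (rule bexI [of _ "Old p"]) (use l kl p pN Nx(3) V in auto)
  qed (use fin V sy in auto)
  moreover have "cliques ?V1 (\<lambda>x y. ?r False True True x y \<and> \<not> ?G x y \<and> \<not> ?G y x) =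
      cliques ?V1 (?r False False True)"
    by (rule cliques_cong) (use p in auto)
  ultimately have 4: "clique_space ?V1 (?r False True True) homotopy_equivalent_space
      clique_space ?V1 (?r False False True)" by simp
  \<comment> \<open>\<open>Near\<close> is added backwards as well. It sees only
    \<open>Old p\<close> and the copies, and \<open>Old p\<close> still sees all copies.\<close>
  have "clique_space ?V2 (?r False False True) homotopy_equivalent_space
      clique_space (?V2 - {Near}) (?r False False True)"
    by (rule remove_dominated_vertex [where w = "Old p"])
      (use fin V sy in \<open>auto simp: dominated_def\<close>)
  moreover have "?V2 - {Near} = ?V1" by auto
  ultimately have 5: "clique_space ?V2 (?r False False True) homotopy_equivalent_space
      clique_space ?V1 (?r False False True)" by simp
  \<comment> \<open>The edges from \<open>Old p\<close> to the copies go, with witness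
    \<open>Near\<close>; only the edge from \<open>Old p\<close> to \<open>Near\<close> connects the
    two parts afterwards.\<close>
  let ?G = "\<lambda>x y. x = Old p \<and> (\<exists>l. y = Copy l)"
  have "clique_space ?V2 (?r False False True) homotopy_equivalent_space
      clique_space ?V2 (\<lambda>x y. ?r False False True x y \<and> \<not> ?G x y \<and> \<not> ?G y x)"
  proof (rule remove_edges)
    fix x y assume h: "?r False False True x y" "?G x y"
    then obtain l where l: "x = Old p" "y = Copy l" by auto
    show "\<exists>w\<in>?V2. w \<noteq> x \<and> w \<noteq> y \<and> ?r False False True x w \<and> ?r False False True y w \<and>
        \<not> ?G w x \<and> \<not> ?G x w \<and> \<not> ?G w y \<and> \<not> ?G y w \<and>
        (\<forall>z\<in>?V2. z \<noteq> x \<longrightarrow> z \<noteq> y \<longrightarrow> z \<noteq> w \<longrightarrow> ?r False False True x z \<longrightarrow> ?r False False True y z \<longrightarrow>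
          ?r False False True w z \<and> \<not> ?G w z \<and> \<not> ?G z w)"
      by (rule bexI [of _ Near]) (use l in auto)
  qed (use fin V sy in auto)
  moreover have "cliques ?V2 (\<lambda>x y. ?r False False True x y \<and> \<not> ?G x y \<and> \<not> ?G y x) =
      cliques ?V2 (?r False False False)"
    by (rule cliques_cong) auto
  ultimately have 6: "clique_space ?V2 (?r False False True) homotopy_equivalent_space
      clique_space ?V2 (?r False False False)" by simp
  note [trans] = homotopy_eqv_trans
  have "clique_space V R homotopy_equivalent_space clique_space (insert Far ?W) (?r True True True)"
    by (fact 1)
  also have "\<dots> homotopy_equivalent_space clique_space ?V1 (?r True True True)"
    by (rule iffD1 [OF homotopy_equivalent_space_sym 2])
  also note 3
  also note 4
  also have "clique_space ?V1 (?r False False True) homotopy_equivalent_space clique_space ?V2 (?r False False True)"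
    by (rule iffD1 [OF homotopy_equivalent_space_sym 5])
  also note 6
  finally show ?thesis .
qed

section \<open>Clique complexes attached to a common vertex\<close>

text \<open>The pieces \<open>V i\<close>, for \<open>i \<in> I\<close>, are made disjoint by tagging; \<open>None\<close> is joined to the part \<open>A i\<close> of
  each of them.\<close>

definition pieces :: "'i set \<Rightarrow> ('i \<Rightarrow> 'v set) \<Rightarrow> ('i \<times> 'v) option set" where
  "pieces I V = insert None {Some (i, x) |i x. i \<in> I \<and> x \<in> V i}"

fun bouquet_rel :: "('v \<Rightarrow> 'v \<Rightarrow> bool) \<Rightarrow> ('i \<Rightarrow> 'v set) \<Rightarrow> ('i \<times> 'v) option \<Rightarrow> ('i \<times> 'v) option \<Rightarrow> bool" where
  "bouquet_rel R A None None = False"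
| "bouquet_rel R A None (Some (i, x)) = (x \<in> A i)"
| "bouquet_rel R A (Some (i, x)) None = (x \<in> A i)"
| "bouquet_rel R A (Some (i, x)) (Some (j, y)) = (i = j \<and> R x y)"

abbreviation bouquet :: "'i set \<Rightarrow> ('i \<Rightarrow> 'v set) \<Rightarrow> ('v \<Rightarrow> 'v \<Rightarrow> bool) \<Rightarrow> ('i \<Rightarrow> 'v set) \<Rightarrow>
    (('i \<times> 'v) option \<Rightarrow> real) topology" where
  "bouquet I V R A \<equiv> clique_space (pieces I V) (bouquet_rel R A)"

lemma None_in_pieces [simp]: "None \<in> pieces I V"
  by (simp add: pieces_def)

lemma Some_in_pieces [simp]: "Some (i, x) \<in> pieces I V \<longleftrightarrow> i \<in> I \<and> x \<in> V i"
  by (simp add: pieces_def)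

lemma finite_pieces:
  assumes "finite I" "\<And>i. i \<in> I \<Longrightarrow> finite (V i)"
  shows "finite (pieces I V)"
proof -
  have "pieces I V = insert None (\<Union>i\<in>I. (\<lambda>x. Some (i, x)) ` V i)"
    by (auto simp: pieces_def)
  then show ?thesis using assms by simp
qed

lemma symp_bouquet_rel:
  assumes "symp R" shows "symp (bouquet_rel R A)"
proof (rule sympI)
  fix u v assume "bouquet_rel R A u v"
  then show "bouquet_rel R A v u"
    using assms by (cases u; cases v) (auto dest: sympD)
qed

lemma bouquet_cases:
  assumes "u = None \<Longrightarrow> P" "\<And>i x. u = Some (i, x) \<Longrightarrow> P"
  shows P
  using assms by (cases u) auto

lemma pieces_cases:
  assumes "u \<in> pieces I V"
  obtains "u = None" | i x where "u = Some (i, x)" "i \<in> I" "x \<in> V i"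
  using assms by (auto simp: pieces_def)

text \<open>Common neighbours of \<open>None\<close> and a vertex \<open>x\<close> of
  \<open>U\<close> lie in \<open>U\<close>. Hence domination of \<open>x\<close> within
  \<open>U\<close> alone, not within the whole piece, suffices to remove the edge from
  \<open>None\<close> to \<open>x\<close>.\<close>

lemma bouquet_shrink_attachment:
  assumes fin: "finite I" "\<And>i. i \<in> I \<Longrightarrow> finite (V i)" and R: "symp R" and i: "i \<in> I"
    and "folds R U U'" "U \<subseteq> V i"
  shows "bouquet I V R (A(i := U)) homotopy_equivalent_space bouquet I V R (A(i := U'))"
  using assms(5,6)
proof (induction rule: folds.induct)
  case (folds_refl U)
  then show ?case by (simp add: homotopy_equivalent_space_refl)
next
  case (folds_step U x w U')
  have d: "x \<in> U" "w \<in> U" "x \<noteq> w" "R x w" "R w x"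
    and dom: "\<And>y. y \<in> U \<Longrightarrow> y \<noteq> x \<Longrightarrow> y \<noteq> w \<Longrightarrow> R x y \<Longrightarrow> R w y"
    using folds_step.hyps(1) sympD [OF R] unfolding dominated_def by blast+
  have rs: "R y z" if "R z y" for y z using that R by (auto dest: sympD)
  let ?u = "None" and ?v = "Some (i, x)" and ?w = "Some (i, w)" and ?S = "bouquet_rel R (A(i := U))"
  have "bouquet I V R (A(i := U)) homotopy_equivalent_space
      clique_space (pieces I V) (\<lambda>y z. ?S y z \<and> {y, z} \<noteq> {?u, ?v})"
  proof (rule remove_edge [where w = ?w])
    fix y assume y: "y \<in> pieces I V" "y \<noteq> ?u" "y \<noteq> ?v" "y \<noteq> ?w" "?S y ?u" "?S y ?v"
    then show "?S ?w y"
      using dom rs by (cases rule: pieces_cases [OF y(1)]) (simp_all add: fun_upd_def split: if_splits)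
  qed (use d i folds_step.prems finite_pieces [OF fin] symp_bouquet_rel [OF R] in auto)
  moreover have "cliques (pieces I V) (\<lambda>y z. ?S y z \<and> {y, z} \<noteq> {?u, ?v}) =
      cliques (pieces I V) (bouquet_rel R (A(i := U - {x})))"
  proof (rule cliques_cong)
    fix y z
    show "?S y z \<and> {y, z} \<noteq> {?u, ?v} \<longleftrightarrow> bouquet_rel R (A(i := U - {x})) y z"
      by (rule bouquet_cases [of y]; rule bouquet_cases [of z]) (auto simp: doubleton_eq_iff)
  qed
  ultimately have "bouquet I V R (A(i := U)) homotopy_equivalent_space bouquet I V R (A(i := U - {x}))"
    by simp
  moreover have "bouquet I V R (A(i := U - {x})) homotopy_equivalent_space bouquet I V R (A(i := U'))"
    by (intro folds_step.IH) (use folds_step.prems in auto)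
  ultimately show ?case by (rule homotopy_eqv_trans)
qed

text \<open>The removed vertices are not joined to \<open>None\<close>, so a domination inside the
  piece remains one in the bouquet. This is what \<open>A i \<subseteq> U'\<close> ensures.\<close>

lemma bouquet_fold_piece:
  assumes fin: "finite I" "\<And>i. i \<in> I \<Longrightarrow> finite (V i)" and R: "symp R" and i: "i \<in> I"
    and "folds R (V i) U'" "A i \<subseteq> U'"
  shows "bouquet I V R A homotopy_equivalent_space bouquet I (V(i := U')) R A"
proof -
  have "bouquet I (V(i := U)) R A homotopy_equivalent_space bouquet I (V(i := U')) R A"
    if "folds R U U'" "A i \<subseteq> U'" "finite U" for U U'
    using that
  proof (induction rule: folds.induct)
    case (folds_refl U)
    then show ?case by (simp add: homotopy_equivalent_space_refl)
  next
    case (folds_step U x w U')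
    have d: "x \<in> U" "w \<in> U" "x \<noteq> w" "R x w"
      and dom: "\<And>y. y \<in> U \<Longrightarrow> R x y \<Longrightarrow> y = x \<or> y = w \<or> R w y"
      using folds_step.hyps(1) unfolding dominated_def by blast+
    have "x \<notin> A i"
      using folds_subset [OF folds_step.hyps(2)] folds_step.prems by blast
    then have "dominated (bouquet_rel R A) (pieces I (V(i := U))) (Some (i, x)) (Some (i, w))"
      unfolding dominated_def using d i by (auto elim!: pieces_cases dest: dom)
    moreover have "finite (pieces I (V(i := U)))"
      using fin folds_step.prems by (intro finite_pieces) auto
    ultimately have "bouquet I (V(i := U)) R A homotopy_equivalent_space
        clique_space (pieces I (V(i := U)) - {Some (i, x)}) (bouquet_rel R A)"
      using symp_bouquet_rel [OF R] by (intro remove_dominated_vertex)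
    moreover have "pieces I (V(i := U)) - {Some (i, x)} = pieces I (V(i := U - {x}))"
      by (auto simp: pieces_def split: if_splits)
    ultimately have "bouquet I (V(i := U)) R A homotopy_equivalent_space bouquet I (V(i := U - {x})) R A"
      by simp
    moreover have "bouquet I (V(i := U - {x})) R A homotopy_equivalent_space bouquet I (V(i := U')) R A"
      by (intro folds_step.IH) (use folds_step.prems in auto)
    ultimately show ?case by (rule homotopy_eqv_trans)
  qed
  from this [of "V i" U'] show ?thesis
    using assms by simp
qed

text \<open>\<open>None\<close> hangs on the single vertex \<open>a\<close> and is dominated by
  it.\<close>

lemma bouquet_single:
  assumes "finite V" "symp R" "a \<in> V"
  shows "clique_space V R homotopy_equivalent_space bouquet {i} (\<lambda>_. V) R (\<lambda>_. {a})"
proof -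
  let ?P = "pieces {i} (\<lambda>_. V)" and ?S = "bouquet_rel R (\<lambda>_. {a})"
  have "clique_space V R homeomorphic_space clique_space ((\<lambda>x. Some (i, x)) ` V) ?S"
    using assms by (intro clique_space_relabel) (auto simp: inj_on_def)
  moreover have "(\<lambda>x. Some (i, x)) ` V = ?P - {None}"
    by (auto simp: pieces_def)
  ultimately have 1: "clique_space V R homotopy_equivalent_space clique_space (?P - {None}) ?S"
    using homeomorphic_imp_homotopy_equivalent_space by metis
  have "dominated ?S ?P None (Some (i, a))"
    using assms unfolding dominated_def by (auto simp: pieces_def)
  then have "bouquet {i} (\<lambda>_. V) R (\<lambda>_. {a}) homotopy_equivalent_space clique_space (?P - {None}) ?S"
    using assms symp_bouquet_rel [OF assms(2)] finite_pieces [of "{i}" "\<lambda>_. V"]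
    by (intro remove_dominated_vertex) auto
  with 1 show ?thesis
    by (metis (no_types) homotopy_equivalent_space_sym homotopy_eqv_trans)
qed

text \<open>This is \<open>split_link\<close> with \<open>p = None\<close>: the link
  \<open>N\<close> is joined to \<open>None\<close> since \<open>N \<subseteq> A i\<close>, and
  \<open>v\<close> is not. The detached suspension becomes the piece \<open>k\<close>, with
  \<open>Near\<close> renamed to \<open>s\<close>, \<open>Far\<close> to \<open>t\<close> and the
  copies to the vertices of \<open>N\<close>.\<close>

lemma bouquet_split:
  assumes fin: "finite I" "\<And>i. i \<in> I \<Longrightarrow> finite (V i)" and R: "symp R" and i: "i \<in> I" "k \<notin> I"
    and v: "v \<in> V i" "v \<notin> A i" and N: "N = {x \<in> V i. x \<noteq> v \<and> R v x}" "N \<subseteq> A i"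
    and st: "s \<notin> N" "t \<notin> N" "s \<noteq> t" "\<not> R s t" "\<And>x. x \<in> N \<Longrightarrow> R s x \<and> R t x"
  shows "bouquet I V R A homotopy_equivalent_space
    bouquet (insert k I) (V(i := V i - {v}, k := insert s (insert t N))) R (A(k := {s}))"
proof -
  let ?P = "pieces I V" and ?S = "bouquet_rel R A" and ?v = "Some (i, v)"
  let ?N = "{y \<in> ?P. y \<noteq> ?v \<and> ?S ?v y}"
  let ?C = "Old ` (?P - {?v}) \<union> Copy ` ?N \<union> {Near, Far}"
  let ?f = "\<lambda>c. case c of Old y \<Rightarrow> y | Copy y \<Rightarrow> Some (k, snd (the y)) | Near \<Rightarrow> Some (k, s) | Far \<Rightarrow> Some (k, t)"
  let ?P' = "pieces (insert k I) (V(i := V i - {v}, k := insert s (insert t N)))"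
  let ?S' = "bouquet_rel R (A(k := {s}))"
  have ik: "i \<noteq> k" using i by auto
  have Neq: "?N = (\<lambda>x. Some (i, x)) ` N"
    using v i N(1) by (auto simp: pieces_def)
  have st': "R x s" "R x t" if "x \<in> N" for x
    using st(5) [OF that] R by (auto dest: sympD)
  have ts: "\<not> R t s" using st(4) R by (auto dest: sympD)
  have 1: "bouquet I V R A homotopy_equivalent_space
      clique_space ?C (cell_rel False False False ?S None ?N)"
  proof (rule split_link)
    show "finite ?P" by (rule finite_pieces [OF fin])
    show "symp ?S" by (rule symp_bouquet_rel [OF R])
    show "?S None y" if "y \<in> ?N" for y
      using that N(2) unfolding Neq by auto
  qed (use i v in auto)
  have finC: "finite ?C"
    using finite_pieces [OF fin] by simp
  have inj: "inj_on ?f ?C"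
    using i st unfolding Neq inj_on_def by (auto simp: pieces_def)
  have img: "?f ` ?C = ?P'"
  proof -
    have "?f ` ?C = (?P - {?v}) \<union> (\<lambda>x. Some (k, x)) ` N \<union> {Some (k, s), Some (k, t)}"
      unfolding Neq image_Un image_image by simp
    also have "\<dots> = ?P'"
      using i by (auto simp: pieces_def split: if_splits)
    finally show ?thesis .
  qed
  have "clique_space ?C (cell_rel False False False ?S None ?N) homeomorphic_space clique_space (?f ` ?C) ?S'"
  proof (rule clique_space_relabel [OF finC inj])
    fix x y assume xy: "x \<in> ?C" "y \<in> ?C" "x \<noteq> y"
    have old: "x = Old None \<or> (\<exists>j z. x = Old (Some (j, z)) \<and> j \<noteq> k) \<or> (\<exists>z\<in>N. x = Copy (Some (i, z))) \<or>
        x = Near \<or> x = Far" if "x \<in> ?C" for x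
      using that i unfolding Neq by (auto simp: pieces_def)
    have sz: "s \<noteq> z" if "z \<in> N" for z using that st by auto
    show "cell_rel False False False ?S None ?N x y \<longleftrightarrow> ?S' (?f x) (?f y)"
      using old [OF xy(1)] old [OF xy(2)] xy(3)
      by (elim disjE exE bexE conjE) (simp_all add: st st' ts sz not_sym [OF sz] not_sym [OF st(3)])
  qed
  then have "clique_space ?C (cell_rel False False False ?S None ?N) homotopy_equivalent_space clique_space ?P' ?S'"
    unfolding img by (rule homeomorphic_imp_homotopy_equivalent_space)
  with 1 show ?thesis
    by (rule homotopy_eqv_trans)
qed

lemma bouquet_change_all:
  assumes "finite I"
    and ch: "\<And>i A. i \<in> I \<Longrightarrow>
      bouquet I V R (A(i := B i)) homotopy_equivalent_space bouquet I V R (A(i := B' i))"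
  shows "bouquet I V R B homotopy_equivalent_space bouquet I V R B'"
proof -
  have "bouquet I V R B homotopy_equivalent_space bouquet I V R (\<lambda>i. if i \<in> J then B' i else B i)"
    if "J \<subseteq> I" for J
    using finite_subset [OF that assms(1)] that
  proof (induction J rule: finite_induct)
    case empty
    then show ?case by (simp add: homotopy_equivalent_space_refl)
  next
    case (insert j J)
    let ?A = "\<lambda>i. if i \<in> J then B' i else B i"
    have "bouquet I V R B homotopy_equivalent_space bouquet I V R ?A"
      using insert by blast
    moreover have "bouquet I V R (?A(j := B j)) homotopy_equivalent_space bouquet I V R (?A(j := B' j))"
      by (rule ch) (use insert in blast)
    moreover have "?A(j := B j) = ?A" "?A(j := B' j) = (\<lambda>i. if i \<in> insert j J then B' i else B i)"
      using insert by (auto simp: fun_eq_iff)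
    ultimately have "bouquet I V R ?A homotopy_equivalent_space
        bouquet I V R (\<lambda>i. if i \<in> insert j J then B' i else B i)"
      by (simp only:)
    with \<open>bouquet I V R B homotopy_equivalent_space bouquet I V R ?A\<close> show ?case
      by (rule homotopy_eqv_trans)
  qed
  from this [of I] have "bouquet I V R B homotopy_equivalent_space bouquet I V R (\<lambda>i. if i \<in> I then B' i else B i)"
    by blast
  moreover have "cliques (pieces I V) (bouquet_rel R (\<lambda>i. if i \<in> I then B' i else B i)) =
      cliques (pieces I V) (bouquet_rel R B')"
    by (rule cliques_cong) (auto elim!: pieces_cases)
  ultimately show ?thesis by simp
qed

text \<open>The attachment \<open>{a, b}\<close> is an edge and folds to either of its ends.\<close>

lemma bouquet_move_attachment_edge:
  assumes fin: "finite I" "\<And>i. i \<in> I \<Longrightarrow> finite (V i)" and R: "symp R" and i: "i \<in> I"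
    and ab: "a \<in> V i" "b \<in> V i" "R a b"
  shows "bouquet I V R (A(i := {a})) homotopy_equivalent_space bouquet I V R (A(i := {b}))"
proof -
  have ba: "R b a" using ab R by (auto dest: sympD)
  have "folds R {a, b} {a}" "folds R {a, b} {b}"
    using ab ba by (auto intro!: folds_cone)
  then have "bouquet I V R (A(i := {a, b})) homotopy_equivalent_space bouquet I V R (A(i := {a}))"
    "bouquet I V R (A(i := {a, b})) homotopy_equivalent_space bouquet I V R (A(i := {b}))"
    using ab by (auto intro!: bouquet_shrink_attachment [OF fin R i])
  then show ?thesis
    by (rule homotopy_eqv_trans [OF iffD1 [OF homotopy_equivalent_space_sym]])
qed

text \<open>A combinatorial substitute for path connectedness: it lets an attachment move between
  any two vertices in at most two steps.\<close>

definition diameter_two :: "'v set \<Rightarrow> ('v \<Rightarrow> 'v \<Rightarrow> bool) \<Rightarrow> bool" where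
  "diameter_two V R \<longleftrightarrow> (\<forall>a\<in>V. \<forall>b\<in>V. a = b \<or> R a b \<or> (\<exists>c\<in>V. R a c \<and> R c b))"

lemma bouquet_move_attachment:
  assumes fin: "finite I" "\<And>i. i \<in> I \<Longrightarrow> finite (V i)" and R: "symp R" and i: "i \<in> I"
    and ab: "a \<in> V i" "b \<in> V i" "diameter_two (V i) R"
  shows "bouquet I V R (A(i := {a})) homotopy_equivalent_space bouquet I V R (A(i := {b}))"
proof -
  have edge: "bouquet I V R (A(i := {a})) homotopy_equivalent_space bouquet I V R (A(i := {b}))"
    if "a \<in> V i" "b \<in> V i" "R a b" for a b
    by (rule bouquet_move_attachment_edge) (use fin R i that in auto)
  consider "a = b" | "R a b" | c where "c \<in> V i" "R a c" "R c b"
    using ab unfolding diameter_two_def by blast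
  then show ?thesis
  proof cases
    case 1
    then show ?thesis by (simp add: homotopy_equivalent_space_refl)
  next
    case 2
    then show ?thesis using edge ab by blast
  next
    case 3
    show ?thesis
      by (rule homotopy_eqv_trans [OF edge edge]) (use 3 ab in auto)
  qed
qed

section \<open>Wedge sums of clique complexes\<close>

lemma continuous_map_from_sum_topology:
  assumes "\<And>i. i \<in> I \<Longrightarrow> continuous_map (X i) Y (\<lambda>x. f (i, x))"
  shows "continuous_map (sum_topology X I) Y f"
proof -
  have "{x. (i, x) \<in> {z \<in> topspace (sum_topology X I). f z \<in> U}} = {x \<in> topspace (X i). f (i, x) \<in> U}"
    if "i \<in> I" for i U
    using that by auto
  then show ?thesis
    using assms unfolding continuous_map_def openin_sum_topology by fastforce
qed

lemma compact_space_sum_topology: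
  assumes "finite I" "\<And>i. i \<in> I \<Longrightarrow> compact_space (X i)"
  shows "compact_space (sum_topology X I)"
proof -
  have "compactin (sum_topology X I) (Pair i ` topspace (X i))" if "i \<in> I" for i
    using assms(2) [OF that] that unfolding compact_space_def
    by (rule image_compactin [OF _ continuous_map_component_injection])
  then have "compactin (sum_topology X I) (\<Union>i\<in>I. Pair i ` topspace (X i))"
    using assms(1) by (intro compactin_Union) auto
  moreover have "(\<Union>i\<in>I. Pair i ` topspace (X i)) = topspace (sum_topology X I)"
    by auto
  ultimately show ?thesis by (simp add: compact_space_def)
qed

text \<open>The bridge from suspensions and wedges, which are defined as quotients, to realizations:
  a continuous surjection from a compact space onto a Hausdorff space is a quotient map as well, so
  only the fibres have to be compared.\<close>

lemma quotient_maps_same_fibres: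
  assumes f: "quotient_map X Y f" and g: "quotient_map X Z g"
    and fg: "\<And>x y. x \<in> topspace X \<Longrightarrow> y \<in> topspace X \<Longrightarrow> f x = f y \<longleftrightarrow> g x = g y"
  shows "Y homeomorphic_space Z"
proof -
  obtain u where u: "continuous_map Y Z u" "\<And>x. x \<in> topspace X \<Longrightarrow> u (f x) = g x"
    using quotient_map_lift_exists [OF f quotient_imp_continuous_map [OF g]] fg by metis
  obtain v where v: "continuous_map Z Y v" "\<And>x. x \<in> topspace X \<Longrightarrow> v (g x) = f x"
    using quotient_map_lift_exists [OF g quotient_imp_continuous_map [OF f]] fg by metis
  have "v (u y) = y" if "y \<in> topspace Y" for y
    using that u v quotient_imp_surjective_map [OF f] by force
  moreover have "u (v z) = z" if "z \<in> topspace Z" for z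
    using that u v quotient_imp_surjective_map [OF g] by force
  ultimately show ?thesis
    using u v unfolding homeomorphic_space_def homeomorphic_maps_def by blast
qed

text \<open>The largest \<open>t\<close> such that \<open>z - t p\<close> has nonnegative coordinates.\<close>

definition depth :: "('v \<Rightarrow> real) \<Rightarrow> ('v \<Rightarrow> real) \<Rightarrow> real" where
  "depth p z = Min ((\<lambda>v. z v / p v) ` supp p)"

lemma supp_of_point:
  assumes "finite V" "p \<in> topspace (clique_space V R)"
  shows "finite (supp p)" "supp p \<noteq> {}" "supp p \<subseteq> V" "\<And>v. v \<in> supp p \<Longrightarrow> 0 < p v"
proof -
  have p: "supp p \<in> cliques V R" "\<forall>v. 0 \<le> p v" "sum p V = 1"
    using assms(2) topspace_clique_space [OF assms(1)] by blast+
  show "supp p \<subseteq> V" using clique_subset [OF p(1)] by blast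
  then show "finite (supp p)" using assms(1) finite_subset by blast
  show "supp p \<noteq> {}"
  proof
    assume "supp p = {}"
    then have "p v = 0" for v unfolding supp_def by blast
    then show False using p(3) by simp
  qed
  show "0 < p v" if "v \<in> supp p" for v
    using that p(2) unfolding supp_def by (simp add: less_le)
qed

lemma depth_properties:
  assumes V: "finite V" and p: "p \<in> topspace (clique_space V R)" and z: "z \<in> topspace (clique_space V R)"
  shows "0 \<le> depth p z" "\<And>v. depth p z * p v \<le> z v" "\<exists>v\<in>supp p. depth p z * p v = z v"
    "depth p z \<noteq> 0 \<Longrightarrow> supp p \<subseteq> supp z"
proof -
  note sp = supp_of_point [OF V p]
  have z0: "\<forall>v. 0 \<le> z v"
    using z topspace_clique_space [OF V] by blast
  have fin: "finite ((\<lambda>v. z v / p v) ` supp p)" "(\<lambda>v. z v / p v) ` supp p \<noteq> {}"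
    using sp by auto
  have "depth p z \<in> (\<lambda>v. z v / p v) ` supp p"
    unfolding depth_def by (rule Min_in [OF fin])
  then obtain u where u: "u \<in> supp p" "depth p z = z u / p u" by blast
  then have zu: "depth p z * p u = z u" using sp(4) [of u] by simp
  have le: "depth p z \<le> z v / p v" if "v \<in> supp p" for v
    unfolding depth_def using fin that by (intro Min_le) auto
  show nn: "0 \<le> depth p z" using u z0 sp(4) [of u] by simp
  show le': "depth p z * p v \<le> z v" for v
  proof (cases "v \<in> supp p")
    case True
    then show ?thesis using le [OF True] sp(4) [OF True] by (simp add: pos_le_divide_eq)
  next
    case False
    then have "p v = 0" by (simp add: supp_def)
    then show ?thesis using z0 by simp
  qed
  show "\<exists>v\<in>supp p. depth p z * p v = z v" using u zu by blast
  show "supp p \<subseteq> supp z" if "depth p z \<noteq> 0"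
  proof
    fix v assume v: "v \<in> supp p"
    have "0 < depth p z * p v" using nn that sp(4) [OF v] by simp
    then have "z v \<noteq> 0" using le' [of v] by linarith
    then show "v \<in> supp z" by (simp add: supp_def)
  qed
qed

lemma depth_self:
  assumes V: "finite V" and p: "p \<in> topspace (clique_space V R)"
  shows "depth p p = 1"
proof -
  note sp = supp_of_point [OF V p]
  have "(\<lambda>v. p v / p v) ` supp p = {1}"
    using sp by (force simp: supp_def)
  then show ?thesis by (simp add: depth_def)
qed

text \<open>For a clique \<open>S\<close> and symmetric \<open>R\<close> this is the vertex set of
  the closed star of the face \<open>S\<close>.\<close>

definition star_hull :: "'v set \<Rightarrow> ('v \<Rightarrow> 'v \<Rightarrow> bool) \<Rightarrow> 'v set \<Rightarrow> 'v set" where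
  "star_hull V R S = {x \<in> V. \<forall>u\<in>S. x = u \<or> R x u}"

text \<open>Faces containing some \<open>S i\<close> with \<open>i \<in> J\<close> are omitted; for \<open>J = I\<close> this is the union of the pieces,
  each stellarly subdivided at an interior point of \<open>S i\<close>, with all these points identified to \<open>None\<close>.\<close>

definition pointed_complex :: "'i set \<Rightarrow> ('i \<Rightarrow> 'v set) \<Rightarrow> ('v \<Rightarrow> 'v \<Rightarrow> bool) \<Rightarrow> ('i \<Rightarrow> 'v set) \<Rightarrow> 'i set \<Rightarrow>
    ('i \<times> 'v) option set set" where
  "pointed_complex I V R S J =
    {\<tau> \<in> cliques (pieces I V) (bouquet_rel R (\<lambda>i. star_hull (V i) R (S i))).
      \<forall>i\<in>J. \<not> (\<lambda>x. Some (i, x)) ` S i \<subseteq> \<tau>}"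

text \<open>A face that contains the copy of \<open>S j\<close> lies, apart from
  \<open>None\<close>, in the star of \<open>S j\<close> within the piece \<open>j\<close>. As
  \<open>None\<close> is joined to that star, the face extends by \<open>None\<close> and can be
  removed.\<close>

lemma remove_pointed_faces:
  assumes fin: "finite I" "\<And>i. i \<in> I \<Longrightarrow> finite (V i)" and R: "symp R"
    and S: "\<And>i. i \<in> I \<Longrightarrow> S i \<noteq> {} \<and> S i \<subseteq> V i"
  shows "bouquet I V R (\<lambda>i. star_hull (V i) R (S i)) homotopy_equivalent_space
    geometric_realization (pointed_complex I V R S I)"
proof -
  let ?S = "\<lambda>i. (\<lambda>x. Some (i, x)) ` S i" and ?K = "pointed_complex I V R S"
  let ?Q = "cliques (pieces I V) (bouquet_rel R (\<lambda>i. star_hull (V i) R (S i)))"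
  have Q: "finite_complex ?Q"
    by (rule finite_complex_cliques [OF finite_pieces [OF fin]])
  have K: "finite_complex (?K J)" for J
    unfolding finite_complex_def
  proof (intro conjI ballI allI impI)
    show "finite (\<Union>(?K J))"
      by (rule finite_subset [of _ "\<Union>?Q"]) (use Q in \<open>auto simp: pointed_complex_def finite_complex_def\<close>)
    show "\<tau> \<in> ?K J" if "\<sigma> \<in> ?K J" "\<tau> \<subseteq> \<sigma>" for \<sigma> \<tau>
      using that finite_complex_down [OF Q, of \<sigma> \<tau>] unfolding pointed_complex_def by blast
  qed
  have "geometric_realization ?Q homotopy_equivalent_space geometric_realization (?K J)" if "J \<subseteq> I" for J
    using finite_subset [OF that fin(1)] that
  proof (induction J rule: finite_induct)
    case empty
    then show ?case by (simp add: homotopy_equivalent_space_refl pointed_complex_def)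
  next
    case (insert j J)
    have j: "S j \<noteq> {}" "S j \<subseteq> V j" "finite (S j)" "j \<in> I"
      using S [of j] fin(2) [of j] insert.prems finite_subset by auto
    have "geometric_realization (?K J) homotopy_equivalent_space
        geometric_realization {\<tau> \<in> ?K J. \<not> ?S j \<subseteq> \<tau>}"
    proof (rule realization_remove_face [OF K, where w = None])
      fix \<tau> assume \<tau>: "\<tau> \<in> ?K J" "?S j \<subseteq> \<tau>"
      have \<tau>Q: "\<tau> \<in> ?Q" using \<tau>(1) by (simp add: pointed_complex_def)
      \<comment> \<open>One vertex of \<open>S j\<close> in \<open>\<tau>\<close> forces all other
        vertices of \<open>\<tau>\<close> except \<open>None\<close> into the piece
        \<open>j\<close>.\<close>
      obtain s where s: "s \<in> S j" using j by blast
      have "insert None \<tau> \<in> ?Q"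
      proof (rule insert_clique [OF \<tau>Q _ symp_bouquet_rel [OF R]])
        fix u assume u: "u \<in> \<tau>" "u \<noteq> None"
        then obtain i x where ix: "u = Some (i, x)" by auto
        have rel: "u = Some (j, v) \<or> (i = j \<and> R x v)" if "v \<in> S j" for v
          using clique_rel [OF \<tau>Q u(1), of "Some (j, v)"] \<tau>(2) that ix by auto
        have "i = j" using rel [OF s] ix by auto
        moreover have "x \<in> V i" using clique_subset [OF \<tau>Q u(1)] ix by simp
        ultimately show "bouquet_rel R (\<lambda>i. star_hull (V i) R (S i)) None u"
          using rel ix by (auto simp: star_hull_def)
      qed simp
      \<comment> \<open>The omitted faces consist of vertices other than \<open>None\<close>, so
        adding \<open>None\<close> completes none of them.\<close>
      then show "insert None \<tau> \<in> ?K J"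
        using \<tau>(1) by (auto simp: pointed_complex_def)
    qed (use j in auto)
    moreover have "{\<tau> \<in> ?K J. \<not> ?S j \<subseteq> \<tau>} = ?K (insert j J)"
      unfolding pointed_complex_def by blast
    ultimately have "geometric_realization (?K J) homotopy_equivalent_space
        geometric_realization (?K (insert j J))" by simp
    with insert show ?case
      by (blast intro: homotopy_eqv_trans [of _ "geometric_realization (?K J)"])
  qed
  then show ?thesis by blast
qed

text \<open>A wedge of clique spaces with base points \<open>p\<^sub>i\<close> in the interior of the faces \<open>S i\<close> is triangulated by
  \<open>pointed_complex\<close>: a point \<open>z\<close> is sent to \<open>z - t p\<^sub>i\<close> with mass \<open>t\<close> on \<open>None\<close>, where \<open>t\<close> is maximal.\<close>

definition wedge_coordinates :: "('i \<Rightarrow> 'v \<Rightarrow> real) \<Rightarrow> 'i \<Rightarrow> ('v \<Rightarrow> real) \<Rightarrow> ('i \<times> 'v) option \<Rightarrow> real" where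
  "wedge_coordinates p i z u = (case u of None \<Rightarrow> depth (p i) z
     | Some (j, x) \<Rightarrow> if j = i then z x - depth (p i) z * p i x else 0)"

lemma sum_pieces_single:
  assumes fin: "finite I" "\<And>i. i \<in> I \<Longrightarrow> finite (V i)" and i: "i \<in> I"
    and y: "\<And>j x. j \<noteq> i \<Longrightarrow> y (Some (j, x)) = 0"
  shows "sum y (pieces I V) = y None + (\<Sum>x\<in>V i. y (Some (i, x)))"
proof -
  have "sum y (pieces I V) = sum y (insert None ((\<lambda>x. Some (i, x)) ` V i))"
  proof (rule sum.mono_neutral_right)
    show "finite (pieces I V)" by (rule finite_pieces [OF fin])
    show "insert None ((\<lambda>x. Some (i, x)) ` V i) \<subseteq> pieces I V" using i by auto
    show "\<forall>u\<in>pieces I V - insert None ((\<lambda>x. Some (i, x)) ` V i). y u = 0"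
    proof
      fix u assume u: "u \<in> pieces I V - insert None ((\<lambda>x. Some (i, x)) ` V i)"
      then obtain j x where "u = Some (j, x)" "x \<in> V j" by (auto simp: pieces_def)
      then show "y u = 0" using u y by (cases "j = i") auto
    qed
  qed
  also have "\<dots> = y None + sum y ((\<lambda>x. Some (i, x)) ` V i)"
    using fin(2) [OF i] by (subst sum.insert) auto
  also have "sum y ((\<lambda>x. Some (i, x)) ` V i) = (\<Sum>x\<in>V i. y (Some (i, x)))"
    by (subst sum.reindex) (auto simp: inj_on_def)
  finally show ?thesis .
qed

lemma Union_pointed_complex: "\<Union>(pointed_complex I V R S J) \<subseteq> pieces I V"
proof
  fix u assume "u \<in> \<Union>(pointed_complex I V R S J)"
  then obtain \<tau> where \<tau>: "u \<in> \<tau>" "\<tau> \<in> pointed_complex I V R S J" by blast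
  then have "\<tau> \<in> cliques (pieces I V) (bouquet_rel R (\<lambda>i. star_hull (V i) R (S i)))"
    by (simp add: pointed_complex_def)
  then show "u \<in> pieces I V" by (rule clique_subset [OF _ \<tau>(1)])
qed

text \<open>Maximality of the depth makes some coordinate over \<open>supp (p i)\<close> vanish, so
  the omitted face is avoided. Positive depth forces \<open>supp (p i) \<subseteq> supp z\<close>;
  then all of \<open>supp z\<close> lies in the star that is joined to \<open>None\<close>.\<close>

lemma wedge_coordinates_in:
  assumes fin: "finite I" "\<And>i. i \<in> I \<Longrightarrow> finite (V i)"
    and p: "\<And>i. i \<in> I \<Longrightarrow> p i \<in> topspace (clique_space (V i) R)"
    and i: "i \<in> I" and z: "z \<in> topspace (clique_space (V i) R)"
  shows "wedge_coordinates p i z \<in> topspace (geometric_realization (pointed_complex I V R (\<lambda>i. supp (p i)) I))"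
proof -
  have finP: "finite (pieces I V)" by (rule finite_pieces [OF fin])
  let ?y = "wedge_coordinates p i z" and ?t = "depth (p i) z"
  let ?A = "\<lambda>i. star_hull (V i) R (supp (p i))"
  note d = depth_properties [OF fin(2) [OF i] p [OF i] z]
  have z': "supp z \<in> cliques (V i) R" "sum z (V i) = 1"
    using z topspace_clique_space [OF fin(2) [OF i]] by blast+
  have p': "sum (p i) (V i) = 1"
    using p [OF i] topspace_clique_space [OF fin(2) [OF i]] by blast
  have suppy: "\<exists>x. u = Some (i, x) \<and> x \<in> supp z" if "u \<in> supp ?y" "u \<noteq> None" for u
  proof -
    obtain j x where u: "u = Some (j, x)" using \<open>u \<noteq> None\<close> by auto
    have "p i x = 0 \<or> ?t = 0" if "z x = 0"
    proof (rule ccontr)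
      assume "\<not> (p i x = 0 \<or> ?t = 0)"
      then have "x \<in> supp (p i)" "?t \<noteq> 0" by (auto simp: supp_def)
      then have "x \<in> supp z" using d(4) by blast
      then show False using \<open>z x = 0\<close> by (simp add: supp_def)
    qed
    then show ?thesis
      using \<open>u \<in> supp ?y\<close> u by (auto simp: supp_def wedge_coordinates_def split: if_splits)
  qed
  have "supp ?y \<in> cliques (pieces I V) (bouquet_rel R ?A)"
  proof -
    have "u \<in> pieces I V" if "u \<in> supp ?y" for u
      using suppy [OF that] clique_subset [OF z'(1)] i by (cases "u = None") auto
    moreover have star: "x \<in> ?A i" if "None \<in> supp ?y" "x \<in> supp z" for x
    proof -
      have "?t \<noteq> 0" using \<open>None \<in> supp ?y\<close> by (simp add: supp_def wedge_coordinates_def)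
      then have "supp (p i) \<subseteq> supp z" by (rule d(4))
      then show ?thesis
        using clique_rel [OF z'(1) \<open>x \<in> supp z\<close>] clique_subset [OF z'(1) \<open>x \<in> supp z\<close>]
        by (auto simp: star_hull_def)
    qed
    moreover have "bouquet_rel R ?A u v" if uv: "u \<in> supp ?y" "v \<in> supp ?y" "u \<noteq> v" for u v
    proof (cases "u = None")
      case True
      then have "v \<noteq> None" using uv(3) by simp
      then obtain x where "v = Some (i, x)" "x \<in> supp z" using suppy [OF uv(2)] by blast
      then show ?thesis using star uv True by auto
    next
      case False
      then obtain x where x: "u = Some (i, x)" "x \<in> supp z" using suppy [OF uv(1)] by blast
      show ?thesis
      proof (cases "v = None")
        case True
        then show ?thesis using star uv x by auto
      next
        case False
        then obtain x' where "v = Some (i, x')" "x' \<in> supp z" using suppy [OF uv(2)] by blast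
        then show ?thesis using clique_rel [OF z'(1), of x x'] x uv by auto
      qed
    qed
    ultimately show ?thesis
      unfolding cliques_def by blast
  qed
  moreover have "\<not> (\<lambda>x. Some (j, x)) ` supp (p j) \<subseteq> supp ?y" if j: "j \<in> I" for j
  proof (cases "j = i")
    case True
    obtain v where "v \<in> supp (p i)" "?t * p i v = z v" using d(3) by blast
    then have "?y (Some (i, v)) = 0" by (simp add: wedge_coordinates_def)
    then show ?thesis
      using True \<open>v \<in> supp (p i)\<close> by (auto simp: supp_def [of ?y])
  next
    case False
    then have "?y (Some (j, v)) = 0" for v by (simp add: wedge_coordinates_def)
    then show ?thesis
      using supp_of_point(2) [OF fin(2) [OF j] p [OF j]] by (auto simp: supp_def [of ?y])
  qed
  ultimately have 1: "supp ?y \<in> pointed_complex I V R (\<lambda>i. supp (p i)) I"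
    unfolding pointed_complex_def by blast
  have 2: "0 \<le> ?y u" for u
    using d(1,2) by (auto simp: wedge_coordinates_def split: option.split)
  have "sum ?y (pieces I V) = ?t + (\<Sum>x\<in>V i. z x - ?t * p i x)"
    by (subst sum_pieces_single [OF fin i]) (auto simp: wedge_coordinates_def)
  also have "\<dots> = 1"
    using z' p' by (simp add: sum_subtractf flip: sum_distrib_left)
  finally show ?thesis
    using 1 2 topspace_realization [OF finP Union_pointed_complex] by blast
qed

lemma wedge_coordinates_onto:
  assumes fin: "finite I" "\<And>i. i \<in> I \<Longrightarrow> finite (V i)" and R: "symp R" and "I \<noteq> {}"
    and p: "\<And>i. i \<in> I \<Longrightarrow> p i \<in> topspace (clique_space (V i) R)"
    and y: "y \<in> topspace (geometric_realization (pointed_complex I V R (\<lambda>i. supp (p i)) I))"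
  shows "\<exists>i\<in>I. \<exists>z\<in>topspace (clique_space (V i) R). wedge_coordinates p i z = y"
proof -
  have finP: "finite (pieces I V)" by (rule finite_pieces [OF fin])
  let ?A = "\<lambda>i. star_hull (V i) R (supp (p i))"
  have y': "supp y \<in> pointed_complex I V R (\<lambda>i. supp (p i)) I" "\<forall>u. 0 \<le> y u" "sum y (pieces I V) = 1"
    using y topspace_realization [OF finP Union_pointed_complex] by blast+
  have cl: "supp y \<in> cliques (pieces I V) (bouquet_rel R ?A)"
    and no: "\<And>i. i \<in> I \<Longrightarrow> \<not> (\<lambda>x. Some (i, x)) ` supp (p i) \<subseteq> supp y"
    using y'(1) unfolding pointed_complex_def by blast+
  \<comment> \<open>A face meets at most one piece. If all mass is on \<open>None\<close>, every
    index will do, and \<open>I \<noteq> {}\<close> supplies one.\<close>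
  have "\<exists>i\<in>I. \<forall>j x. Some (j, x) \<in> supp y \<longrightarrow> j = i"
  proof (cases "\<exists>i x. Some (i, x) \<in> supp y")
    case True
    then obtain i x where ix: "Some (i, x) \<in> supp y" by blast
    then have "i \<in> I" using clique_subset [OF cl ix] by simp
    moreover have "j = i" if "Some (j, x') \<in> supp y" for j x'
      using clique_rel [OF cl that ix] by auto
    ultimately show ?thesis by blast
  next
    case False
    then show ?thesis using \<open>I \<noteq> {}\<close> by blast
  qed
  then obtain i where i: "i \<in> I" and only: "\<And>j x. Some (j, x) \<in> supp y \<Longrightarrow> j = i" by blast
  note V = fin(2) [OF i] and pi = p [OF i]
  note sp = supp_of_point [OF V pi]
  have p': "supp (p i) \<in> cliques (V i) R" "\<forall>v. 0 \<le> p i v" "sum (p i) (V i) = 1"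
    using pi topspace_clique_space [OF V] by blast+
  let ?t = "y None"
  \<comment> \<open>The inverse of \<open>wedge_coordinates\<close>: the mass on \<open>None\<close>
    is redistributed in proportion to \<open>p i\<close>.\<close>
  define z where "z v = y (Some (i, v)) + ?t * p i v" for v
  have "supp z \<in> cliques (V i) R"
  proof -
    have zc: "Some (i, v) \<in> supp y \<or> (None \<in> supp y \<and> v \<in> supp (p i))" if "v \<in> supp z" for v
      using that by (auto simp: supp_def z_def)
    have yV: "v \<in> V i" if "Some (i, v) \<in> supp y" for v
      using clique_subset [OF cl that] by simp
    have "v \<in> V i" if "v \<in> supp z" for v
      using zc [OF that] yV sp(3) by blast
    moreover have yy: "R u v" if "Some (i, u) \<in> supp y" "Some (i, v) \<in> supp y" "u \<noteq> v" for u v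
      using clique_rel [OF cl that(1,2)] that(3) by simp
    moreover have yp: "R u v" if "Some (i, u) \<in> supp y" "None \<in> supp y" "v \<in> supp (p i)" "u \<noteq> v" for u v
      using clique_rel [OF cl that(1,2)] that(3,4) by (auto simp: star_hull_def)
    moreover have py: "R v u" if "Some (i, u) \<in> supp y" "None \<in> supp y" "v \<in> supp (p i)" "u \<noteq> v" for u v
      using yp [OF that] R by (auto dest: sympD)
    moreover note clique_rel [OF p'(1)]
    ultimately have "R u v" if "u \<in> supp z" "v \<in> supp z" "u \<noteq> v" for u v
      using zc [OF that(1)] zc [OF that(2)] that(3) by (elim disjE conjE) blast+
    with \<open>\<And>v. v \<in> supp z \<Longrightarrow> v \<in> V i\<close> show ?thesis unfolding cliques_def by blast
  qed
  moreover have "0 \<le> z v" for v using y'(2) p'(2) by (simp add: z_def)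
  moreover have "sum z (V i) = 1"
  proof -
    have "sum y (pieces I V) = ?t + (\<Sum>x\<in>V i. y (Some (i, x)))"
    proof (rule sum_pieces_single)
      show "y (Some (j, x)) = 0" if "j \<noteq> i" for j x
        using only [of j x] that by (auto simp: supp_def)
    qed (use fin i in auto)
    then show ?thesis
      using y'(3) p'(3) by (simp add: z_def sum.distrib flip: sum_distrib_left)
  qed
  ultimately have z: "z \<in> topspace (clique_space (V i) R)"
    using topspace_clique_space [OF V] by blast
  have quot: "z v / p i v = y (Some (i, v)) / p i v + ?t" if "v \<in> supp (p i)" for v
    using sp(4) [OF that] by (simp add: z_def add_divide_distrib)
  \<comment> \<open>At a vertex of \<open>supp (p i)\<close> missing from \<open>supp y\<close>, the
    quotient is exactly \<open>?t\<close>; all other quotients are at least as large, so the depth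
    of \<open>z\<close> is recovered.\<close>
  obtain v where v: "v \<in> supp (p i)" "Some (i, v) \<notin> supp y"
    using no [OF i] by blast
  have "depth (p i) z = ?t"
    unfolding depth_def
  proof (rule Min_eqI)
    show "finite ((\<lambda>v. z v / p i v) ` supp (p i))" using sp(1) by simp
    show "?t \<in> (\<lambda>v. z v / p i v) ` supp (p i)"
      using quot [OF v(1)] v by (force simp: supp_def [of y])
    show "?t \<le> q" if "q \<in> (\<lambda>v. z v / p i v) ` supp (p i)" for q
      using that quot sp(4) y'(2) by (auto simp: less_imp_le)
  qed
  then have "wedge_coordinates p i z u = y u" for u
    using only by (auto simp: wedge_coordinates_def z_def supp_def split: option.split)
  then have "wedge_coordinates p i z = y" by blast
  then show ?thesis using i z by blast
qed

lemma continuous_map_wedge_coordinates: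
  assumes fin: "finite I" "\<And>i. i \<in> I \<Longrightarrow> finite (V i)"
    and p: "\<And>i. i \<in> I \<Longrightarrow> p i \<in> topspace (clique_space (V i) R)" and i: "i \<in> I"
  shows "continuous_map (clique_space (V i) R)
    (geometric_realization (pointed_complex I V R (\<lambda>i. supp (p i)) I)) (wedge_coordinates p i)"
  unfolding continuous_map_into_realization
proof (intro conjI allI)
  fix u
  note sp = supp_of_point [OF fin(2) [OF i] p [OF i]]
  have quot: "continuous_map (clique_space (V i) R) euclideanreal (\<lambda>z. z v / p i v)" if "v \<in> supp (p i)" for v
    using that by (intro continuous_intros) (auto simp: supp_def)
  have d: "continuous_map (clique_space (V i) R) euclideanreal (depth (p i))"
    unfolding depth_def using sp quot by (intro continuous_map_Min) auto
  show "continuous_map (clique_space (V i) R) euclideanreal (\<lambda>z. wedge_coordinates p i z u)"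
  proof (cases u)
    case None
    then show ?thesis using d by (simp add: wedge_coordinates_def)
  next
    case (Some jx)
    then obtain j x where u: "u = Some (j, x)" by (cases jx) auto
    show ?thesis
    proof (cases "j = i")
      case True
      have "continuous_map (clique_space (V i) R) euclideanreal (\<lambda>z. z x - depth (p i) z * p i x)"
        by (intro continuous_intros d)
      then show ?thesis using u True by (simp add: wedge_coordinates_def)
    qed (simp add: u wedge_coordinates_def)
  qed
qed (use wedge_coordinates_in [of I V p R i] fin p i in blast)

text \<open>A common value from two different pieces has no mass on either piece. Hence
  \<open>z\<close> is a multiple of \<open>p i\<close>, the total mass makes the factor 1, and both
  points are base points.\<close>

lemma wedge_coordinates_eq_iff:
  assumes V: "finite (V i)" "finite (V j)"
    and p: "p i \<in> topspace (clique_space (V i) R)" "p j \<in> topspace (clique_space (V j) R)"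
    and z: "z \<in> topspace (clique_space (V i) R)" "z' \<in> topspace (clique_space (V j) R)"
  shows "wedge_coordinates p i z = wedge_coordinates p j z' \<longleftrightarrow>
    (z = p i \<and> z' = p j) \<or> (i = j \<and> z = z')"
proof
  assume eq: "wedge_coordinates p i z = wedge_coordinates p j z'"
  have t: "depth (p i) z = depth (p j) z'"
    using fun_cong [OF eq, of None] by (simp add: wedge_coordinates_def)
  show "(z = p i \<and> z' = p j) \<or> (i = j \<and> z = z')"
  proof (cases "i = j")
    case True
    have "z x = z' x" for x
      using fun_cong [OF eq, of "Some (i, x)"] t True by (simp add: wedge_coordinates_def)
    then show ?thesis using True by blast
  next
    case False
    have a: "z x = depth (p i) z * p i x" for x
      using fun_cong [OF eq, of "Some (i, x)"] False by (simp add: wedge_coordinates_def)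
    have b: "z' x = depth (p j) z' * p j x" for x
      using fun_cong [OF eq, of "Some (j, x)"] False by (simp add: wedge_coordinates_def)
    have s: "sum (p i) (V i) = 1" "sum z (V i) = 1"
      using p z V topspace_clique_space by blast+
    have "sum z (V i) = depth (p i) z * sum (p i) (V i)"
      using a by (simp add: sum_distrib_left)
    then have "depth (p i) z = 1" using s by simp
    then have "z x = p i x" "z' x = p j x" for x using a [of x] b [of x] t by simp_all
    then show ?thesis by blast
  qed
next
  have "wedge_coordinates p i (p i) = (\<lambda>u. if u = None then 1 else 0)"
    using depth_self [OF V(1) p(1)] by (auto simp: wedge_coordinates_def fun_eq_iff split: option.split)
  moreover have "wedge_coordinates p j (p j) = (\<lambda>u. if u = None then 1 else 0)"
    using depth_self [OF V(2) p(2)] by (auto simp: wedge_coordinates_def fun_eq_iff split: option.split)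
  ultimately show "wedge_coordinates p i z = wedge_coordinates p j z'"
    if "(z = p i \<and> z' = p j) \<or> (i = j \<and> z = z')"
    using that by auto
qed

text \<open>The base points need not be vertices, so each piece is first subdivided at the image
  \<open>p i\<close> of its base point. Inserting the removed faces again joins \<open>None\<close>
  to the star of \<open>supp (p i)\<close>; that attachment shrinks to a vertex of
  \<open>supp (p i)\<close>, which is then moved to \<open>a i\<close>.\<close>

lemma wedge_sum_homotopy_equivalent_bouquet:
  fixes Ys :: "'a topology list" and V :: "nat \<Rightarrow> 'v set"
  assumes R: "symp R" and "Ys \<noteq> []"
    and V: "\<And>i. i < length Ys \<Longrightarrow> finite (V i)"
    and h: "\<And>i. i < length Ys \<Longrightarrow> Ys ! i homeomorphic_space clique_space (V i) R"
    and ps: "\<And>i. i < length Ys \<Longrightarrow> ps ! i \<in> topspace (Ys ! i)"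
    and a: "\<And>i. i < length Ys \<Longrightarrow> a i \<in> V i" "\<And>i. i < length Ys \<Longrightarrow> diameter_two (V i) R"
  shows "bouquet {..<length Ys} V R (\<lambda>i. {a i}) homotopy_equivalent_space wedge_sum Ys ps"
proof -
  let ?I = "{..<length Ys}"
  have "\<exists>h. \<forall>i\<in>?I. homeomorphic_map (Ys ! i) (clique_space (V i) R) (h i)"
    using h by (intro bchoice) (auto simp: homeomorphic_space)
  then obtain h where h: "\<And>i. i \<in> ?I \<Longrightarrow> homeomorphic_map (Ys ! i) (clique_space (V i) R) (h i)"
    by blast
  define p where "p i = h i (ps ! i)" for i
  have fin: "finite ?I" "\<And>i. i \<in> ?I \<Longrightarrow> finite (V i)" using V by auto
  have hc: "continuous_map (Ys ! i) (clique_space (V i) R) (h i)"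
    and hsurj: "h i ` topspace (Ys ! i) = topspace (clique_space (V i) R)"
    and hinj: "inj_on (h i) (topspace (Ys ! i))" if "i \<in> ?I" for i
    using h [OF that] homeomorphic_imp_continuous_map homeomorphic_imp_surjective_map
      homeomorphic_imp_injective_map by blast+
  have psi: "ps ! i \<in> topspace (Ys ! i)" if "i \<in> ?I" for i using ps that by simp
  have p: "p i \<in> topspace (clique_space (V i) R)" if "i \<in> ?I" for i
    using hsurj [OF that] psi [OF that] unfolding p_def by blast
  let ?N = "geometric_realization (pointed_complex ?I V R (\<lambda>i. supp (p i)) ?I)"
  let ?X = "sum_topology (\<lambda>i. Ys ! i) ?I"
  let ?G = "\<lambda>(i, y). wedge_coordinates p i (h i y)"
  have hz: "h i y \<in> topspace (clique_space (V i) R)" if "i \<in> ?I" "y \<in> topspace (Ys ! i)" for i y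
    using hsurj [OF that(1)] that(2) by blast
  have "compact_space (Ys ! i)" if "i \<in> ?I" for i
    using homeomorphic_compact_space [OF homeomorphic_map_imp_homeomorphic_space [OF h [OF that]]]
      compact_realization [OF finite_complex_cliques [OF fin(2) [OF that]]] by blast
  then have comp: "compact_space ?X"
    by (intro compact_space_sum_topology) auto
  have "continuous_map ?X ?N ?G"
  proof (rule continuous_map_from_sum_topology)
    show "continuous_map (Ys ! i) ?N (\<lambda>y. ?G (i, y))" if "i \<in> ?I" for i
      using continuous_map_compose [OF hc [OF that] continuous_map_wedge_coordinates [of ?I V p R i]] fin p that
      by (simp add: o_def)
  qed
  moreover have "?G ` topspace ?X = topspace ?N"
  proof (intro equalityI subsetI)
    fix y assume "y \<in> ?G ` topspace ?X"
    then obtain i x where ix: "i \<in> ?I" "x \<in> topspace (Ys ! i)" "y = wedge_coordinates p i (h i x)"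
      by (auto simp: topspace_sum_topology)
    show "y \<in> topspace ?N"
      unfolding ix(3) by (rule wedge_coordinates_in) (use fin p ix hz in auto)
  next
    fix y assume y: "y \<in> topspace ?N"
    have "\<exists>i\<in>?I. \<exists>z\<in>topspace (clique_space (V i) R). wedge_coordinates p i z = y"
      by (rule wedge_coordinates_onto [OF _ _ R _ _ y]) (use fin p \<open>Ys \<noteq> []\<close> in auto)
    then obtain i z where i: "i \<in> ?I" "z \<in> topspace (clique_space (V i) R)" "wedge_coordinates p i z = y"
      by blast
    then obtain x where "x \<in> topspace (Ys ! i)" "z = h i x" using hsurj [OF i(1)] by blast
    then have "(i, x) \<in> topspace ?X" "?G (i, x) = y" using i by auto
    then show "y \<in> ?G ` topspace ?X" by blast
  qed
  ultimately have qG: "quotient_map ?X ?N ?G"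
    using comp Hausdorff_realization by (intro continuous_imp_quotient_map)
  let ?q = "\<lambda>(i, x). if x = ps ! i then None else Some (i, x)"
  have qw: "quotient_map ?X (wedge_sum Ys ps) ?q"
    unfolding wedge_sum_def by (rule quotient_map_quotient_topology)
  have "wedge_sum Ys ps homeomorphic_space ?N"
  proof (rule quotient_maps_same_fibres [OF qw qG])
    fix u w assume "u \<in> topspace ?X" "w \<in> topspace ?X"
    then obtain i x j y where u: "u = (i, x)" "i \<in> ?I" "x \<in> topspace (Ys ! i)"
      and w: "w = (j, y)" "j \<in> ?I" "y \<in> topspace (Ys ! j)"
      by (auto simp: topspace_sum_topology)
    have 1: "h i x = p i \<longleftrightarrow> x = ps ! i" "h j y = p j \<longleftrightarrow> y = ps ! j"
      using hinj u w psi unfolding p_def inj_on_def by blast+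
    have 2: "h i x = h j y \<longleftrightarrow> x = y" if "i = j"
      using hinj [OF u(2)] u w that unfolding inj_on_def by blast
    have "?G u = ?G w \<longleftrightarrow> (h i x = p i \<and> h j y = p j) \<or> (i = j \<and> h i x = h j y)"
      unfolding u(1) w(1) prod.case
      by (rule wedge_coordinates_eq_iff [where V = V and R = R]) (use fin p u w hz in auto)
    then show "?q u = ?q w \<longleftrightarrow> ?G u = ?G w"
      using 1 2 u(1) w(1) by auto
  qed
  then have 1: "?N homotopy_equivalent_space wedge_sum Ys ps"
    using homeomorphic_imp_homotopy_equivalent_space homeomorphic_space_sym by blast
  have sp: "supp (p i) \<noteq> {} \<and> supp (p i) \<subseteq> V i" if "i \<in> ?I" for i
    using supp_of_point [OF fin(2) [OF that] p [OF that]] by blast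
  let ?A = "\<lambda>i. star_hull (V i) R (supp (p i))"
  have 2: "bouquet ?I V R ?A homotopy_equivalent_space ?N"
    by (rule remove_pointed_faces) (use fin R sp in blast)+
  have 3: "bouquet ?I V R (\<lambda>i. {a i}) homotopy_equivalent_space bouquet ?I V R ?A"
  proof (rule bouquet_change_all [OF fin(1)])
    fix i A assume i: "i \<in> ?I"
    obtain b where b: "b \<in> supp (p i)" "b \<in> V i" using sp [OF i] by blast
    have cl: "supp (p i) \<in> cliques (V i) R"
      using p [OF i] topspace_clique_space [OF fin(2) [OF i]] by blast
    \<comment> \<open>Every vertex of the face \<open>supp (p i)\<close> is compatible with its
      whole star, so the star folds to it as a cone.\<close>
    have "folds R (?A i) {b}"
    proof (rule folds_cone)
      show "finite (?A i)" using fin(2) [OF i] by (simp add: star_hull_def)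
      show "b \<in> ?A i"
        using b clique_rel [OF cl b(1)] by (auto simp: star_hull_def)
      show "R x b \<and> R b x" if "x \<in> ?A i" "x \<noteq> b" for x
        using that b R by (auto simp: star_hull_def dest: sympD)
    qed
    then have "bouquet ?I V R (A(i := ?A i)) homotopy_equivalent_space bouquet ?I V R (A(i := {b}))"
      by (intro bouquet_shrink_attachment) (use fin R i in \<open>auto simp: star_hull_def\<close>)
    then have s: "bouquet ?I V R (A(i := {b})) homotopy_equivalent_space bouquet ?I V R (A(i := ?A i))"
      by (rule iffD1 [OF homotopy_equivalent_space_sym])
    have m: "bouquet ?I V R (A(i := {a i})) homotopy_equivalent_space bouquet ?I V R (A(i := {b}))"
      by (rule bouquet_move_attachment) (use fin R i b a in auto)
    show "bouquet ?I V R (A(i := {a i})) homotopy_equivalent_space bouquet ?I V R (A(i := ?A i))"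
      by (rule homotopy_eqv_trans [OF m s])
  qed
  show ?thesis
    by (rule homotopy_eqv_trans [OF 3 homotopy_eqv_trans [OF 2 1]])
qed

section \<open>Suspensions and spheres as clique complexes\<close>

lemma vertex_in_clique_space:
  assumes "finite V" "v \<in> V"
  shows "(\<lambda>u. if u = v then 1 else 0) \<in> topspace (clique_space V R)"
proof -
  have "supp (\<lambda>u. if u = v then 1 else 0 :: real) = {v}" by (auto simp: supp_def)
  moreover have "{v} \<in> cliques V R" using assms(2) by (simp add: cliques_def)
  moreover have "(\<Sum>u\<in>V. if u = v then 1 else 0 :: real) = 1" using assms by simp
  ultimately show ?thesis using topspace_clique_space [OF assms(1)] by force
qed

text \<open>At \<open>r = 0\<close> all mass is on \<open>s\<close>, at \<open>r = 1/2\<close> it is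
  all on \<open>z\<close>, and at \<open>r = 1\<close> on \<open>t\<close>. At no level do both
  poles carry mass, as they are not joined.\<close>

definition suspension_coordinates :: "'v \<Rightarrow> 'v \<Rightarrow> ('v \<Rightarrow> real) \<Rightarrow> real \<Rightarrow> 'v \<Rightarrow> real" where
  "suspension_coordinates s t z r u =
     (if u = s then max 0 (1 - 2 * r) else if u = t then max 0 (2 * r - 1) else (1 - \<bar>2 * r - 1\<bar>) * z u)"

context
  fixes W :: "'v set" and R :: "'v \<Rightarrow> 'v \<Rightarrow> bool" and s t :: 'v
  assumes W: "finite W" and R: "symp R" and st: "s \<notin> W" "t \<notin> W" "s \<noteq> t" "\<not> R s t"
    and join: "\<And>x. x \<in> W \<Longrightarrow> R s x \<and> R t x"
begin

lemma suspension_coordinates_in: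
  assumes z: "z \<in> topspace (clique_space W R)" and r: "0 \<le> r" "r \<le> 1"
  shows "suspension_coordinates s t z r \<in> topspace (clique_space (insert s (insert t W)) R)"
proof -
  let ?y = "suspension_coordinates s t z r"
  have z': "supp z \<in> cliques W R" "\<forall>v. 0 \<le> z v" "sum z W = 1"
    using z topspace_clique_space [OF W] by blast+
  have join': "R x s" "R x t" if "x \<in> W" for x
    using join [OF that] R by (auto dest: sympD)
  have cs: "(u = s \<and> r < 1/2) \<or> (u = t \<and> r > 1/2) \<or> (u \<in> supp z \<and> u \<in> W)" if "u \<in> supp ?y" for u
  proof -
    have "u \<in> supp z" if "u \<noteq> s" "u \<noteq> t"
      using \<open>u \<in> supp ?y\<close> that by (auto simp: supp_def suspension_coordinates_def)
    moreover have "r < 1/2" if "u = s"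
      using \<open>u \<in> supp ?y\<close> that by (auto simp: supp_def suspension_coordinates_def max_def split: if_splits)
    moreover have "r > 1/2" if "u = t"
      using \<open>u \<in> supp ?y\<close> that st by (auto simp: supp_def suspension_coordinates_def max_def split: if_splits)
    moreover note clique_subset [OF z'(1)]
    ultimately show ?thesis by blast
  qed
  have "R u v" if "u \<in> supp ?y" "v \<in> supp ?y" "u \<noteq> v" for u v
    using cs [OF that(1)] cs [OF that(2)] that(3) clique_rel [OF z'(1), of u v] join join' by force
  moreover have "u \<in> insert s (insert t W)" if "u \<in> supp ?y" for u
    using cs [OF that] by blast
  ultimately have "supp ?y \<in> cliques (insert s (insert t W)) R"
    unfolding cliques_def by blast
  moreover have "0 \<le> ?y u" for u
    using z'(2) r by (auto simp: suspension_coordinates_def intro!: mult_nonneg_nonneg)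
  moreover have "sum ?y (insert s (insert t W)) = 1"
  proof -
    have "sum ?y W = (\<Sum>u\<in>W. (1 - \<bar>2 * r - 1\<bar>) * z u)"
      using st by (intro sum.cong) (auto simp: suspension_coordinates_def)
    also have "\<dots> = 1 - \<bar>2 * r - 1\<bar>" using z'(3) by (simp flip: sum_distrib_left)
    finally have "sum ?y (insert s (insert t W)) =
        max 0 (1 - 2 * r) + (max 0 (2 * r - 1) + (1 - \<bar>2 * r - 1\<bar>))"
      using st W by (simp add: suspension_coordinates_def [of s t z r s] suspension_coordinates_def [of s t z r t])
    also have "\<dots> = 1" by (auto simp: max_def abs_if)
    finally show ?thesis .
  qed
  ultimately show ?thesis using topspace_clique_space [of "insert s (insert t W)"] W by blast
qed

lemma suspension_coordinates_onto:
  assumes "W \<noteq> {}" and x: "x \<in> topspace (clique_space (insert s (insert t W)) R)"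
  shows "\<exists>z\<in>topspace (clique_space W R). \<exists>r\<in>{0..1}. suspension_coordinates s t z r = x"
proof -
  have fin: "finite (insert s (insert t W))" using W by simp
  have x': "supp x \<in> cliques (insert s (insert t W)) R" "\<And>v. 0 \<le> x v" "sum x (insert s (insert t W)) = 1"
    using x topspace_clique_space [OF fin] by blast+
  have x0: "x v = 0" if "v \<notin> insert s (insert t W)" for v
    using clique_space_zero [OF fin x that] .
  have or0: "x s = 0 \<or> x t = 0"
    using clique_rel [OF x'(1), of s t] st by (auto simp: supp_def)
  have total: "x s + x t + sum x W = 1"
    using x'(3) st W by simp
  have sW: "0 \<le> sum x W" using x'(2) by (simp add: sum_nonneg)
  \<comment> \<open>Since one of \<open>x s\<close> and \<open>x t\<close> vanishes, their
    difference determines the level: \<open>2 * r - 1 = x t - x s\<close>.\<close>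
  define r where "r = (1 - x s + x t) / 2"
  have r: "0 \<le> r" "r \<le> 1" "2 * r - 1 = x t - x s" "1 - 2 * r = x s - x t"
  proof -
    have "2 * r = 1 - x s + x t" by (simp add: r_def)
    then show "0 \<le> r" "r \<le> 1" "2 * r - 1 = x t - x s" "1 - 2 * r = x s - x t"
      using total sW x'(2) [of s] x'(2) [of t] by linarith+
  qed
  have c: "1 - \<bar>2 * r - 1\<bar> = sum x W"
    using r(3) total or0 x'(2) [of s] x'(2) [of t] by auto
  \<comment> \<open>At a pole no mass is left for \<open>W\<close> and any \<open>z\<close> serves;
    a vertex of \<open>W\<close> is taken, which exists by \<open>W \<noteq> {}\<close>. Otherwise
    the coordinates on \<open>W\<close> are normalized.\<close>
  obtain z where z: "z \<in> topspace (clique_space W R)" "\<And>u. u \<noteq> s \<Longrightarrow> u \<noteq> t \<Longrightarrow> sum x W * z u = x u"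
  proof (cases "sum x W = 0")
    case True
    then have "x u = 0" if "u \<in> W" for u
      using that W x'(2) by (simp add: sum_nonneg_eq_0_iff)
    moreover obtain w where "w \<in> W" using \<open>W \<noteq> {}\<close> by blast
    ultimately show thesis
      using that [OF vertex_in_clique_space [OF W, of w R]] True x0 by (metis insertE mult_zero_left)
  next
    case False
    define z where "z u = (if u \<in> W then x u / sum x W else 0)" for u
    have sz: "u \<in> supp x \<and> u \<in> W" if "u \<in> supp z" for u
      using that by (auto simp: supp_def z_def split: if_splits)
    have "R u v" if "u \<in> supp z" "v \<in> supp z" "u \<noteq> v" for u v
      using clique_rel [OF x'(1), of u v] sz that by blast
    then have "supp z \<in> cliques W R"
      using sz unfolding cliques_def by blast
    moreover have "0 \<le> z v" for v using x'(2) sW by (simp add: z_def)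
    moreover have "sum z W = (\<Sum>u\<in>W. x u / sum x W)"
      by (intro sum.cong) (auto simp: z_def)
    then have "sum z W = 1" using False by (simp flip: sum_divide_distrib)
    ultimately have "z \<in> topspace (clique_space W R)"
      using topspace_clique_space [OF W] by blast
    moreover have "sum x W * z u = x u" if "u \<noteq> s" "u \<noteq> t" for u
      using False x0 [of u] that by (simp add: z_def)
    ultimately show thesis by (rule that)
  qed
  have "suspension_coordinates s t z r u = x u" for u
    unfolding suspension_coordinates_def c
    using r(3,4) z(2) [of u] or0 x'(2) [of s] x'(2) [of t] by (auto simp del: diff_eq_eq)
  then show ?thesis using z(1) r(1,2) by fastforce
qed

text \<open>The coordinates at \<open>s\<close> and \<open>t\<close> determine the level. Away from
  the two ends the factor \<open>1 - \<bar>2 * r - 1\<bar>\<close> is nonzero, so the point of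
  \<open>Z\<close> is determined too; at the ends it is lost, exactly as in the suspension.\<close>

lemma suspension_clique_space:
  assumes "W \<noteq> {}" and Z: "Z homeomorphic_space clique_space W R"
  shows "suspension Z homeomorphic_space clique_space (insert s (insert t W)) R"
proof -
  obtain h where h: "homeomorphic_map Z (clique_space W R) h"
    using Z by (auto simp: homeomorphic_space)
  have hc: "continuous_map Z (clique_space W R) h"
    and hsurj: "h ` topspace Z = topspace (clique_space W R)"
    and hinj: "inj_on h (topspace Z)"
    using h homeomorphic_imp_continuous_map homeomorphic_imp_surjective_map
      homeomorphic_imp_injective_map by blast+
  let ?X = "prod_topology Z (top_of_set {0..1::real})" and ?Y = "clique_space (insert s (insert t W)) R"
  let ?F = "\<lambda>(y, r). suspension_coordinates s t (h y) r"
  have hz: "h y \<in> topspace (clique_space W R)" if "y \<in> topspace Z" for y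
    using hsurj that by blast
  have "compact_space Z"
    using homeomorphic_compact_space [OF Z] compact_realization [OF finite_complex_cliques [OF W]] by blast
  then have comp: "compact_space ?X"
    by (simp add: compact_space_prod_topology compact_space_subtopology)
  have "continuous_map ?X ?Y ?F"
    unfolding continuous_map_into_realization
  proof (intro conjI allI Pi_I)
    fix u
    have c1: "continuous_map ?X euclideanreal snd"
      using continuous_map_compose [OF continuous_map_snd continuous_map_from_subtopology [OF continuous_map_id]]
      by simp
    have "continuous_map Z euclideanreal (\<lambda>y. h y u)"
      using hc unfolding continuous_map_into_realization by blast
    then have c2: "continuous_map ?X euclideanreal (\<lambda>w. h (fst w) u)"
      using continuous_map_compose [OF continuous_map_fst] by (fastforce simp: o_def)
    show "continuous_map ?X euclideanreal (\<lambda>w. ?F w u)"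
      unfolding suspension_coordinates_def case_prod_unfold
      by (cases "u = s"; cases "u = t"; simp) (intro continuous_intros c1 c2)+
  next
    fix w assume "w \<in> topspace ?X"
    then show "?F w \<in> topspace ?Y"
      using suspension_coordinates_in hz by auto
  qed
  moreover have "?F ` topspace ?X = topspace ?Y"
  proof (intro equalityI subsetI)
    fix x assume "x \<in> ?F ` topspace ?X"
    then show "x \<in> topspace ?Y"
      using suspension_coordinates_in hz by auto
  next
    fix x assume "x \<in> topspace ?Y"
    then obtain z r where z: "z \<in> topspace (clique_space W R)" "r \<in> {0..1}"
      "suspension_coordinates s t z r = x"
      using suspension_coordinates_onto [OF \<open>W \<noteq> {}\<close>] by blast
    then obtain y where "y \<in> topspace Z" "z = h y" using hsurj by blast
    then have "(y, r) \<in> topspace ?X" "?F (y, r) = x" using z by auto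
    then show "x \<in> ?F ` topspace ?X" by blast
  qed
  ultimately have qF: "quotient_map ?X ?Y ?F"
    using comp Hausdorff_realization by (intro continuous_imp_quotient_map)
  let ?q = "\<lambda>(x, t). if t = 0 then South else if t = 1 then North else Level x t"
  have qs: "quotient_map ?X (suspension Z) ?q"
    unfolding suspension_def by (rule quotient_map_quotient_topology)
  show ?thesis
  proof (rule quotient_maps_same_fibres [OF qs qF])
    fix w w' assume ww: "w \<in> topspace ?X" "w' \<in> topspace ?X"
    obtain y r y' r' where w: "w = (y, r)" "w' = (y', r')" by (cases w; cases w')
    have y: "y \<in> topspace Z" "y' \<in> topspace Z" and r: "0 \<le> r" "r \<le> 1" "0 \<le> r'" "r' \<le> 1"
      using ww w by auto
    show "?q w = ?q w' \<longleftrightarrow> ?F w = ?F w'"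
    proof
      assume q: "?q w = ?q w'"
      then consider "r = 0" "r' = 0" | "r = 1" "r' = 1" | "r = r'" "y = y'"
        unfolding w by (auto split: if_splits)
      then show "?F w = ?F w'"
        unfolding w by cases (auto simp: suspension_coordinates_def fun_eq_iff)
    next
      assume F: "?F w = ?F w'"
      have e: "suspension_coordinates s t (h y) r u = suspension_coordinates s t (h y') r' u" for u
        using fun_cong [OF F, of u] unfolding w by simp
      have "max 0 (1 - 2 * r) = max 0 (1 - 2 * r')" "max 0 (2 * r - 1) = max 0 (2 * r' - 1)"
        using e [of s] e [of t] st(3) by (auto simp: suspension_coordinates_def)
      then have rr: "r = r'" by (auto simp: max_def split: if_splits)
      have "y = y'" if "r \<noteq> 0" "r \<noteq> 1"
      proof -
        have c: "1 - \<bar>2 * r - 1\<bar> \<noteq> 0" using that r by auto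
        have "h y u = h y' u" for u
        proof (cases "u = s \<or> u = t")
          case True
          then have "u \<notin> W" using st by auto
          then show ?thesis using clique_space_zero [OF W] hz y by metis
        next
          case False
          then show ?thesis using e [of u] c rr by (simp add: suspension_coordinates_def)
        qed
        then have "h y = h y'" by blast
        then show ?thesis using hinj y by (auto dest: inj_onD)
      qed
      then show "?q w = ?q w'" unfolding w using rr by auto
    qed
  qed
qed

end

text \<open>Joining with the two nonadjacent vertices of a pair is a suspension.\<close>

fun add_pairs :: "'v set \<Rightarrow> ('v \<times> 'v) list \<Rightarrow> 'v set" where
  "add_pairs W [] = W"
| "add_pairs W ((s, t) # ps) = insert s (insert t (add_pairs W ps))"

fun suspending :: "('v \<Rightarrow> 'v \<Rightarrow> bool) \<Rightarrow> 'v set \<Rightarrow> ('v \<times> 'v) list \<Rightarrow> bool" where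
  "suspending R W [] = True"
| "suspending R W ((s, t) # ps) \<longleftrightarrow> suspending R W ps \<and> s \<notin> add_pairs W ps \<and> t \<notin> add_pairs W ps \<and>
     s \<noteq> t \<and> \<not> R s t \<and> (\<forall>x\<in>add_pairs W ps. R s x \<and> R t x)"

lemma finite_add_pairs: "finite W \<Longrightarrow> finite (add_pairs W ps)"
  by (induction W ps rule: add_pairs.induct) auto

lemma subset_add_pairs: "W \<subseteq> add_pairs W ps"
  by (induction W ps rule: add_pairs.induct) auto

lemma add_pairs_eq: "add_pairs W ps = W \<union> fst ` set ps \<union> snd ` set ps"
  by (induction W ps rule: add_pairs.induct) auto

lemma quotient_topology_Base: "quotient_topology X Base homeomorphic_space X"
proof (rule quotient_maps_same_fibres [OF quotient_map_quotient_topology])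
  have "{x \<in> topspace X. x \<in> U} = U" if "U \<subseteq> topspace X" for U using that by auto
  then show "quotient_map X X id" by (simp add: quotient_map_def)
qed auto

lemma iterated_suspension_clique_space:
  assumes W: "finite W" "W \<noteq> {}" and R: "symp R" and "suspending R W ps"
  shows "iterated_suspension (length ps) (clique_space W R) homeomorphic_space clique_space (add_pairs W ps) R"
  using assms(1,2,4)
proof (induction W ps rule: add_pairs.induct)
  case (1 W)
  then show ?case by (simp add: iterated_suspension_def quotient_topology_Base)
next
  case (2 W s t ps)
  have "suspension (iterated_suspension (length ps) (clique_space W R)) homeomorphic_space
      clique_space (insert s (insert t (add_pairs W ps))) R"
    by (rule suspension_clique_space) (use 2 R finite_add_pairs [of W ps] subset_add_pairs [of W ps] in auto)
  then show ?case by (simp add: iterated_suspension_def)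
qed

text \<open>Two vertices of the base meet through a pole, and the two poles meet through any vertex
  of the base.\<close>

lemma diameter_two_suspending:
  assumes R: "symp R" and "suspending R W ((s, t) # ps)" "add_pairs W ps \<noteq> {}"
  shows "diameter_two (add_pairs W ((s, t) # ps)) R"
proof -
  have j: "R s x" "R t x" "R x s" "R x t" if "x \<in> add_pairs W ps" for x
    using assms(2) that R by (auto dest: sympD)
  obtain w where w: "w \<in> add_pairs W ps" using assms(3) by blast
  show ?thesis
    unfolding diameter_two_def add_pairs.simps
  proof (intro ballI)
    fix a b assume "a \<in> insert s (insert t (add_pairs W ps))" "b \<in> insert s (insert t (add_pairs W ps))"
    then show "a = b \<or> R a b \<or> (\<exists>c\<in>insert s (insert t (add_pairs W ps)). R a c \<and> R c b)"
      using j w by blast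
  qed
qed

lemma suspending_nth:
  assumes "suspending R W ps" "symp R" "i < length ps" "j < length ps" "i \<noteq> j"
    and "u = fst (ps ! i) \<or> u = snd (ps ! i)" "v = fst (ps ! j) \<or> v = snd (ps ! j)"
  shows "u \<noteq> v \<and> R u v"
  using assms
proof (induction W ps arbitrary: i j u v rule: add_pairs.induct)
  case (2 W s t ps)
  have mem: "w \<in> add_pairs W ps" if "w = fst (ps ! k) \<or> w = snd (ps ! k)" "k < length ps" for w k
    using that unfolding add_pairs_eq by auto
  have j: "w \<noteq> s \<and> w \<noteq> t \<and> R s w \<and> R t w \<and> R w s \<and> R w t"
    if "w = fst (ps ! k) \<or> w = snd (ps ! k)" "k < length ps" for w k
    using mem [OF that] 2(2,3) by (auto dest: sympD)
  show ?case
  proof (cases i)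
    case 0
    then obtain j' where "j = Suc j'" using \<open>i \<noteq> j\<close> by (cases j) auto
    then show ?thesis using 0 2 j [of v j'] by auto
  next
    case (Suc i')
    show ?thesis
    proof (cases j)
      case 0
      then show ?thesis using Suc 2 j [of u i'] by auto
    next
      case (Suc j')
      then show ?thesis
        using \<open>i = Suc i'\<close> 2(2-) by (intro "2.IH" [of i' j']) auto
    qed
  qed
qed simp

lemma suspending_nth_pair:
  assumes "suspending R W ps" "i < length ps"
  shows "fst (ps ! i) \<noteq> snd (ps ! i) \<and> \<not> R (fst (ps ! i)) (snd (ps ! i))"
  using assms
proof (induction W ps arbitrary: i rule: add_pairs.induct)
  case (2 W s t ps)
  then show ?case by (cases i) auto
qed simp

section \<open>Spheres as boundaries of cross-polytopes\<close>

lemma topspace_nsphere: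
  "x \<in> topspace (nsphere k) \<longleftrightarrow> (\<Sum>i\<le>k. (x i)\<^sup>2) = 1 \<and> (\<forall>i>k. x i = 0)"
  by (simp add: nsphere)

text \<open>The vertices of the cross-polytope are paired with the points \<open>\<plusminus>e\<^sub>i\<close> of the sphere, and the
  unit sphere of the sum norm is projected radially to the Euclidean one.\<close>

lemma nsphere_clique_space:
  assumes R: "symp R" and ps: "suspending R {} ps" "length ps = Suc k"
  shows "nsphere k homeomorphic_space clique_space (add_pairs {} ps) R"
proof -
  let ?W = "add_pairs {} ps"
  define s where "s i = fst (ps ! i)" for i
  define t where "t i = snd (ps ! i)" for i
  have fin: "finite ?W" by (simp add: finite_add_pairs)
  have W: "?W = s ` {..k} \<union> t ` {..k}"
  proof -
    have "set ps = (!) ps ` {..k}"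
      using ps(2) by (auto simp: set_conv_nth less_Suc_eq_le)
    then show ?thesis by (simp add: add_pairs_eq s_def t_def image_image)
  qed
  have st: "s i \<noteq> t i" "\<not> R (s i) (t i)" if "i \<le> k" for i
    using suspending_nth_pair [OF ps(1), of i] ps(2) that by (auto simp: s_def t_def)
  have nth: "u \<noteq> v \<and> R u v" if "i \<le> k" "j \<le> k" "i \<noteq> j" "u = s i \<or> u = t i" "v = s j \<or> v = t j" for i j u v
    by (rule suspending_nth [OF ps(1) R, of i j]) (use that ps(2) in \<open>auto simp: s_def t_def\<close>)
  have eqs: "s i = s j \<longleftrightarrow> i = j" "t i = t j \<longleftrightarrow> i = j" "s i \<noteq> t j" "t i \<noteq> s j" if "i \<le> k" "j \<le> k" for i j
    using nth [OF that] st [OF that(1)] by metis+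
  have sumW: "sum x ?W = (\<Sum>i\<le>k. x (s i) + x (t i))" for x :: "'a \<Rightarrow> real"
  proof -
    have "sum x ?W = sum x (s ` {..k}) + sum x (t ` {..k})"
      unfolding W using eqs by (intro sum.union_disjoint) auto
    also have "sum x (s ` {..k}) = (\<Sum>i\<le>k. x (s i))"
      using eqs by (subst sum.reindex) (auto simp: inj_on_def)
    also have "sum x (t ` {..k}) = (\<Sum>i\<le>k. x (t i))"
      using eqs by (subst sum.reindex) (auto simp: inj_on_def)
    finally show ?thesis by (simp add: sum.distrib)
  qed
  \<comment> \<open>The signed coordinate on the axis \<open>i\<close>. As \<open>s i\<close> and
    \<open>t i\<close> are not joined, at most one of the two masses is nonzero, and
    \<open>D\<close> loses no information.\<close>
  define D where "D x i = x (s i) - x (t i)" for x :: "'a \<Rightarrow> real" and i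
  define Q where "Q x = sqrt (\<Sum>i\<le>k. (D x i)\<^sup>2)" for x
  let ?f = "\<lambda>x i. if i \<le> k then D x i / Q x else 0"
  let ?X = "clique_space ?W R"
  have X: "x (s i) = 0 \<or> x (t i) = 0" "0 \<le> x v" "(\<Sum>i\<le>k. \<bar>D x i\<bar>) = 1"
    if "x \<in> topspace ?X" "i \<le> k" for x i v
  proof -
    have x: "supp x \<in> cliques ?W R" "\<And>v. 0 \<le> x v" "sum x ?W = 1"
      using that(1) topspace_clique_space [OF fin] by blast+
    have or0: "x (s i) = 0 \<or> x (t i) = 0" if "i \<le> k" for i
      using clique_rel [OF x(1), of "s i" "t i"] st [OF that] by (auto simp: supp_def)
    show "x (s i) = 0 \<or> x (t i) = 0" by (rule or0 [OF that(2)])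
    show "0 \<le> x v" by (rule x)
    have "(\<Sum>i\<le>k. \<bar>D x i\<bar>) = (\<Sum>i\<le>k. x (s i) + x (t i))"
    proof (rule sum.cong)
      fix i assume "i \<in> {..k}"
      then show "\<bar>D x i\<bar> = x (s i) + x (t i)"
        using or0 [of i] x(2) [of "s i"] x(2) [of "t i"] by (auto simp: D_def)
    qed simp
    then show "(\<Sum>i\<le>k. \<bar>D x i\<bar>) = 1" using sumW [of x] x(3) by simp
  qed
  have Qpos: "0 < Q x" if x: "x \<in> topspace ?X" for x
  proof -
    have "\<exists>i\<le>k. D x i \<noteq> 0"
    proof (rule ccontr)
      assume "\<not> (\<exists>i\<le>k. D x i \<noteq> 0)"
      then have "(\<Sum>i\<le>k. \<bar>D x i\<bar>) = 0" by simp
      then show False using X(3) [OF x, of 0] by simp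
    qed
    then obtain i where "i \<le> k" "D x i \<noteq> 0" by blast
    then have "0 < (\<Sum>i\<le>k. (D x i)\<^sup>2)" by (intro sum_pos2 [of _ i]) auto
    then show ?thesis by (simp add: Q_def)
  qed
  have "continuous_map ?X (nsphere k) ?f"
    unfolding nsphere continuous_map_in_subtopology continuous_map_componentwise_UNIV
  proof (intro conjI allI)
    fix i
    have "continuous_map ?X euclideanreal (\<lambda>x. \<Sum>i\<le>k. (D x i)\<^sup>2)"
      unfolding D_def by (intro continuous_intros) auto
    then have "continuous_map ?X euclideanreal Q"
      unfolding Q_def using continuous_map_compose [of ?X euclideanreal _ euclideanreal sqrt]
        continuous_on_real_sqrt [OF continuous_on_id, of UNIV] by (simp add: o_def)
    then have "continuous_map ?X euclideanreal (\<lambda>x. D x i / Q x)"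
      unfolding D_def using Qpos by (intro continuous_intros) fastforce+
    then show "continuous_map ?X euclideanreal (\<lambda>x. ?f x i)"
      by (cases "i \<le> k") simp_all
  next
    have "(\<Sum>i\<le>k. (?f x i)\<^sup>2) = 1" if x: "x \<in> topspace ?X" for x
    proof -
      have "(\<Sum>i\<le>k. (?f x i)\<^sup>2) = (\<Sum>i\<le>k. (D x i)\<^sup>2) / (Q x)\<^sup>2"
        by (simp add: power_divide sum_divide_distrib)
      also have "(\<Sum>i\<le>k. (D x i)\<^sup>2) = (Q x)\<^sup>2"
        by (simp add: Q_def sum_nonneg)
      finally show ?thesis using Qpos [OF x] by simp
    qed
    then show "?f \<in> topspace ?X \<rightarrow> {x. (\<Sum>i\<le>k. (x i)\<^sup>2) = 1 \<and> (\<forall>i>k. x i = 0)}"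
      by auto
  qed
  moreover have "compact_space ?X"
    by (rule compact_realization [OF finite_complex_cliques [OF fin]])
  moreover have "Hausdorff_space (nsphere k)"
    unfolding nsphere by (intro Hausdorff_space_subtopology) (simp add: Hausdorff_space_product_topology)
  moreover have "?f ` topspace ?X = topspace (nsphere k)"
  proof (intro equalityI subsetI)
    fix y assume "y \<in> ?f ` topspace ?X"
    then show "y \<in> topspace (nsphere k)"
      using continuous_map_image_subset_topspace [OF calculation(1)] by blast
  next
    fix y assume "y \<in> topspace (nsphere k)"
    then have y: "(\<Sum>i\<le>k. (y i)\<^sup>2) = 1" "\<And>i. i > k \<Longrightarrow> y i = 0"
      by (auto simp: topspace_nsphere)
    define N where "N = (\<Sum>i\<le>k. \<bar>y i\<bar>)"
    have N: "0 < N"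
    proof -
      have "\<exists>i\<le>k. y i \<noteq> 0" using y(1) by (metis (no_types, lifting) atMost_iff sum.neutral zero_neq_one zero_power2)
      then obtain i where "i \<le> k" "y i \<noteq> 0" by blast
      then show ?thesis unfolding N_def by (intro sum_pos2 [of _ i]) auto
    qed
    \<comment> \<open>The point of \<open>y\<close> rescaled to sum norm 1: positive parts go to the
      vertices \<open>s i\<close>, negative parts to \<open>t i\<close>.\<close>
    define x where "x u = (\<Sum>i\<le>k. (if u = s i then max 0 (y i) / N else 0) + (if u = t i then max 0 (- y i) / N else 0))"
      for u
    have xs: "x (s i) = max 0 (y i) / N" if "i \<le> k" for i
    proof -
      have "x (s i) = (\<Sum>j\<le>k. if j = i then max 0 (y j) / N else 0)"
        unfolding x_def using eqs that by (intro sum.cong) auto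
      then show ?thesis using that by simp
    qed
    have xt: "x (t i) = max 0 (- y i) / N" if "i \<le> k" for i
    proof -
      have "x (t i) = (\<Sum>j\<le>k. if j = i then max 0 (- y j) / N else 0)"
        unfolding x_def using eqs that by (intro sum.cong) auto
      then show ?thesis using that by simp
    qed
    have sx: "(\<exists>i\<le>k. u = s i \<and> 0 < y i) \<or> (\<exists>i\<le>k. u = t i \<and> y i < 0)" if u: "u \<in> supp x" for u
    proof -
      have "u \<in> s ` {..k} \<union> t ` {..k}"
      proof (rule ccontr)
        assume "u \<notin> s ` {..k} \<union> t ` {..k}"
        then have "x u = 0" unfolding x_def by (intro sum.neutral) auto
        then show False using u by (simp add: supp_def)
      qed
      then show ?thesis
        using u xs xt N by (fastforce simp: supp_def max_def split: if_splits)
    qed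
    have "supp x \<in> cliques ?W R"
    proof -
      have "u \<in> ?W" if "u \<in> supp x" for u using sx [OF that] W by auto
      moreover have "R u v" if "u \<in> supp x" "v \<in> supp x" "u \<noteq> v" for u v
        using sx [OF that(1)] sx [OF that(2)]
      proof (elim disjE exE conjE)
        fix i j assume "i \<le> k" "u = s i" "j \<le> k" "v = s j"
        then show ?thesis using nth [of i j u v] \<open>u \<noteq> v\<close> by auto
      next
        fix i j assume "i \<le> k" "u = s i" "0 < y i" "j \<le> k" "v = t j" "y j < 0"
        then show ?thesis using nth [of i j u v] by (cases "i = j") auto
      next
        fix i j assume "i \<le> k" "u = t i" "y i < 0" "j \<le> k" "v = s j" "0 < y j"
        then show ?thesis using nth [of i j u v] by (cases "i = j") auto
      next
        fix i j assume "i \<le> k" "u = t i" "j \<le> k" "v = t j"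
        then show ?thesis using nth [of i j u v] \<open>u \<noteq> v\<close> by auto
      qed
      ultimately show ?thesis unfolding cliques_def by blast
    qed
    moreover have "0 \<le> x u" for u
      unfolding x_def using N by (intro sum_nonneg) auto
    moreover have "sum x ?W = (\<Sum>i\<le>k. \<bar>y i\<bar> / N)"
      unfolding sumW by (intro sum.cong) (auto simp: xs xt max_def)
    then have "sum x ?W = 1" using N by (simp add: N_def flip: sum_divide_distrib)
    ultimately have xX: "x \<in> topspace ?X" using topspace_clique_space [OF fin] by blast
    have Dx: "D x i = y i / N" if "i \<le> k" for i
      using that by (simp add: D_def xs xt max_def)
    then have "(\<Sum>i\<le>k. (D x i)\<^sup>2) = (\<Sum>i\<le>k. (y i)\<^sup>2) / N\<^sup>2"
      by (simp add: power_divide sum_divide_distrib)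
    then have "Q x = 1 / N" using y(1) N by (simp add: Q_def real_sqrt_divide)
    then have "?f x i = y i" for i using Dx [of i] y(2) [of i] N by auto
    then have "?f x = y" by blast
    then show "y \<in> ?f ` topspace ?X" using xX by blast
  qed
  moreover have "inj_on ?f (topspace ?X)"
  proof (rule inj_onI)
    fix x x' assume x: "x \<in> topspace ?X" "x' \<in> topspace ?X" and eq: "?f x = ?f x'"
    \<comment> \<open>Points with the same radial projection are proportional, and since both have
      sum norm 1, the factor is 1.\<close>
    have D: "D x i = Q x / Q x' * D x' i" if "i \<le> k" for i
      using fun_cong [OF eq, of i] that Qpos [OF x(1)] Qpos [OF x(2)] by (simp add: field_simps)
    have "(\<Sum>i\<le>k. \<bar>D x i\<bar>) = Q x / Q x' * (\<Sum>i\<le>k. \<bar>D x' i\<bar>)"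
      using Qpos [OF x(1)] Qpos [OF x(2)] D by (simp add: abs_mult sum_distrib_left)
    then have "Q x / Q x' = 1" using X(3) [OF x(1), of 0] X(3) [OF x(2), of 0] by simp
    then have DD: "D x i = D x' i" if "i \<le> k" for i using D [OF that] by simp
    have "x u = x' u" for u
    proof (cases "u \<in> ?W")
      case True
      then obtain i where i: "i \<le> k" "u = s i \<or> u = t i" using W by auto
      have "x (s i) = x' (s i)" "x (t i) = x' (t i)"
        using DD [OF i(1)] X(1) [OF x(1) i(1)] X(1) [OF x(2) i(1)]
          X(2) [OF x(1) i(1), of "s i"] X(2) [OF x(1) i(1), of "t i"]
          X(2) [OF x(2) i(1), of "s i"] X(2) [OF x(2) i(1), of "t i"] by (auto simp: D_def)
      then show ?thesis using i by blast
    next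
      case False
      then show ?thesis using clique_space_zero [OF fin x(1)] clique_space_zero [OF fin x(2)] by simp
    qed
    then show "x = x'" by blast
  qed
  ultimately have "homeomorphic_map ?X (nsphere k) ?f"
    by (intro continuous_imp_homeomorphic_map)
  then show ?thesis
    using homeomorphic_map_imp_homeomorphic_space homeomorphic_space_sym by blast
qed

section \<open>Wedge decompositions from splittings\<close>

lemma folds_trans: "folds R U U' \<Longrightarrow> folds R U' U'' \<Longrightarrow> folds R U U''"
  by (induction rule: folds.induct) (auto intro: folds_step)

text \<open>The vertices of \<open>S\<close> are compatible with everything in \<open>U\<close> and
  cannot obstruct a domination there. With the two poles as \<open>S\<close>, a link can be folded
  inside its suspension.\<close>

lemma folds_join:
  assumes "folds R U U'" "S \<inter> U = {}" "\<And>x y. x \<in> U \<Longrightarrow> y \<in> S \<Longrightarrow> R x y"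
  shows "folds R (S \<union> U) (S \<union> U')"
  using assms
proof (induction rule: folds.induct)
  case (folds_refl U)
  then show ?case by (simp add: folds.folds_refl)
next
  case (folds_step U x w U')
  have "dominated R (S \<union> U) x w"
    using folds_step.hyps(1) folds_step.prems unfolding dominated_def by blast
  moreover have "S \<union> U - {x} = S \<union> (U - {x})"
    using folds_step.hyps(1) folds_step.prems unfolding dominated_def by auto
  moreover have "folds R (S \<union> (U - {x})) (S \<union> U')"
    by (rule folds_step.IH) (use folds_step.prems in auto)
  ultimately show ?case using folds.folds_step by metis
qed

text \<open>Splitting requires that \<open>None\<close> be joined to the whole link of
  \<open>v\<close>. The attachment is therefore widened from \<open>{a}\<close> to \<open>U\<close>,
  by reading the fold of \<open>U\<close> backwards, and narrowed again after the split.\<close>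

lemma bouquet_split_fold:
  assumes fin: "finite I" "\<And>i. i \<in> I \<Longrightarrow> finite (V i)" and R: "symp R" and i: "i \<in> I" "k \<notin> I"
    and v: "v \<in> V i" and N: "{x \<in> V i. x \<noteq> v \<and> R v x} \<subseteq> U" and U: "U \<subseteq> V i - {v}" "folds R U {a}"
    and L: "folds R {x \<in> V i. x \<noteq> v \<and> R v x} L"
    and st: "s \<notin> V i" "t \<notin> V i" "s \<noteq> t" "\<not> R s t" "\<And>x. x \<in> V i \<Longrightarrow> R s x \<and> R t x"
  shows "bouquet I V R (A(i := {a})) homotopy_equivalent_space
    bouquet (insert k I) (V(i := V i - {v}, k := insert s (insert t L))) R (A(i := {a}, k := {s}))"
proof -
  let ?N = "{x \<in> V i. x \<noteq> v \<and> R v x}"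
  let ?V' = "V(i := V i - {v}, k := insert s (insert t ?N))"
  have ik: "i \<noteq> k" using i by auto
  have fin': "finite (insert k I)" "\<And>j. j \<in> insert k I \<Longrightarrow> finite (?V' j)"
    using fin i by auto
  have "bouquet I V R (A(i := U)) homotopy_equivalent_space bouquet I V R (A(i := {a}))"
    by (rule bouquet_shrink_attachment) (use fin R i U in auto)
  then have 1: "bouquet I V R (A(i := {a})) homotopy_equivalent_space bouquet I V R (A(i := U))"
    by (rule iffD1 [OF homotopy_equivalent_space_sym])
  have 2: "bouquet I V R (A(i := U)) homotopy_equivalent_space
      bouquet (insert k I) ?V' R ((A(i := U))(k := {s}))"
    by (rule bouquet_split) (use fin R i v N U st in auto)
  have sw: "(A(i := B))(k := {s}) = (A(k := {s}))(i := B)" for B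
    using ik by (simp add: fun_upd_twist)
  \<comment> \<open>The same fold still works after the split because \<open>U\<close> avoids
    \<open>v\<close>.\<close>
  have 3: "bouquet (insert k I) ?V' R ((A(i := U))(k := {s})) homotopy_equivalent_space
      bouquet (insert k I) ?V' R ((A(i := {a}))(k := {s}))"
    unfolding sw by (rule bouquet_shrink_attachment) (use fin' R i U ik in auto)
  have Rts: "R x s" "R x t" if "x \<in> V i" for x
    using st(5) [OF that] R by (auto dest: sympD)
  have "folds R ({s, t} \<union> ?N) ({s, t} \<union> L)"
    by (rule folds_join [OF L]) (use st Rts in auto)
  then have "folds R (insert s (insert t ?N)) (insert s (insert t L))"
    by simp
  then have "bouquet (insert k I) ?V' R ((A(i := {a}))(k := {s})) homotopy_equivalent_space
      bouquet (insert k I) (?V'(k := insert s (insert t L))) R ((A(i := {a}))(k := {s}))"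
    by (intro bouquet_fold_piece) (use fin' R in auto)
  then have 4: "bouquet (insert k I) ?V' R ((A(i := {a}))(k := {s})) homotopy_equivalent_space
      bouquet (insert k I) (V(i := V i - {v}, k := insert s (insert t L))) R ((A(i := {a}))(k := {s}))"
    by simp
  show ?thesis
    by (rule homotopy_eqv_trans [OF 1 homotopy_eqv_trans [OF 2 homotopy_eqv_trans [OF 3 4]]])
qed

lemma homotopy_equivalent_wedgeI:
  fixes Ys :: "'a topology list"
  assumes X: "X homotopy_equivalent_space bouquet {..<length Ys} V R (\<lambda>i. {a i})"
    and R: "symp R" and "Ys \<noteq> []"
    and Y: "\<And>i. i < length Ys \<Longrightarrow> finite (V i) \<and> a i \<in> V i \<and> diameter_two (V i) R \<and>
      Ys ! i homeomorphic_space clique_space (V i) R"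
  shows "homotopy_equivalent_wedge X Ys"
  unfolding homotopy_equivalent_wedge_def
proof (intro conjI ballI allI impI)
  fix Z assume "Z \<in> set Ys"
  then obtain i where i: "i < length Ys" "Z = Ys ! i" by (auto simp: in_set_conv_nth)
  then have "topspace (clique_space (V i) R) \<noteq> {}"
    using vertex_in_clique_space [of "V i" "a i" R] Y [OF i(1)] by blast
  then show "topspace Z \<noteq> {}"
    using homeomorphic_empty_space Y [OF i(1)] i(2) by (metis null_topspace_iff_trivial)
next
  fix ps assume "list_all2 (\<lambda>p Y. p \<in> topspace Y) ps Ys"
  then have "bouquet {..<length Ys} V R (\<lambda>i. {a i}) homotopy_equivalent_space wedge_sum Ys ps"
    by (intro wedge_sum_homotopy_equivalent_bouquet) (use R \<open>Ys \<noteq> []\<close> Y in \<open>auto simp: list_all2_conv_all_nth\<close>)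
  with X show "X homotopy_equivalent_space wedge_sum Ys ps"
    by (rule homotopy_eqv_trans)
qed

text \<open>The piece left after the split hangs on \<open>a\<close>, so \<open>a\<close> has to
  survive its folding to \<open>K\<close>.\<close>

lemma wedge_of_split:
  fixes V :: "'v set"
  assumes V: "finite V" and R: "symp R"
    and v: "v \<in> V" "{x \<in> V. x \<noteq> v \<and> R v x} \<subseteq> U" "U \<subseteq> V - {v}" "folds R U {a}"
    and L: "folds R {x \<in> V. x \<noteq> v \<and> R v x} L"
    and K: "folds R (V - {v}) K" "a \<in> K"
    and st: "s \<notin> V" "t \<notin> V" "s \<noteq> t" "\<not> R s t" "\<And>x. x \<in> V \<Longrightarrow> R s x \<and> R t x"
    and Y: "Y0 homeomorphic_space clique_space K R" "diameter_two K R"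
      "Y1 homeomorphic_space clique_space (insert s (insert t L)) R" "diameter_two (insert s (insert t L)) R"
  shows "homotopy_equivalent_wedge (clique_space V R) [Y0, Y1]"
proof -
  let ?P = "\<lambda>_::nat. V" and ?A = "\<lambda>_::nat. {a}"
  have KV: "K \<subseteq> V" "L \<subseteq> V" using folds_subset [OF K(1)] folds_subset [OF L] by auto
  have a: "a \<in> V" using K KV by blast
  have A0: "?A(0 := {a}) = ?A" by auto
  have 1: "clique_space V R homotopy_equivalent_space bouquet {0::nat} ?P R (?A(0 := {a}))"
    unfolding A0 by (rule bouquet_single [OF V R a])
  let ?L = "insert s (insert t L)"
  have 2: "bouquet {0::nat} ?P R (?A(0 := {a})) homotopy_equivalent_space
      bouquet {1, 0} (?P(0 := V - {v}, 1 := ?L)) R (?A(0 := {a}, 1 := {s}))"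
    by (rule bouquet_split_fold) (use V R v L st in auto)
  have "bouquet {1, 0} (?P(0 := V - {v}, 1 := ?L)) R (?A(0 := {a}, 1 := {s})) homotopy_equivalent_space
      bouquet {1, 0} ((?P(0 := V - {v}, 1 := ?L))(0 := K)) R (?A(0 := {a}, 1 := {s}))"
    by (rule bouquet_fold_piece) (use V R K KV finite_subset in auto)
  moreover have "(?P(0 := V - {v}, 1 := ?L))(0 := K) = ?P(0 := K, 1 := ?L)"
    "?A(0 := {a}, 1 := {s}) = (\<lambda>i. {if i = 1 then s else a})"
    by (auto simp: fun_eq_iff)
  moreover have "{1, 0} = {..<length [Y0, Y1]}" by auto
  ultimately have 3: "bouquet {1, 0} (?P(0 := V - {v}, 1 := ?L)) R (?A(0 := {a}, 1 := {s})) homotopy_equivalent_space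
      bouquet {..<length [Y0, Y1]} (?P(0 := K, 1 := ?L)) R (\<lambda>i. {if i = 1 then s else a})"
    by (simp only:)
  show ?thesis
    by (rule homotopy_equivalent_wedgeI [OF homotopy_eqv_trans [OF 1 homotopy_eqv_trans [OF 2 3]] R])
      (use V K KV Y finite_subset in \<open>auto simp: less_Suc_eq\<close>)
qed

text \<open>The second split happens in the piece \<open>V - {v}\<close>, which the first one has
  left attached at \<open>a\<close>; this is why \<open>U'\<close> must fold to the same vertex as
  \<open>U\<close>. The poles \<open>s\<close> and \<open>t\<close> may serve for both links since
  the pieces are tagged.\<close>

lemma wedge_of_two_splits:
  fixes V :: "'v set"
  assumes V: "finite V" and R: "symp R"
    and v: "v \<in> V" "{x \<in> V. x \<noteq> v \<and> R v x} \<subseteq> U" "U \<subseteq> V - {v}" "folds R U {a}"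
    and L: "folds R {x \<in> V. x \<noteq> v \<and> R v x} L"
    and w: "w \<in> V - {v}" "{x \<in> V - {v}. x \<noteq> w \<and> R w x} \<subseteq> U'" "U' \<subseteq> V - {v} - {w}" "folds R U' {a}"
    and M: "folds R {x \<in> V - {v}. x \<noteq> w \<and> R w x} M"
    and K: "folds R (V - {v} - {w}) K" "a \<in> K"
    and st: "s \<notin> V" "t \<notin> V" "s \<noteq> t" "\<not> R s t" "\<And>x. x \<in> V \<Longrightarrow> R s x \<and> R t x"
    and Y: "Y0 homeomorphic_space clique_space K R" "diameter_two K R"
      "Y1 homeomorphic_space clique_space (insert s (insert t M)) R" "diameter_two (insert s (insert t M)) R"
      "Y2 homeomorphic_space clique_space (insert s (insert t L)) R" "diameter_two (insert s (insert t L)) R"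
  shows "homotopy_equivalent_wedge (clique_space V R) [Y0, Y1, Y2]"
proof -
  let ?P = "\<lambda>_::nat. V" and ?A = "\<lambda>_::nat. {a}"
  let ?L = "insert s (insert t L)" and ?M = "insert s (insert t M)"
  have KV: "K \<subseteq> V" "L \<subseteq> V" "M \<subseteq> V"
    using folds_subset [OF K(1)] folds_subset [OF L] folds_subset [OF M] by auto
  have finL: "finite L" using KV V finite_subset by blast
  have a: "a \<in> V" using K KV by blast
  have A0: "?A(0 := {a}) = ?A" by auto
  have 1: "clique_space V R homotopy_equivalent_space bouquet {0::nat} ?P R (?A(0 := {a}))"
    unfolding A0 by (rule bouquet_single [OF V R a])
  \<comment> \<open>The first link gets index 2 so that the pieces end in the order of the list
    \<open>[Y0, Y1, Y2]\<close>.\<close>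
  have 2: "bouquet {0::nat} ?P R (?A(0 := {a})) homotopy_equivalent_space
      bouquet {2, 0} (?P(0 := V - {v}, 2 := ?L)) R (?A(0 := {a}, 2 := {s}))"
    by (rule bouquet_split_fold) (use V R v L st in auto)
  let ?P2 = "?P(0 := V - {v}, 2 := ?L)"
  have sw: "?A(0 := {a}, 2 := {s}) = (?A(2 := {s}))(0 := {a})" by (auto simp: fun_eq_iff)
  have 3: "bouquet {2, 0} ?P2 R (?A(0 := {a}, 2 := {s})) homotopy_equivalent_space
      bouquet {1, 2, 0} (?P2(0 := ?P2 0 - {w}, 1 := ?M)) R ((?A(2 := {s}))(0 := {a}, 1 := {s}))"
    unfolding sw by (rule bouquet_split_fold) (use V R w M st finL in auto)
  have "bouquet {1, 2, 0} (?P2(0 := ?P2 0 - {w}, 1 := ?M)) R ((?A(2 := {s}))(0 := {a}, 1 := {s})) homotopy_equivalent_space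
      bouquet {1, 2, 0} ((?P2(0 := ?P2 0 - {w}, 1 := ?M))(0 := K)) R ((?A(2 := {s}))(0 := {a}, 1 := {s}))"
    by (rule bouquet_fold_piece) (use V R K KV finL finite_subset in auto)
  moreover have "(?P2(0 := ?P2 0 - {w}, 1 := ?M))(0 := K) = ?P(0 := K, 1 := ?M, 2 := ?L)"
    "(?A(2 := {s}))(0 := {a}, 1 := {s}) = (\<lambda>i. {if i = 1 \<or> i = 2 then s else a})"
    by (auto simp: fun_eq_iff)
  moreover have "{1, 2, 0} = {..<length [Y0, Y1, Y2]}" by auto
  ultimately have 4: "bouquet {1, 2, 0} (?P2(0 := ?P2 0 - {w}, 1 := ?M)) R ((?A(2 := {s}))(0 := {a}, 1 := {s})) homotopy_equivalent_space
      bouquet {..<length [Y0, Y1, Y2]} (?P(0 := K, 1 := ?M, 2 := ?L)) R (\<lambda>i. {if i = 1 \<or> i = 2 then s else a})"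
    by (simp only:)
  show ?thesis
    by (rule homotopy_equivalent_wedgeI [OF homotopy_eqv_trans [OF 1 homotopy_eqv_trans [OF 2 homotopy_eqv_trans [OF 3 4]]] R])
      (use V K KV Y finite_subset in \<open>auto simp: less_Suc_eq\<close>)
qed

section \<open>The hexagonal grid graphs\<close>

text \<open>Neighbours in the infinite grid, which contains every \<open>H\<^sub>n\<close> as an induced subgraph. Row \<open>0\<close> is not
  used by the grids: its edge from \<open>(0, 0)\<close> to \<open>(0, 1)\<close> provides suspension points. Because of
  truncated subtraction, the relation is symmetric only away from column \<open>0\<close>.\<close>

fun hex_neighbours :: "nat \<times> nat \<Rightarrow> (nat \<times> nat) set" where
  "hex_neighbours (i, r) = {(i, r + 1), (i, r - 1)} \<union>
     (if i = 1 \<and> odd r then {(2, r + 1)} else {}) \<union> (if i = 2 \<and> even r then {(1, r - 1)} else {}) \<union>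
     (if i = 2 \<and> odd r then {(3, r)} else {}) \<union> (if i = 3 \<and> odd r then {(2, r)} else {})"

definition hex_compat :: "nat \<times> nat \<Rightarrow> nat \<times> nat \<Rightarrow> bool" where
  "hex_compat u v \<longleftrightarrow> v \<notin> hex_neighbours u \<and> u \<notin> hex_neighbours v"

definition inner :: "(nat \<times> nat) set" where
  "inner = {(i, r). 1 \<le> i \<and> 1 \<le> r}"

definition hex_vertices :: "nat \<Rightarrow> (nat \<times> nat) set" where
  "hex_vertices n = {(i, r). 1 \<le> r \<and> ((i = 1 \<or> i = 3) \<and> r \<le> 2 * n + 1 \<or> i = 2 \<and> r \<le> 2 * n + 2)}"

lemma symp_hex_compat: "symp hex_compat"
  by (auto simp: symp_def hex_compat_def)

lemma in_hex_neighbours: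
  "(j, q) \<in> hex_neighbours (i, r) \<longleftrightarrow> j = i \<and> (q = r + 1 \<or> q = r - 1) \<or>
     i = 1 \<and> j = 2 \<and> odd r \<and> q = r + 1 \<or> i = 2 \<and> j = 1 \<and> even r \<and> q = r - 1 \<or>
     i = 2 \<and> j = 3 \<and> odd r \<and> q = r \<or> i = 3 \<and> j = 2 \<and> odd r \<and> q = r"
  unfolding hex_neighbours.simps by (simp split: if_split) blast

lemma hex_neighbours_sym:
  assumes "u \<in> inner" "v \<in> inner"
  shows "u \<in> hex_neighbours v \<longleftrightarrow> v \<in> hex_neighbours u"
proof -
  obtain i r j q where uv: "u = (i, r)" "v = (j, q)" by (cases u; cases v)
  then have "1 \<le> r" "1 \<le> q" using assms by (auto simp: inner_def)
  then show ?thesis unfolding uv in_hex_neighbours by presburger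
qed

lemma hex_compat_inner: "u \<in> inner \<Longrightarrow> v \<in> inner \<Longrightarrow> hex_compat u v \<longleftrightarrow> v \<notin> hex_neighbours u"
  using hex_neighbours_sym by (auto simp: hex_compat_def)

section \<open>The finite grids inside the infinite grid\<close>

lemma in_hex_vertices [simp]:
  "(i, r) \<in> hex_vertices n \<longleftrightarrow> 1 \<le> r \<and> ((i = 1 \<or> i = 3) \<and> r \<le> 2 * n + 1 \<or> i = 2 \<and> r \<le> 2 * n + 2)"
  by (simp add: hex_vertices_def)

lemma hex_vertices_inner: "hex_vertices n \<subseteq> inner"
  by (auto simp: inner_def)

lemma finite_hex_vertices: "finite (hex_vertices n)"
  by (rule finite_subset [of _ "{..3} \<times> {..2 * n + 2}"]) auto

lemma hex_grid_vertices: "fst (hex_grid n) = hex_vertices n"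
  by (auto simp: hex_grid_def hex_vertices_def)

lemma hex_grid_edge_iff:
  assumes "u \<in> hex_vertices n" "v \<in> hex_vertices n"
  shows "{u, v} \<in> snd (hex_grid n) \<longleftrightarrow> \<not> hex_compat u v"
proof -
  obtain i r j q where uv: "u = (i, r)" "v = (j, q)" by (cases u; cases v)
  define arc where "arc i r j q \<longleftrightarrow> (i = j \<and> q = Suc r) \<or> (i = 1 \<and> j = 2 \<and> odd r \<and> q = Suc r) \<or>
    (i = 2 \<and> j = 3 \<and> odd r \<and> q = r)" for i r j q :: nat
  \<comment> \<open>The edge parameter \<open>t\<close> is traded for parity, which leaves the
    comparison with \<open>hex_neighbours\<close> to Presburger arithmetic.\<close>
  have ex1: "(\<exists>t. x = 2 * t - 1 \<and> y = 2 * t \<and> 1 \<le> t \<and> t \<le> n + 1) \<longleftrightarrow> odd x \<and> y = Suc x \<and> x \<le> 2 * n + 1" for x y :: nat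
  proof
    assume "\<exists>t. x = 2 * t - 1 \<and> y = 2 * t \<and> 1 \<le> t \<and> t \<le> n + 1"
    then obtain t where t: "x = 2 * t - 1" "y = 2 * t" "1 \<le> t" "t \<le> n + 1" by blast
    then obtain k where "t = Suc k" by (cases t) auto
    then show "odd x \<and> y = Suc x \<and> x \<le> 2 * n + 1" using t by simp
  next
    assume x: "odd x \<and> y = Suc x \<and> x \<le> 2 * n + 1"
    then obtain k where "x = 2 * k + 1" by (auto elim: oddE)
    then show "\<exists>t. x = 2 * t - 1 \<and> y = 2 * t \<and> 1 \<le> t \<and> t \<le> n + 1"
      using x by (intro exI [of _ "Suc k"]) auto
  qed
  have ex2: "(\<exists>t. x = 2 * t - 1 \<and> y = 2 * t - 1 \<and> 1 \<le> t \<and> t \<le> n + 1) \<longleftrightarrow> odd x \<and> y = x \<and> x \<le> 2 * n + 1" for x y :: nat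
  proof
    assume "\<exists>t. x = 2 * t - 1 \<and> y = 2 * t - 1 \<and> 1 \<le> t \<and> t \<le> n + 1"
    then obtain t where t: "x = 2 * t - 1" "y = 2 * t - 1" "1 \<le> t" "t \<le> n + 1" by blast
    then obtain k where "t = Suc k" by (cases t) auto
    then show "odd x \<and> y = x \<and> x \<le> 2 * n + 1" using t by simp
  next
    assume x: "odd x \<and> y = x \<and> x \<le> 2 * n + 1"
    then obtain k where "x = 2 * k + 1" by (auto elim: oddE)
    then show "\<exists>t. x = 2 * t - 1 \<and> y = 2 * t - 1 \<and> 1 \<le> t \<and> t \<le> n + 1"
      using x by (intro exI [of _ "Suc k"]) auto
  qed
  have e1: "{u, v} \<in> {{(k, r), (k, r + 1)} |r. 1 \<le> r \<and> r \<le> m} \<longleftrightarrow>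
      (i = k \<and> j = k \<and> (q = Suc r \<and> 1 \<le> r \<and> r \<le> m \<or> r = Suc q \<and> 1 \<le> q \<and> q \<le> m))" for k m
    unfolding uv by (auto simp: doubleton_eq_iff)
  have e2: "{u, v} \<in> {{(1, 2 * t - 1), (2, 2 * t)} |t. 1 \<le> t \<and> t \<le> n + 1} \<longleftrightarrow>
      (i = 1 \<and> j = 2 \<and> (\<exists>t. r = 2 * t - 1 \<and> q = 2 * t \<and> 1 \<le> t \<and> t \<le> n + 1)) \<or>
      (j = 1 \<and> i = 2 \<and> (\<exists>t. q = 2 * t - 1 \<and> r = 2 * t \<and> 1 \<le> t \<and> t \<le> n + 1))"
    unfolding uv mem_Collect_eq doubleton_eq_iff prod.inject by blast
  have e3: "{u, v} \<in> {{(2, 2 * t - 1), (3, 2 * t - 1)} |t. 1 \<le> t \<and> t \<le> n + 1} \<longleftrightarrow>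
      (i = 2 \<and> j = 3 \<and> (\<exists>t. r = 2 * t - 1 \<and> q = 2 * t - 1 \<and> 1 \<le> t \<and> t \<le> n + 1)) \<or>
      (j = 2 \<and> i = 3 \<and> (\<exists>t. q = 2 * t - 1 \<and> r = 2 * t - 1 \<and> 1 \<le> t \<and> t \<le> n + 1))"
    unfolding uv mem_Collect_eq doubleton_eq_iff prod.inject by blast
  have "{u, v} \<in> snd (hex_grid n) \<longleftrightarrow> arc i r j q \<or> arc j q i r"
  proof -
    have "i = 1 \<or> i = 2 \<or> i = 3" "j = 1 \<or> j = 2 \<or> j = 3" "1 \<le> r" "1 \<le> q"
      "i = 2 \<and> r \<le> 2 * n + 2 \<or> r \<le> 2 * n + 1" "j = 2 \<and> q \<le> 2 * n + 2 \<or> q \<le> 2 * n + 1"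
      using assms uv by auto
    then show ?thesis
      unfolding hex_grid_def snd_conv Un_iff e1 e2 e3 ex1 ex2 arc_def
      by (elim disjE; simp; presburger)
  qed
  also have "\<dots> \<longleftrightarrow> (j, q) \<in> hex_neighbours (i, r)"
  proof -
    have "1 \<le> r" "1 \<le> q" "i = 1 \<or> i = 2 \<or> i = 3" using assms uv by auto
    then show ?thesis unfolding in_hex_neighbours arc_def by presburger
  qed
  also have "\<dots> \<longleftrightarrow> \<not> hex_compat u v"
    using hex_compat_inner [of u v] assms hex_vertices_inner uv by blast
  finally show ?thesis .
qed

lemma Ind_delete_hex: "Ind (delete_vertices (hex_grid n) S) = clique_space (hex_vertices n - S) hex_compat"
proof -
  \<comment> \<open>\<open>independent_complex\<close> also tests \<open>u = v\<close>, whereas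
    \<open>cliques\<close> does not, so a singleton must not be an edge.\<close>
  have "\<not> {u} \<in> snd (hex_grid n)" for u
    by (auto simp: hex_grid_def)
  then have "independent_complex (delete_vertices (hex_grid n) S) = cliques (hex_vertices n - S) hex_compat"
    unfolding independent_complex_def cliques_def delete_vertices_def fst_conv snd_conv hex_grid_vertices
    using hex_grid_edge_iff by (intro Collect_cong) (smt (verit, ccfv_threshold) Diff_iff empty_subsetI
      insert_absorb2 insert_subset mem_Collect_eq subset_iff)
  then show ?thesis by (simp add: Ind_def)
qed

lemma Ind_hex_grid: "Ind (hex_grid n) = clique_space (hex_vertices n) hex_compat"
proof -
  have "e \<subseteq> hex_vertices n" if "e \<in> snd (hex_grid n)" for e
    using that by (auto simp: hex_grid_def)
  then have "delete_vertices (hex_grid n) {} = hex_grid n"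
    by (auto simp: delete_vertices_def prod_eq_iff hex_grid_vertices)
  then show ?thesis using Ind_delete_hex [of n "{}"] by simp
qed

definition Y_vertices :: "nat \<Rightarrow> (nat \<times> nat) set" where
  "Y_vertices n = hex_vertices n - {(1, 2 * n), (1, 2 * n + 1), (2, 2 * n + 2)}"

lemma Ind_Y_graph: "Ind (Y_graph n) = clique_space (Y_vertices n) hex_compat"
  by (simp add: Y_graph_def Ind_delete_hex Y_vertices_def)

text \<open>Domination is checked at the few neighbours of \<open>w\<close> only, instead of at all
  of \<open>V\<close>. Hence a fold sequence can be verified by simplification even in a grid of
  symbolic length.\<close>

fun hex_folds :: "(nat \<times> nat) set \<Rightarrow> ((nat \<times> nat) \<times> (nat \<times> nat)) list \<Rightarrow> bool" where
  "hex_folds V [] = True"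
| "hex_folds V ((u, w) # ps) \<longleftrightarrow> u \<in> V \<and> w \<in> V \<and> u \<noteq> w \<and> w \<notin> hex_neighbours u \<and>
     (\<forall>x\<in>hex_neighbours w. x \<in> V \<longrightarrow> x \<in> hex_neighbours u) \<and> hex_folds (V - {u}) ps"

lemma folds_hex_folds:
  assumes "V \<subseteq> inner" "hex_folds V ps"
  shows "folds hex_compat V (V - fst ` set ps)"
  using assms
proof (induction V ps rule: hex_folds.induct)
  case (1 V)
  then show ?case by (simp add: folds_refl)
next
  case (2 V u w ps)
  have hc: "hex_compat x y \<longleftrightarrow> y \<notin> hex_neighbours x" if "x \<in> V" "y \<in> V" for x y
    using hex_compat_inner 2(2) that by blast
  have "dominated hex_compat V u w"
    unfolding dominated_def using hc 2(3) unfolding hex_folds.simps by blast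
  moreover have "folds hex_compat (V - {u}) (V - {u} - fst ` set ps)"
    using 2 by auto
  moreover have "V - {u} - fst ` set ps = V - fst ` set ((u, w) # ps)" by auto
  ultimately show ?case using folds_step by metis
qed

text \<open>The listed folds clear all neighbours of \<open>a\<close>; what is left is a cone with
  apex \<open>a\<close>.\<close>

lemma hex_folds_cone:
  assumes "V \<subseteq> inner" "finite V" "hex_folds V ps" "a \<in> V - fst ` set ps"
    "\<forall>x\<in>hex_neighbours a. x \<notin> V - fst ` set ps"
  shows "folds hex_compat V {a}"
proof (rule folds_trans [OF folds_hex_folds [OF assms(1,3)] folds_cone])
  fix x assume "x \<in> V - fst ` set ps"
  moreover from this have "x \<notin> hex_neighbours a" using assms(5) by blast
  ultimately have "hex_compat a x"
    using hex_compat_inner [of a x] assms(1,4) by blast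
  then show "hex_compat x a \<and> hex_compat a x"
    using symp_hex_compat by (auto dest: sympD)
qed (use assms in auto)

lemma hex_link:
  assumes "V \<subseteq> inner" "v \<in> V"
  shows "{x \<in> V. x \<noteq> v \<and> hex_compat v x} = V - insert v (hex_neighbours v)"
  using assms hex_compat_inner by blast

text \<open>Each pair must be an edge of the grid with no neighbour among the other vertices. Again
  only the neighbours of its ends are inspected.\<close>

fun hex_suspending :: "(nat \<times> nat) set \<Rightarrow> ((nat \<times> nat) \<times> (nat \<times> nat)) list \<Rightarrow> bool" where
  "hex_suspending W [] = True"
| "hex_suspending W ((s, t) # ps) \<longleftrightarrow> hex_suspending W ps \<and> s \<in> inner \<and> t \<in> inner \<and>
     s \<notin> add_pairs W ps \<and> t \<notin> add_pairs W ps \<and> s \<noteq> t \<and> t \<in> hex_neighbours s \<and>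
     (\<forall>x\<in>hex_neighbours s. x \<notin> add_pairs W ps) \<and> (\<forall>x\<in>hex_neighbours t. x \<notin> add_pairs W ps)"

lemma hex_suspending_imp:
  assumes "W \<subseteq> inner" "hex_suspending W ps"
  shows "suspending hex_compat W ps \<and> add_pairs W ps \<subseteq> inner"
  using assms
proof (induction W ps rule: hex_suspending.induct)
  case (2 W s t ps)
  then have "suspending hex_compat W ps" and ap: "add_pairs W ps \<subseteq> inner" by auto
  moreover have "hex_compat s x" "hex_compat t x" if "x \<in> add_pairs W ps" for x
    using 2(3) that ap hex_compat_inner [of _ x] unfolding hex_suspending.simps by blast+
  moreover have "\<not> hex_compat s t" using 2(3) unfolding hex_suspending.simps hex_compat_def by blast
  ultimately show ?case using 2(3) by simp
qed simp

section \<open>Suspensions and spheres inside the infinite grid\<close>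

lemma hex_compat_row_zero:
  assumes "x \<in> inner"
  shows "hex_compat (0, 0) x" "hex_compat (0, 1) x"
  using assms by (cases x; auto simp: hex_compat_def inner_def split: if_splits)+

lemma row_zero: "(0, 0) \<notin> inner" "(0, 1) \<notin> inner" "\<not> hex_compat (0, 0) (0, 1)"
  by (auto simp: inner_def hex_compat_def)

lemma suspending_row_zero:
  assumes "W \<subseteq> inner" "hex_suspending W ps"
  shows "suspending hex_compat W (((0, 0), (0, 1)) # ps)"
  using hex_suspending_imp [OF assms] hex_compat_row_zero row_zero by auto

text \<open>The first two claims serve the graph that remains after the splittings; the last two
  serve a link, where the pair in row 0 consists of the poles of the detached suspension.\<close>

lemma hex_iterated_suspension:
  assumes "finite W" "W \<noteq> {}" "W \<subseteq> inner" "hex_suspending W ps" "ps \<noteq> []"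
  shows "iterated_suspension (length ps) (clique_space W hex_compat) homeomorphic_space
      clique_space (add_pairs W ps) hex_compat" (is ?A)
    and "diameter_two (add_pairs W ps) hex_compat" (is ?B)
    and "iterated_suspension (Suc (length ps)) (clique_space W hex_compat) homeomorphic_space
      clique_space (insert (0, 0) (insert (0, 1) (add_pairs W ps))) hex_compat" (is ?C)
    and "diameter_two (insert (0, 0) (insert (0, 1) (add_pairs W ps))) hex_compat" (is ?D)
proof -
  note sus = hex_suspending_imp [OF assms(3,4), THEN conjunct1] and sus0 = suspending_row_zero [OF assms(3,4)]
  show ?A by (rule iterated_suspension_clique_space [OF assms(1,2) symp_hex_compat sus])
  show ?C using iterated_suspension_clique_space [OF assms(1,2) symp_hex_compat sus0] by simp
  obtain s t qs where ps: "ps = (s, t) # qs" using assms(5) by (cases ps) auto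
  have ne: "add_pairs W qs \<noteq> {}" for qs using assms(2) subset_add_pairs [of W qs] by blast
  show ?B unfolding ps by (rule diameter_two_suspending [OF symp_hex_compat]) (use sus ps ne in auto)
  show ?D using diameter_two_suspending [OF symp_hex_compat sus0 ne] by simp
qed

text \<open>\<open>k \<noteq> 0\<close> provides two pairs of vertices: a single pair is the sphere
  of dimension 0, which is disconnected.\<close>

lemma hex_sphere:
  assumes "hex_suspending {} ps" "length ps = Suc k" "k \<noteq> 0"
  shows "nsphere k homeomorphic_space clique_space (add_pairs {} ps) hex_compat" (is ?A)
    and "diameter_two (add_pairs {} ps) hex_compat" (is ?B)
    and "nsphere (Suc k) homeomorphic_space
      clique_space (insert (0, 0) (insert (0, 1) (add_pairs {} ps))) hex_compat" (is ?C)
    and "diameter_two (insert (0, 0) (insert (0, 1) (add_pairs {} ps))) hex_compat" (is ?D)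
proof -
  note sus = hex_suspending_imp [OF empty_subsetI assms(1), THEN conjunct1]
    and sus0 = suspending_row_zero [OF empty_subsetI assms(1)]
  show ?A by (rule nsphere_clique_space [OF symp_hex_compat sus assms(2)])
  show ?C using nsphere_clique_space [OF symp_hex_compat sus0] assms(2) by simp
  obtain p q qs where ps: "ps = p # q # qs"
    using assms(2,3) by (cases ps; cases "tl ps") auto
  obtain s t s' t' where st: "p = (s, t)" "q = (s', t')" by (cases p; cases q)
  show ?B unfolding ps st
    by (rule diameter_two_suspending [OF symp_hex_compat]) (use sus ps st in auto)
  have "add_pairs {} ps \<noteq> {}" by (simp add: ps st)
  then show ?D using diameter_two_suspending [OF symp_hex_compat sus0] by simp
qed

lemma hex_two_splits:
  assumes V: "V \<subseteq> inner" "finite V"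
    and v: "v \<in> V" "U \<subseteq> V - {v}" "V - insert v (hex_neighbours v) \<subseteq> U" "folds hex_compat U {a}"
    and L: "folds hex_compat (V - insert v (hex_neighbours v)) L"
    and w: "w \<in> V - {v}" "U' \<subseteq> V - {v, w}" "V - {v} - insert w (hex_neighbours w) \<subseteq> U'" "folds hex_compat U' {a}"
    and M: "folds hex_compat (V - {v} - insert w (hex_neighbours w)) M"
    and K: "folds hex_compat (V - {v, w}) K" "a \<in> K"
    and Y: "Y0 homeomorphic_space clique_space K hex_compat" "diameter_two K hex_compat"
      "Y1 homeomorphic_space clique_space (insert (0, 0) (insert (0, 1) M)) hex_compat"
      "diameter_two (insert (0, 0) (insert (0, 1) M)) hex_compat"
      "Y2 homeomorphic_space clique_space (insert (0, 0) (insert (0, 1) L)) hex_compat"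
      "diameter_two (insert (0, 0) (insert (0, 1) L)) hex_compat"
  shows "homotopy_equivalent_wedge (clique_space V hex_compat) [Y0, Y1, Y2]"
proof -
  have 1: "{x \<in> V. x \<noteq> v \<and> hex_compat v x} = V - insert v (hex_neighbours v)"
    using V v by (intro hex_link) auto
  have 2: "{x \<in> V - {v}. x \<noteq> w \<and> hex_compat w x} = V - {v} - insert w (hex_neighbours w)"
    using V w by (intro hex_link) auto
  have 3: "V - {v} - {w} = V - {v, w}" by auto
  show ?thesis
    by (rule wedge_of_two_splits [where v = v and w = w and U = U and U' = U' and a = a and K = K and L = L and M = M
          and s = "(0, 0)" and t = "(0, 1)", OF V(2) symp_hex_compat v(1), unfolded 1 2 3])
      (use assms row_zero hex_compat_row_zero in \<open>auto dest: subsetD\<close>)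
qed

lemma hex_split:
  assumes V: "V \<subseteq> inner" "finite V"
    and v: "v \<in> V" "U \<subseteq> V - {v}" "V - insert v (hex_neighbours v) \<subseteq> U" "folds hex_compat U {a}"
    and L: "folds hex_compat (V - insert v (hex_neighbours v)) L"
    and K: "folds hex_compat (V - {v}) K" "a \<in> K"
    and Y: "Y0 homeomorphic_space clique_space K hex_compat" "diameter_two K hex_compat"
      "Y1 homeomorphic_space clique_space (insert (0, 0) (insert (0, 1) L)) hex_compat"
      "diameter_two (insert (0, 0) (insert (0, 1) L)) hex_compat"
  shows "homotopy_equivalent_wedge (clique_space V hex_compat) [Y0, Y1]"
proof -
  have 1: "{x \<in> V. x \<noteq> v \<and> hex_compat v x} = V - insert v (hex_neighbours v)"
    using V v by (intro hex_link) auto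
  show ?thesis
    by (rule wedge_of_split [where v = v and U = U and a = a and K = K and L = L
          and s = "(0, 0)" and t = "(0, 1)", OF V(2) symp_hex_compat v(1), unfolded 1])
      (use assms row_zero hex_compat_row_zero in \<open>auto dest: subsetD\<close>)
qed

section \<open>The splittings of the grids\<close>

text \<open>In each case the pairs in \<open>?D\<close>, \<open>?K\<close>, \<open>?L\<close>, \<open>?M\<close> are a removed vertex and the vertex
  dominating it, in the order of removal; the pairs in \<open>?PK\<close>, \<open>?PL\<close>, \<open>?PM\<close> are the isolated edges
  that survive. The sequences were found by computer search.\<close>

lemma nat_cases_below_9: "r = 0 \<or> r = 1 \<or> r = 2 \<or> r = 3 \<or> r = 4 \<or> r = 5 \<or> r = 6 \<or> r = 7 \<or> r = 8 \<or> 9 \<le> r"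
  for r :: nat
  by linarith

lemma hex_wedge_1: "homotopy_equivalent_wedge (Ind (hex_grid 1)) [nsphere 2, nsphere 2]"
proof -
  \<comment> \<open>Without \<open>(2, 3)\<close>, the apex \<open>(3, 3)\<close> has
    \<open>(3, 2)\<close> as its only neighbour, and the fold in \<open>?D\<close> removes that one.
    Three edges give the sphere of dimension 2 for \<open>?PK\<close>; for \<open>?PL\<close> two
    edges and the poles do.\<close>
  let ?V = "hex_vertices 1" and ?v = "(2, 2)" and ?U = "hex_vertices 1 - {(2, 2), (2, 3)}"
  let ?D = "[((3, 2), (2, 1))] :: ((nat \<times> nat) \<times> (nat \<times> nat)) list"
  let ?K = "[((1, 3), (1, 1)), ((3, 2), (2, 1)),
    ((2, 4), (3, 3))] :: ((nat \<times> nat) \<times> (nat \<times> nat)) list"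
  let ?L = "[((1, 2), (2, 4)), ((3, 1), (3, 3))] :: ((nat \<times> nat) \<times> (nat \<times> nat)) list"
  let ?PK = "[((1, 1), (1, 2)), ((2, 1), (3, 1)),
    ((2, 3), (3, 3))] :: ((nat \<times> nat) \<times> (nat \<times> nat)) list"
  let ?PL = "[((1, 3), (2, 4)), ((3, 2), (3, 3))] :: ((nat \<times> nat) \<times> (nat \<times> nat)) list"
  note inn = hex_vertices_inner [of 1]
  have D: "folds hex_compat ?U {(3, 3)}"
    by (rule hex_folds_cone [where ps = ?D]) (use inn finite_hex_vertices in auto)
  have "hex_folds (?V - {?v}) ?K" by simp
  then have K: "folds hex_compat (?V - {?v}) (?V - {?v} - fst ` set ?K)"
    by (intro folds_hex_folds) (use inn in auto)
  have Keq: "?V - {?v} - fst ` set ?K = add_pairs {} ?PK"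
  proof (rule set_eqI, clarify)
    fix i r
    show "(i, r) \<in> ?V - {?v} - fst ` set ?K \<longleftrightarrow> (i, r) \<in> add_pairs {} ?PK"
      using nat_cases_below_9 [of r] by (elim disjE) auto
  qed
  have "hex_folds (?V - insert ?v (hex_neighbours ?v)) ?L" by simp
  then have L: "folds hex_compat (?V - insert ?v (hex_neighbours ?v)) (?V - insert ?v (hex_neighbours ?v) - fst ` set ?L)"
    by (intro folds_hex_folds) (use inn in auto)
  have Leq: "?V - insert ?v (hex_neighbours ?v) - fst ` set ?L = add_pairs {} ?PL"
  proof (rule set_eqI, clarify)
    fix i r
    show "(i, r) \<in> ?V - insert ?v (hex_neighbours ?v) - fst ` set ?L \<longleftrightarrow> (i, r) \<in> add_pairs {} ?PL"
      using nat_cases_below_9 [of r] by (elim disjE) auto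
  qed
  have sK: "hex_suspending {} ?PK" and sL: "hex_suspending {} ?PL"
    by (simp_all add: inner_def)
  have Y0: "nsphere 2 homeomorphic_space clique_space (add_pairs {} ?PK) hex_compat"
    "diameter_two (add_pairs {} ?PK) hex_compat"
    by (rule hex_sphere(1,2) [OF sK, of 2]; simp)+
  have suc: "Suc 1 = 2" by simp
  have Y1: "nsphere 2 homeomorphic_space clique_space (insert (0, 0) (insert (0, 1) (add_pairs {} ?PL))) hex_compat"
    "diameter_two (insert (0, 0) (insert (0, 1) (add_pairs {} ?PL))) hex_compat"
    by (rule hex_sphere(3,4) [OF sL, of 1, unfolded suc]; simp)+
  show ?thesis
    unfolding Ind_hex_grid
    by (rule hex_split [OF inn finite_hex_vertices _ _ _ D L [unfolded Leq] K [unfolded Keq] _ Y0 Y1]) auto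
qed

lemma hex_wedge_3: "homotopy_equivalent_wedge (Ind (hex_grid 3)) [nsphere 5, nsphere 6]"
proof -
  \<comment> \<open>The folds in \<open>?D\<close> remove the neighbours \<open>(3, 3)\<close> and
    \<open>(3, 5)\<close> of the apex \<open>(3, 4)\<close>. Both \<open>?PK\<close> and
    \<open>?PL\<close> have six edges; the poles raise the dimension to 6 for the link.\<close>
  let ?V = "hex_vertices 3" and ?v = "(1, 2)" and ?U = "hex_vertices 3 - {(1, 2), (1, 3)}"
  let ?D = "[((2, 1), (1, 1)), ((3, 3), (3, 1)), ((2, 3), (1, 1)),
    ((3, 5), (2, 4))] :: ((nat \<times> nat) \<times> (nat \<times> nat)) list"
  let ?K = "[((2, 3), (1, 1)), ((2, 1), (1, 1)), ((3, 3), (3, 1)), ((2, 5), (3, 4)), ((3, 6), (3, 4)),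
    ((1, 4), (2, 4)), ((2, 8), (3, 7)), ((1, 5), (1, 7)),
    ((2, 6), (3, 7))] :: ((nat \<times> nat) \<times> (nat \<times> nat)) list"
  let ?L = "[((2, 6), (1, 4)), ((1, 6), (1, 4)), ((2, 7), (1, 7)), ((3, 5), (3, 7)), ((2, 3), (3, 4)),
    ((3, 2), (3, 4)), ((3, 1), (2, 2))] :: ((nat \<times> nat) \<times> (nat \<times> nat)) list"
  let ?PK = "[((1, 1), (2, 2)), ((1, 3), (2, 4)), ((1, 6), (1, 7)), ((2, 7), (3, 7)), ((3, 1), (3, 2)),
    ((3, 4), (3, 5))] :: ((nat \<times> nat) \<times> (nat \<times> nat)) list"
  let ?PL = "[((1, 4), (1, 5)), ((1, 7), (2, 8)), ((2, 1), (2, 2)), ((2, 4), (2, 5)), ((3, 3), (3, 4)),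
    ((3, 6), (3, 7))] :: ((nat \<times> nat) \<times> (nat \<times> nat)) list"
  note inn = hex_vertices_inner [of 3]
  have D: "folds hex_compat ?U {(3, 4)}"
    by (rule hex_folds_cone [where ps = ?D]) (use inn finite_hex_vertices in auto)
  have "hex_folds (?V - {?v}) ?K" by simp
  then have K: "folds hex_compat (?V - {?v}) (?V - {?v} - fst ` set ?K)"
    by (intro folds_hex_folds) (use inn in auto)
  have Keq: "?V - {?v} - fst ` set ?K = add_pairs {} ?PK"
  proof (rule set_eqI, clarify)
    fix i r
    show "(i, r) \<in> ?V - {?v} - fst ` set ?K \<longleftrightarrow> (i, r) \<in> add_pairs {} ?PK"
      using nat_cases_below_9 [of r] by (elim disjE) auto
  qed
  have "hex_folds (?V - insert ?v (hex_neighbours ?v)) ?L" by simp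
  then have L: "folds hex_compat (?V - insert ?v (hex_neighbours ?v)) (?V - insert ?v (hex_neighbours ?v) - fst ` set ?L)"
    by (intro folds_hex_folds) (use inn in auto)
  have Leq: "?V - insert ?v (hex_neighbours ?v) - fst ` set ?L = add_pairs {} ?PL"
  proof (rule set_eqI, clarify)
    fix i r
    show "(i, r) \<in> ?V - insert ?v (hex_neighbours ?v) - fst ` set ?L \<longleftrightarrow> (i, r) \<in> add_pairs {} ?PL"
      using nat_cases_below_9 [of r] by (elim disjE) auto
  qed
  have sK: "hex_suspending {} ?PK" and sL: "hex_suspending {} ?PL"
    by (simp_all add: inner_def)
  have Y0: "nsphere 5 homeomorphic_space clique_space (add_pairs {} ?PK) hex_compat"
    "diameter_two (add_pairs {} ?PK) hex_compat"
    by (rule hex_sphere(1,2) [OF sK, of 5]; simp)+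
  have suc: "Suc 5 = 6" by simp
  have Y1: "nsphere 6 homeomorphic_space clique_space (insert (0, 0) (insert (0, 1) (add_pairs {} ?PL))) hex_compat"
    "diameter_two (insert (0, 0) (insert (0, 1) (add_pairs {} ?PL))) hex_compat"
    by (rule hex_sphere(3,4) [OF sL, of 5, unfolded suc]; simp)+
  show ?thesis
    unfolding Ind_hex_grid
    by (rule hex_split [OF inn finite_hex_vertices _ _ _ D L [unfolded Leq] K [unfolded Keq] _ Y0 Y1]) auto
qed

text \<open>In the general case all vertices in columns up to \<open>2 * m + 1\<close> are kept. The
  columns from \<open>2 * m + 2\<close> to \<open>2 * m + 10\<close>, the last one of
  \<open>hex_grid (m + 4)\<close>, are compared one by one.\<close>

lemma nat_cases_between: "r \<le> 2 * m + 1 \<or> r = 2 * m + 2 \<or> r = 2 * m + 3 \<or> r = 2 * m + 4 \<or> r = 2 * m + 5 \<or>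
    r = 2 * m + 6 \<or> r = 2 * m + 7 \<or> r = 2 * m + 8 \<or> r = 2 * m + 9 \<or> r = 2 * m + 10 \<or> 2 * m + 11 \<le> r"
  for r m :: nat
  by linarith

lemma hex_wedge_2: "homotopy_equivalent_wedge (Ind (hex_grid 2)) [nsphere 4, nsphere 4, nsphere 4]"
proof -
  let ?V = "hex_vertices 2" and ?v = "(2, 4)" and ?w = "(1, 4)"
  \<comment> \<open>The common apex is \<open>(2, 3)\<close>, a neighbour of \<open>?v\<close> that
    \<open>?U\<close> adds to the link. Its other neighbours \<open>(2, 2)\<close> and
    \<open>(3, 3)\<close> are folded away. \<open>?U'\<close> adds \<open>(1, 5)\<close> to the link
    of \<open>?w\<close>, because it dominates \<open>(2, 5)\<close>, which must go before
    \<open>(3, 3)\<close> folds onto \<open>(3, 5)\<close>.\<close>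
  let ?U = "?V - {(2, 4), (1, 3), (2, 5)}" and ?U' = "?V - {(2, 4), (1, 4), (1, 3)}"
  let ?D = "[((3, 3), (3, 5)), ((2, 2), (1, 2))] :: ((nat \<times> nat) \<times> (nat \<times> nat)) list"
  let ?D' = "[((2, 5), (1, 5)), ((2, 2), (1, 2)),
    ((3, 3), (3, 5))] :: ((nat \<times> nat) \<times> (nat \<times> nat)) list"
  let ?K = "[((2, 5), (1, 5)), ((3, 3), (3, 5)), ((1, 1), (2, 3)),
    ((2, 1), (3, 2))] :: ((nat \<times> nat) \<times> (nat \<times> nat)) list"
  let ?L = "[((3, 3), (3, 5)), ((2, 6), (1, 4)), ((2, 1), (3, 2)),
    ((1, 2), (2, 2))] :: ((nat \<times> nat) \<times> (nat \<times> nat)) list"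
  let ?M = "[((2, 2), (1, 2)), ((3, 2), (2, 3)), ((3, 5), (2, 6)),
    ((2, 3), (3, 4))] :: ((nat \<times> nat) \<times> (nat \<times> nat)) list"
  let ?PK = "[((1, 2), (1, 3)), ((1, 5), (2, 6)), ((2, 2), (2, 3)), ((3, 1), (3, 2)),
    ((3, 4), (3, 5))] :: ((nat \<times> nat) \<times> (nat \<times> nat)) list"
  let ?PL = "[((1, 1), (2, 2)), ((1, 4), (1, 5)), ((3, 1), (3, 2)),
    ((3, 4), (3, 5))] :: ((nat \<times> nat) \<times> (nat \<times> nat)) list"
  let ?PM = "[((1, 1), (1, 2)), ((2, 1), (3, 1)), ((2, 5), (2, 6)),
    ((3, 3), (3, 4))] :: ((nat \<times> nat) \<times> (nat \<times> nat)) list"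
  note inn = hex_vertices_inner [of "2"]
  have D: "folds hex_compat ?U {(2, 3)}"
    by (rule hex_folds_cone [where ps = ?D]) (use inn finite_hex_vertices in auto)
  have D': "folds hex_compat ?U' {(2, 3)}"
    by (rule hex_folds_cone [where ps = ?D']) (use inn finite_hex_vertices in auto)
  have "hex_folds (?V - {?v, ?w}) ?K" by simp
  then have K: "folds hex_compat (?V - {?v, ?w}) (?V - {?v, ?w} - fst ` set ?K)"
    by (intro folds_hex_folds) (use inn in auto)
  have Keq: "?V - {?v, ?w} - fst ` set ?K = add_pairs {} ?PK"
  proof (rule set_eqI, clarify)
    fix i r
    show "(i, r) \<in> ?V - {?v, ?w} - fst ` set ?K \<longleftrightarrow> (i, r) \<in> add_pairs {} ?PK"
      using nat_cases_below_9 [of r] by (elim disjE) (auto simp: Y_vertices_def)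
  qed
  have "hex_folds (?V - insert ?v (hex_neighbours ?v)) ?L" by simp
  then have L: "folds hex_compat (?V - insert ?v (hex_neighbours ?v)) (?V - insert ?v (hex_neighbours ?v) - fst ` set ?L)"
    by (intro folds_hex_folds) (use inn in auto)
  have Leq: "?V - insert ?v (hex_neighbours ?v) - fst ` set ?L = add_pairs {} ?PL"
  proof (rule set_eqI, clarify)
    fix i r
    show "(i, r) \<in> ?V - insert ?v (hex_neighbours ?v) - fst ` set ?L \<longleftrightarrow> (i, r) \<in> add_pairs {} ?PL"
      using nat_cases_below_9 [of r] by (elim disjE) (auto simp: Y_vertices_def)
  qed
  have "hex_folds (?V - {?v} - insert ?w (hex_neighbours ?w)) ?M" by simp
  then have M: "folds hex_compat (?V - {?v} - insert ?w (hex_neighbours ?w))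
      (?V - {?v} - insert ?w (hex_neighbours ?w) - fst ` set ?M)"
    by (intro folds_hex_folds) (use inn in auto)
  have Meq: "?V - {?v} - insert ?w (hex_neighbours ?w) - fst ` set ?M = add_pairs {} ?PM"
  proof (rule set_eqI, clarify)
    fix i r
    show "(i, r) \<in> ?V - {?v} - insert ?w (hex_neighbours ?w) - fst ` set ?M \<longleftrightarrow> (i, r) \<in> add_pairs {} ?PM"
      using nat_cases_below_9 [of r] by (elim disjE) (auto simp: Y_vertices_def)
  qed
  have sK: "hex_suspending {} ?PK" and sL: "hex_suspending {} ?PL" and sM: "hex_suspending {} ?PM"
    by (simp_all add: inner_def Y_vertices_def)
  have Y0: "nsphere 4 homeomorphic_space clique_space (add_pairs {} ?PK) hex_compat"
    "diameter_two (add_pairs {} ?PK) hex_compat"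
    by (rule hex_sphere(1,2) [OF sK, of 4]; simp)+
  have suc: "Suc 3 = 4" by simp
  have Y1: "nsphere 4 homeomorphic_space clique_space (insert (0, 0) (insert (0, 1) (add_pairs {} ?PM))) hex_compat"
    "diameter_two (insert (0, 0) (insert (0, 1) (add_pairs {} ?PM))) hex_compat"
    by (rule hex_sphere(3,4) [OF sM, of 3, unfolded suc]; simp)+
  have Y2: "nsphere 4 homeomorphic_space clique_space (insert (0, 0) (insert (0, 1) (add_pairs {} ?PL))) hex_compat"
    "diameter_two (insert (0, 0) (insert (0, 1) (add_pairs {} ?PL))) hex_compat"
    by (rule hex_sphere(3,4) [OF sL, of 3, unfolded suc]; simp)+
  show ?thesis
    unfolding Ind_hex_grid Ind_Y_graph
    by (rule hex_two_splits [OF inn finite_hex_vertices _ _ _ D L [unfolded Leq] _ _ _ D' M [unfolded Meq]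
          K [unfolded Keq] _ Y0 Y1 Y2]) auto
qed

text \<open>With \<open>n = m + 4\<close> no column index involves a truncated subtraction;
  \<open>n - 3\<close> and \<open>n - 2\<close> become \<open>m + 1\<close> and
  \<open>m + 2\<close>.\<close>

lemma hex_wedge_general: "homotopy_equivalent_wedge (Ind (hex_grid (m + 4)))
    [iterated_suspension 6 (Ind (Y_graph (m + 1))),
     iterated_suspension 4 (Ind (Y_graph (m + 2))),
     iterated_suspension 5 (Ind (hex_grid (m + 1)))]"
proof -
  let ?V = "hex_vertices (m + 4)" and ?v = "(2, 2 * m + 8)" and ?w = "(1, 2 * m + 8)"
  \<comment> \<open>The sets for \<open>hex_grid 2\<close>, moved to the right end of the long grid;
    the apex is \<open>(2, 2 * m + 7)\<close>.\<close>
  let ?U = "?V - {(2, 2 * m + 8), (1, 2 * m + 7), (2, 2 * m + 9)}" and ?U' = "?V - {(2, 2 * m + 8), (1, 2 * m + 8), (1, 2 * m + 7)}"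
  let ?D = "[((2, 2 * m + 10), (1, 2 * m + 8)), ((3, 2 * m + 7), (3, 2 * m + 9)),
    ((2, 2 * m + 6), (1, 2 * m + 6))] :: ((nat \<times> nat) \<times> (nat \<times> nat)) list"
  let ?D' = "[((2, 2 * m + 9), (1, 2 * m + 9)), ((3, 2 * m + 7), (3, 2 * m + 9)),
    ((2, 2 * m + 6), (1, 2 * m + 6))] :: ((nat \<times> nat) \<times> (nat \<times> nat)) list"
  let ?K = "[((2, 2 * m + 9), (1, 2 * m + 9)), ((3, 2 * m + 7), (3, 2 * m + 9)),
    ((2, 2 * m + 5), (2, 2 * m + 7)), ((1, 2 * m + 5), (2, 2 * m + 7)),
    ((3, 2 * m + 4), (3, 2 * m + 6)), ((2, 2 * m + 4), (1, 2 * m + 4)),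
    ((1, 2 * m + 2), (1, 2 * m + 4))] :: ((nat \<times> nat) \<times> (nat \<times> nat)) list"
  let ?L = "[((2, 2 * m + 10), (1, 2 * m + 8)), ((3, 2 * m + 7), (3, 2 * m + 9)),
    ((2, 2 * m + 6), (1, 2 * m + 6)), ((2, 2 * m + 5), (3, 2 * m + 6)),
    ((3, 2 * m + 4), (3, 2 * m + 6)),
    ((1, 2 * m + 4), (1, 2 * m + 6))] :: ((nat \<times> nat) \<times> (nat \<times> nat)) list"
  let ?M = "[((3, 2 * m + 9), (2, 2 * m + 10)), ((2, 2 * m + 7), (3, 2 * m + 8)),
    ((3, 2 * m + 6), (3, 2 * m + 8)), ((2, 2 * m + 6), (1, 2 * m + 6)),
    ((1, 2 * m + 4), (1, 2 * m + 6))] :: ((nat \<times> nat) \<times> (nat \<times> nat)) list"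
  \<comment> \<open>This shows where \<open>Y_graph\<close> comes from: of its three deleted
    vertices, \<open>(1, 2 * m + 2)\<close> and \<open>(2, 2 * m + 4)\<close> are folded away in
    \<open>?K\<close>, and \<open>(1, 2 * m + 3)\<close> survives in an isolated edge. In
    \<open>?M\<close> the same happens two columns further on.\<close>
  let ?PK = "[((3, 2 * m + 6), (3, 2 * m + 5)), ((3, 2 * m + 9), (3, 2 * m + 8)),
    ((2, 2 * m + 7), (2, 2 * m + 6)), ((2, 2 * m + 10), (1, 2 * m + 9)),
    ((1, 2 * m + 7), (1, 2 * m + 6)),
    ((1, 2 * m + 4), (1, 2 * m + 3))] :: ((nat \<times> nat) \<times> (nat \<times> nat)) list"
  let ?PL = "[((3, 2 * m + 6), (3, 2 * m + 5)), ((3, 2 * m + 9), (3, 2 * m + 8)),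
    ((1, 2 * m + 5), (1, 2 * m + 6)),
    ((1, 2 * m + 8), (1, 2 * m + 9))] :: ((nat \<times> nat) \<times> (nat \<times> nat)) list"
  let ?PM = "[((1, 2 * m + 5), (1, 2 * m + 6)), ((2, 2 * m + 10), (2, 2 * m + 9)),
    ((3, 2 * m + 8), (3, 2 * m + 7))] :: ((nat \<times> nat) \<times> (nat \<times> nat)) list"
  note inn = hex_vertices_inner [of "(m + 4)"]
  have D: "folds hex_compat ?U {(2, 2 * m + 7)}"
    by (rule hex_folds_cone [where ps = ?D]) (use inn finite_hex_vertices in auto)
  have D': "folds hex_compat ?U' {(2, 2 * m + 7)}"
    by (rule hex_folds_cone [where ps = ?D']) (use inn finite_hex_vertices in auto)
  have "hex_folds (?V - {?v, ?w}) ?K" by simp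
  then have K: "folds hex_compat (?V - {?v, ?w}) (?V - {?v, ?w} - fst ` set ?K)"
    by (intro folds_hex_folds) (use inn in auto)
  have Keq: "?V - {?v, ?w} - fst ` set ?K = add_pairs (Y_vertices (m + 1)) ?PK"
  proof (rule set_eqI, clarify)
    fix i r
    show "(i, r) \<in> ?V - {?v, ?w} - fst ` set ?K \<longleftrightarrow> (i, r) \<in> add_pairs (Y_vertices (m + 1)) ?PK"
      using nat_cases_between [of r m] by (elim disjE) (auto simp: Y_vertices_def)
  qed
  have "hex_folds (?V - insert ?v (hex_neighbours ?v)) ?L" by simp
  then have L: "folds hex_compat (?V - insert ?v (hex_neighbours ?v)) (?V - insert ?v (hex_neighbours ?v) - fst ` set ?L)"
    by (intro folds_hex_folds) (use inn in auto)
  have Leq: "?V - insert ?v (hex_neighbours ?v) - fst ` set ?L = add_pairs (hex_vertices (m + 1)) ?PL"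
  proof (rule set_eqI, clarify)
    fix i r
    show "(i, r) \<in> ?V - insert ?v (hex_neighbours ?v) - fst ` set ?L \<longleftrightarrow> (i, r) \<in> add_pairs (hex_vertices (m + 1)) ?PL"
      using nat_cases_between [of r m] by (elim disjE) (auto simp: Y_vertices_def)
  qed
  have "hex_folds (?V - {?v} - insert ?w (hex_neighbours ?w)) ?M" by simp
  then have M: "folds hex_compat (?V - {?v} - insert ?w (hex_neighbours ?w))
      (?V - {?v} - insert ?w (hex_neighbours ?w) - fst ` set ?M)"
    by (intro folds_hex_folds) (use inn in auto)
  have Meq: "?V - {?v} - insert ?w (hex_neighbours ?w) - fst ` set ?M = add_pairs (Y_vertices (m + 2)) ?PM"
  proof (rule set_eqI, clarify)
    fix i r
    show "(i, r) \<in> ?V - {?v} - insert ?w (hex_neighbours ?w) - fst ` set ?M \<longleftrightarrow> (i, r) \<in> add_pairs (Y_vertices (m + 2)) ?PM"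
      using nat_cases_between [of r m] by (elim disjE) (auto simp: Y_vertices_def)
  qed
  have sK: "hex_suspending (Y_vertices (m + 1)) ?PK" and sL: "hex_suspending (hex_vertices (m + 1)) ?PL" and sM: "hex_suspending (Y_vertices (m + 2)) ?PM"
    by (simp_all add: inner_def Y_vertices_def)
  have sub: "Y_vertices k \<subseteq> inner" "finite (Y_vertices k)" "hex_vertices k \<subseteq> inner" "finite (hex_vertices k)" for k
    using hex_vertices_inner finite_hex_vertices by (auto simp: Y_vertices_def)
  have ne: "(2, 1) \<in> Y_vertices (m + 1)" "(2, 1) \<in> Y_vertices (m + 2)" "(2, 1) \<in> hex_vertices (m + 1)"
    by (auto simp: Y_vertices_def)
  have e6: "length ?PK = 6" and e4: "Suc (length ?PM) = 4" and e5: "Suc (length ?PL) = 5" by simp_all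
  have Y0: "iterated_suspension 6 (clique_space (Y_vertices (m + 1)) hex_compat) homeomorphic_space
      clique_space (add_pairs (Y_vertices (m + 1)) ?PK) hex_compat"
    "diameter_two (add_pairs (Y_vertices (m + 1)) ?PK) hex_compat"
    by (rule hex_iterated_suspension(1,2) [OF _ _ _ sK, unfolded e6]; use sub ne in blast)+
  have Y1: "iterated_suspension 4 (clique_space (Y_vertices (m + 2)) hex_compat) homeomorphic_space
      clique_space (insert (0, 0) (insert (0, 1) (add_pairs (Y_vertices (m + 2)) ?PM))) hex_compat"
    "diameter_two (insert (0, 0) (insert (0, 1) (add_pairs (Y_vertices (m + 2)) ?PM))) hex_compat"
    by (rule hex_iterated_suspension(3,4) [OF _ _ _ sM, unfolded e4]; use sub ne in blast)+
  have Y2: "iterated_suspension 5 (clique_space (hex_vertices (m + 1)) hex_compat) homeomorphic_space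
      clique_space (insert (0, 0) (insert (0, 1) (add_pairs (hex_vertices (m + 1)) ?PL))) hex_compat"
    "diameter_two (insert (0, 0) (insert (0, 1) (add_pairs (hex_vertices (m + 1)) ?PL))) hex_compat"
    by (rule hex_iterated_suspension(3,4) [OF _ _ _ sL, unfolded e5]; use sub ne in blast)+
  show ?thesis
    unfolding Ind_hex_grid Ind_Y_graph
    by (rule hex_two_splits [OF inn finite_hex_vertices _ _ _ D L [unfolded Leq] _ _ _ D' M [unfolded Meq]
          K [unfolded Keq] _ Y0 Y1 Y2]) auto
qed

theorem theorem4p6:
  fixes n :: nat
  assumes "n \<ge> 1"
  shows "(n = 1 \<longrightarrow> homotopy_equivalent_wedge (Ind (hex_grid n)) [nsphere 2, nsphere 2]) \<and>
         (n = 2 \<longrightarrow> homotopy_equivalent_wedge (Ind (hex_grid n)) [nsphere 4, nsphere 4, nsphere 4]) \<and>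
         (n = 3 \<longrightarrow> homotopy_equivalent_wedge (Ind (hex_grid n)) [nsphere 5, nsphere 6]) \<and>
         (n \<ge> 4 \<longrightarrow> homotopy_equivalent_wedge (Ind (hex_grid n))
            [iterated_suspension 6 (Ind (Y_graph (n - 3))),
             iterated_suspension 4 (Ind (Y_graph (n - 2))),
             iterated_suspension 5 (Ind (hex_grid (n - 3)))])"
proof (intro conjI impI)
  assume "4 \<le> n"
  then obtain m where "n = m + 4" by (metis add.commute le_Suc_ex)
  then show "homotopy_equivalent_wedge (Ind (hex_grid n))
      [iterated_suspension 6 (Ind (Y_graph (n - 3))),
       iterated_suspension 4 (Ind (Y_graph (n - 2))),
       iterated_suspension 5 (Ind (hex_grid (n - 3)))]"
    using hex_wedge_general [of m] by simp
qed (use hex_wedge_1 hex_wedge_2 hex_wedge_3 in auto)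

end
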